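(* Let $\Lambda_1,\Lambda_2$ be two-sided subshifts. The following assertions are equivalent: (i) $\Lambda_1$ and $\Lambda_2$ are topologically conjugate. (ii) There exist an isomorphism $\varphi:\mathcal{G}_{\Lambda_1}\to\mathcal{G}_{\Lambda_2}$ of étale groupoids and a homeomorphism $h_\Lambda:\Lambda_1\to\Lambda_2$ of the shift spaces such that $$\varphi(R_{\Lambda_1})=R_{\Lambda_2},\qquad h_\Lambda\circ\pi_1=\pi_2\circ h,\qquad d_{\Lambda_2}\circ\varphi=d_{\Lambda_1},$$ where $h=\varphi|_{\mathcal{G}_{\Lambda_1}^{(0)}}:\mathcal{G}_{\Lambda_1}^{(0)}\to\mathcal{G}_{\Lambda_2}^{(0)}$ is the restriction of $\varphi$ to the unit space, and $\pi_i:\mathcal{X}_{\Lambda_i}\to\Lambda_i$, $i=1,2$, is the factor map.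
   Context: **$\lambda$-graph bisystem.** Let $\Sigma$ be a finite set. A $\lambda$-graph bisystem $\mathcal{L}=(\mathcal{L}^-,\mathcal{L}^+)$ over $\Sigma$ consists of two labeled Bratteli diagrams $\mathcal{L}^{-}=(V,E^{-},\lambda^{-})$, $\mathcal{L}^{+}=(V,E^{+},\lambda^{+})$ with common vertex set $V=\bigcup_{l\ge 0}V_l$ and edge sets $E^-=\bigcup_{l\ge0}E^-_{l+1,l}$, $E^+=\bigcup_{l\ge0}E^+_{l,l+1}$ (all $V_l$, $E^-_{l+1,l}$, $E^+_{l,l+1}$ are finite, nonempty and pairwise disjoint, and $V_0$ is a singleton). An edge $e^-\in E^-_{l+1,l}$ has source $s(e^-)\in V_{l+1}$ and terminal $t(e^-)\in V_l$; an edge $e^+\in E^+_{l,l+1}$ has source $s(e^+)\in V_l$ and terminal $t(e^+)\in V_{l+1}$; labels are given by $\lambda^\pm:E^\pm\to\Sigma$. Required: (1) $\mathcal{L}^-$ is right-resolving: distinct $e^-,f^-\in E^-_{l+1,l}$ with $s(e^-)=s(f^-)$ have $\lambda^-(e^-)\neq\lambda^-(f^-)$; (2) $\mathcal{L}^+$ is left-resolving: distinct $e^+,f^+\in E^+_{l,l+1}$ with $t(e^+)=t(f^+)$ have $\lambda^+(e^+)\ne\lambda^+(f^+)$; (3) local property: for all $u\in V_l$, $v\in V_{l+2}$ there is a bijection $\phi$ from $\{(f^+,f^-)\in E^+_{l,l+1}\times E^-_{l+2,l+1}: s(f^+)=u,\ t(f^+)=t(f^-),\ s(f^-)=v\}$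 onto $\{(e^-,e^+)\in E^-_{l+1,l}\times E^+_{l+1,l+2}: t(e^-)=u,\ s(e^-)=s(e^+),\ t(e^+)=v\}$ such that $\phi(f^+,f^-)=(e^-,e^+)$ implies $\lambda^+(f^+)=\lambda^+(e^+)$ and $\lambda^-(f^-)=\lambda^-(e^-)$. For $v\in V_l$, let $F(v)\subset\Sigma^l$ be the set of words $(\lambda^-(e^-_l),\dots,\lambda^-(e^-_1))$ with $e^-_n\in E^-_{n,n-1}$, $s(e^-_l)=v$, $t(e_n^-)=s(e_{n-1}^-)$, and let $P(v)\subset\Sigma^l$ be the set of words $(\lambda^+(e^+_1),\dots,\lambda^+(e^+_l))$ with $e^+_n\in E^+_{n-1,n}$, $t(e^+_l)=v$, $s(e^+_n)=t(e^+_{n-1})$. FPCC means $F(v)=P(v)$ for all $v\in V$. **Configuration space.** Let $\mathbb{Z}^2[<]=\{(k,l)\in\mathbb{Z}^2: k<l\}$, $n(k,l)=l-k-1$, $V_{(k,l)}=V_{n(k,l)}$, $E^-_{(k-1,k),l}=E^-_{n(k-1,l),n(k,l)}$, $E^+_{k,(l,l+1)}=E^+_{n(k,l),n(k,l+1)}$. $\mathcal{X}_{\mathcal{L}}$ is the set of configurations $x=\{(v_{(k,l)},e^-_{(k-1,k),l},e^+_{k,(l,l+1)})\}_{(k,l)\in\mathbb{Z}^2[<]}$ with $v_{(k,l)}\in V_{(k,l)}$, $e^-_{(k-1,k),l}\in E^-_{(k-1,k),l}$, $e^+_{k,(l,l+1)}\in E^+_{k,(l,l+1)}$, such that $s(e^-_{(k-1,k),l})=v_{(k-1,l)}$,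 $t(e^-_{(k-1,k),l})=v_{(k,l)}$, $s(e^+_{k,(l,l+1)})=v_{(k,l)}$, $t(e^+_{k,(l,l+1)})=v_{(k,l+1)}$, and such that there is $(x_n)_{n\in\mathbb{Z}}\in\Sigma^{\mathbb{Z}}$ with $\lambda^-(e^-_{(k-1,k),l})=x_k$ and $\lambda^+(e^+_{k,(l,l+1)})=x_l$ for all $(k,l)\in\mathbb{Z}^2[<]$. For $v\in V_{(p,q)}$ and $\mu=(\mu_{p+1},\dots,\mu_{q-1})\in P(v)$ let $U_{(\mu;v)}$ be the set of $x\in\mathcal{X}_{\mathcal{L}}$ whose vertex at $(p,q)$ is $v$ and whose labels satisfy $(x_{p+1},\dots,x_{q-1})=\mu$. These sets (over all $(p,q)\in\mathbb{Z}^2[<]$) form a base of the topology of $\mathcal{X}_{\mathcal{L}}$ (a compact totally disconnected metrizable space). **Equivalence relation.** For $(p,q)\in\mathbb{Z}^2[<]$, $\square_{(p,q)}(x)$ is the restriction of $x$ to all $v_{(k,l)},e^-_{(k-1,k),l},e^+_{k,(l,l+1)}$ with $k\le p$, $l\ge q$. Put $R_{\mathcal{L}_{(p,q)}}=\{(x,z):\square_{(p,q)}(x)=\square_{(p,q)}(z)\}\subset\mathcal{X}_{\mathcal{L}}\times\mathcal{X}_{\mathcal{L}}$ with the relative product topology, and $R_{\mathcal{L}}=\bigcup_{(p,q)}R_{\mathcal{L}_{(p,q)}}$ with the inductive limit topology; it is an étale equivalence relation. **Groupoid.** The shift $\sigma_{\mathcal{L}}:\mathcal{X}_{\mathcal{L}}\to\mathcal{X}_{\mathcal{L}}$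 is the homeomorphism $\sigma_{\mathcal{L}}(x)=\{(v_{(k+1,l+1)},e^-_{(k,k+1),l+1},e^+_{k+1,(l+1,l+2)})\}_{(k,l)}$. $\mathcal{G}_{\mathcal{L}}=\{(x,n,z)\in\mathcal{X}_{\mathcal{L}}\times\mathbb{Z}\times\mathcal{X}_{\mathcal{L}}:(\sigma_{\mathcal{L}}^n(x),z)\in R_{\mathcal{L}}\}$, with topology transferred from $R_{\mathcal{L}}\times\mathbb{Z}$ via $(x,n,z)\mapsto((\sigma_{\mathcal{L}}^n(x),z),n)$, $r(x,n,z)=x$, $s(x,n,z)=z$, product $(x,n,z)(z,m,w)=(x,n+m,w)$, inverse $(z,-n,x)$; it is an étale groupoid with unit space $\mathcal{G}_{\mathcal{L}}^{(0)}=\{(x,0,x)\}$ identified with $\mathcal{X}_{\mathcal{L}}$, and $R_{\mathcal{L}}$ is identified with the subgroupoid $\{(x,0,z)\in\mathcal{G}_{\mathcal{L}}\}$. $d_{\mathcal{L}}:\mathcal{G}_{\mathcal{L}}\to\mathbb{Z}$ is $d_{\mathcal{L}}(x,n,z)=n$. **Canonical $\lambda$-graph bisystem of a subshift.** Let $\Lambda\subset\Sigma^{\mathbb{Z}}$ be a two-sided subshift with shift $\sigma_\Lambda((a_n)_n)=(a_{n+1})_n$. For $x\in\Lambda$ and $(k,l)\in\mathbb{Z}^2[<]$ let $W_{k,l}(x)$ be the set of words $(a_{k+1},\dots,a_{l-1})$ of length $n(k,l)$ with $(\dots,x_{k-1},x_k,a_{k+1},\dots,a_{l-1},x_l,x_{l+1},\dots)\in\Lambda$.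 Call $x,z\in\Lambda$ $(k,l)$-centrally equivalent if $W_{k,l}(x)=W_{k,l}(z)$; let $\Omega_{k,l}$ be the (finite) set of classes. $\Omega_{k,l}$ and $\Omega_{k-n,l-n}$ are identified via $\sigma_\Lambda^n$, and $V_{n(k,l)}:=\Omega_{k,l}$. For a class $v\in\Omega_{k,l}$, $x\in v$ and $\beta\in\Sigma$ with $(\beta,a_{k+2},\dots,a_{l-1})\in W_{k,l}(x)$ for some $a_{k+2},\dots,a_{l-1}$, there is an edge $e^-$ of $\mathcal{L}_\Lambda^-$ labeled $\beta$ from $v\in V_{n(k,l)}$ to the class in $\Omega_{k+1,l}=V_{n(k,l)-1}$ of $(\dots,x_{k-1},x_k,\beta,a_{k+2},\dots,a_{l-1},x_l,\dots)$. For $\alpha\in\Sigma$ with $(a_{k+1},\dots,a_{l-2},\alpha)\in W_{k,l}(x)$ for some $a_{k+1},\dots,a_{l-2}$, there is an edge $e^+$ of $\mathcal{L}_\Lambda^+$ labeled $\alpha$ from the class in $\Omega_{k,l-1}=V_{n(k,l)-1}$ of $(\dots,x_k,a_{k+1},\dots,a_{l-2},\alpha,x_l,\dots)$ to $v$. (One edge for each triple source, terminal, label.) This is a $\lambda$-graph bisystem $\mathcal{L}_\Lambda=(\mathcal{L}_\Lambda^-,\mathcal{L}_\Lambda^+)$ satisfying FPCC. Write $\mathcal{X}_\Lambda,R_\Lambda,\mathcal{G}_\Lambda,d_\Lambda$ for $\mathcal{X}_{\mathcal{L}_\Lambda},R_{\mathcal{L}_\Lambda},\mathcal{G}_{\mathcal{L}_\Lambda},d_{\mathcal{L}_\Lambda}$.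 The factor map $\pi:\mathcal{X}_\Lambda\to\Lambda$ is $\pi(x)=(x_n)_{n\in\mathbb{Z}}$ (the label sequence of $x$), a continuous surjection. $\Lambda_1,\Lambda_2$ are topologically conjugate if there is a homeomorphism $g:\Lambda_1\to\Lambda_2$ with $g\circ\sigma_{\Lambda_1}=\sigma_{\Lambda_2}\circ g$. (The homeomorphism $h_\Lambda$ in (ii) is not required to commute with the shifts.) *)

theory Defs
  imports "HOL-Analysis.Analysis"
begin

section \<open>Labeled Bratteli diagrams and lambda-graph bisystems\<close>

text \<open>\<^term>\<open>Eminus L l\<close> is the edge set from level \<open>l+1\<close> to level \<open>l\<close>, and \<^term>\<open>Eplus L l\<close>
  the one from level \<open>l\<close> to level \<open>l+1\<close>.  All edge sets being disjoint, the two diagrams share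
  one source map, one terminal map and one labeling map.\<close>

record ('v, 'e, 's) bisystem =
  Vert :: "nat \<Rightarrow> 'v set"
  Eminus :: "nat \<Rightarrow> 'e set"
  Eplus :: "nat \<Rightarrow> 'e set"
  src :: "'e \<Rightarrow> 'v"
  trm :: "'e \<Rightarrow> 'v"
  lab :: "'e \<Rightarrow> 's"

definition lambda_graph_bisystem :: "'s set \<Rightarrow> ('v, 'e, 's) bisystem \<Rightarrow> bool" where
  "lambda_graph_bisystem S L \<longleftrightarrow>
     finite S \<and>
     (\<forall>l. finite (Vert L l) \<and> Vert L l \<noteq> {} \<and> finite (Eminus L l) \<and> Eminus L l \<noteq> {} \<and>
          finite (Eplus L l) \<and> Eplus L l \<noteq> {}) \<and>
     disjoint_family (Vert L) \<and> disjoint_family (Eminus L) \<and> disjoint_family (Eplus L) \<and>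
     (\<forall>l m. Eminus L l \<inter> Eplus L m = {}) \<and>
     (\<exists>v. Vert L 0 = {v}) \<and>
     (\<forall>l. \<forall>e\<in>Eminus L l. src L e \<in> Vert L (Suc l) \<and> trm L e \<in> Vert L l \<and> lab L e \<in> S) \<and>
     (\<forall>l. \<forall>e\<in>Eplus L l. src L e \<in> Vert L l \<and> trm L e \<in> Vert L (Suc l) \<and> lab L e \<in> S) \<and>
     (\<forall>l. \<forall>e\<in>Eminus L l. \<forall>f\<in>Eminus L l. e \<noteq> f \<and> src L e = src L f \<longrightarrow> lab L e \<noteq> lab L f) \<and>
     (\<forall>l. \<forall>e\<in>Eplus L l. \<forall>f\<in>Eplus L l. e \<noteq> f \<and> trm L e = trm L f \<longrightarrow> lab L e \<noteq> lab L f) \<and>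
     (\<forall>l. \<forall>u\<in>Vert L l. \<forall>v\<in>Vert L (l + 2). \<exists>\<phi>.
        bij_betw \<phi>
          {(fp, fm) \<in> Eplus L l \<times> Eminus L (Suc l). src L fp = u \<and> trm L fp = trm L fm \<and> src L fm = v}
          {(em, ep) \<in> Eminus L l \<times> Eplus L (Suc l). trm L em = u \<and> src L em = src L ep \<and> trm L ep = v} \<and>
        (\<forall>fp\<in>Eplus L l. \<forall>fm\<in>Eminus L (Suc l).
           src L fp = u \<and> trm L fp = trm L fm \<and> src L fm = v \<longrightarrow>
           (\<forall>em ep. \<phi> (fp, fm) = (em, ep) \<longrightarrow> lab L fp = lab L ep \<and> lab L fm = lab L em)))"

text \<open>The set \<open>P(v)\<close> of label words of \<open>\<L>\<^sup>+\<close>-paths from level \<open>0\<close> to a vertex \<open>v\<close> at level \<open>l\<close>.\<close>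

definition pred_words :: "('v, 'e, 's) bisystem \<Rightarrow> nat \<Rightarrow> 'v \<Rightarrow> 's list set" where
  "pred_words L l v =
     {map (lab L) es | es. length es = l \<and> (\<forall>i<l. es ! i \<in> Eplus L i) \<and>
        (\<forall>i. Suc i < l \<longrightarrow> trm L (es ! i) = src L (es ! Suc i)) \<and>
        (0 < l \<longrightarrow> trm L (es ! (l - 1)) = v)}"


section \<open>The configuration space\<close>

definition Z2 :: "(int \<times> int) set" where
  "Z2 = {(k, l). k < l}"

definition gap :: "int \<Rightarrow> int \<Rightarrow> nat" where
  "gap k l = nat (l - k - 1)"

text \<open>A configuration assigns to \<open>(k,l)\<close> the triple
  \<open>(v\<^bsub>(k,l)\<^esub>, e\<^sup>-\<^bsub>(k-1,k),l\<^esub>, e\<^sup>+\<^bsub>k,(l,l+1)\<^esub>)\<close>; it is \<^const>\<open>undefined\<close> outside \<^const>\<open>Z2\<close>, so that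
  equality of configurations is equality of functions.\<close>

type_synonym ('v, 'e) config = "int \<times> int \<Rightarrow> 'v \<times> 'e \<times> 'e"

definition vertex_at :: "('v, 'e) config \<Rightarrow> int \<Rightarrow> int \<Rightarrow> 'v" where
  "vertex_at x k l = fst (x (k, l))"

definition edge_minus :: "('v, 'e) config \<Rightarrow> int \<Rightarrow> int \<Rightarrow> 'e" where
  "edge_minus x k l = fst (snd (x (k, l)))"

definition edge_plus :: "('v, 'e) config \<Rightarrow> int \<Rightarrow> int \<Rightarrow> 'e" where
  "edge_plus x k l = snd (snd (x (k, l)))"

definition configs :: "('v, 'e, 's) bisystem \<Rightarrow> ('v, 'e) config set" where
  "configs L = {x \<in> extensional Z2.
     (\<forall>k l. k < l \<longrightarrow>
        vertex_at x k l \<in> Vert L (gap k l) \<and> edge_minus x k l \<in> Eminus L (gap k l) \<and> edge_plus x k l \<in> Eplus L (gap k l) \<and>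
        src L (edge_minus x k l) = vertex_at x (k - 1) l \<and> trm L (edge_minus x k l) = vertex_at x k l \<and>
        src L (edge_plus x k l) = vertex_at x k l \<and> trm L (edge_plus x k l) = vertex_at x k (l + 1)) \<and>
     (\<exists>a :: int \<Rightarrow> 's. \<forall>k l. k < l \<longrightarrow> lab L (edge_minus x k l) = a k \<and> lab L (edge_plus x k l) = a l)}"

text \<open>The label sequence \<open>(x\<^sub>n)\<close> of a configuration, read off at the positions \<open>(n, n+1)\<close>.\<close>

definition labels :: "('v, 'e, 's) bisystem \<Rightarrow> ('v, 'e) config \<Rightarrow> int \<Rightarrow> 's" where
  "labels L x n = lab L (edge_minus x n (n + 1))"

lemma labels_eq:
  assumes "x \<in> configs L" "k < l"
  shows "lab L (edge_minus x k l) = labels L x k" "lab L (edge_plus x k l) = labels L x l"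
  using assms by (force simp: configs_def labels_def)+

definition cylinder :: "('v, 'e, 's) bisystem \<Rightarrow> int \<Rightarrow> int \<Rightarrow> 's list \<Rightarrow> 'v \<Rightarrow> ('v, 'e) config set" where
  "cylinder L p q \<mu> v = {x \<in> configs L. vertex_at x p q = v \<and> map (labels L x) [p+1..q-1] = \<mu>}"

definition config_top :: "('v, 'e, 's) bisystem \<Rightarrow> ('v, 'e) config topology" where
  "config_top L = topology_generated_by
     {cylinder L p q \<mu> v | p q \<mu> v. p < q \<and> v \<in> Vert L (gap p q) \<and> \<mu> \<in> pred_words L (gap p q) v}"

lemma topspace_config_top: "topspace (config_top L) = configs L"
proof -
  have "x \<in> \<Union>{cylinder L p q \<mu> v | p q \<mu> v.
      p < q \<and> v \<in> Vert L (gap p q) \<and> \<mu> \<in> pred_words L (gap p q) v}" if x: "x \<in> configs L" for x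
  proof -
    have "x \<in> cylinder L 0 1 [] (vertex_at x 0 1)" "vertex_at x 0 1 \<in> Vert L (gap 0 1)"
      using x by (auto simp: cylinder_def configs_def)
    moreover have "[] \<in> pred_words L (gap 0 1) (vertex_at x 0 1)"
      by (auto simp: pred_words_def gap_def)
    ultimately show ?thesis
      using zero_less_one by blast
  qed
  then show ?thesis
    unfolding config_top_def topology_generated_by_topspace by (auto simp: cylinder_def)
qed

text \<open>The \<open>n\<close>-th power (\<open>n \<in> \<int>\<close>) of the shift \<open>\<sigma>\<^sub>\<L>\<close>.\<close>

definition config_shift :: "int \<Rightarrow> ('v, 'e) config \<Rightarrow> ('v, 'e) config" where
  "config_shift n x = (\<lambda>(k, l). x (k + n, l + n))"


section \<open>The equivalence relation and the groupoid\<close>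

definition square :: "int \<Rightarrow> int \<Rightarrow> ('v, 'e) config \<Rightarrow> ('v, 'e) config" where
  "square p q x = restrict x ({..p} \<times> {q..})"

definition Rel_at :: "('v, 'e, 's) bisystem \<Rightarrow> int \<Rightarrow> int \<Rightarrow> (('v, 'e) config \<times> ('v, 'e) config) set" where
  "Rel_at L p q = {(x, z). x \<in> configs L \<and> z \<in> configs L \<and> square p q x = square p q z}"

definition Rel_at_top ::
    "('v, 'e, 's) bisystem \<Rightarrow> int \<Rightarrow> int \<Rightarrow> (('v, 'e) config \<times> ('v, 'e) config) topology" where
  "Rel_at_top L p q = subtopology (prod_topology (config_top L) (config_top L)) (Rel_at L p q)"

definition Rel :: "('v, 'e, 's) bisystem \<Rightarrow> (('v, 'e) config \<times> ('v, 'e) config) set" where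
  "Rel L = (\<Union>(p, q)\<in>Z2. Rel_at L p q)"

definition Rel_top :: "('v, 'e, 's) bisystem \<Rightarrow> (('v, 'e) config \<times> ('v, 'e) config) topology" where
  "Rel_top L = topology (\<lambda>U. U \<subseteq> Rel L \<and>
     (\<forall>p q. p < q \<longrightarrow> openin (Rel_at_top L p q) (U \<inter> Rel_at L p q)))"

lemma openin_Rel_top:
  "openin (Rel_top L) U \<longleftrightarrow>
     U \<subseteq> Rel L \<and> (\<forall>p q. p < q \<longrightarrow> openin (Rel_at_top L p q) (U \<inter> Rel_at L p q))"
proof -
  have "istopology (\<lambda>U. U \<subseteq> Rel L \<and>
     (\<forall>p q. p < q \<longrightarrow> openin (Rel_at_top L p q) (U \<inter> Rel_at L p q)))"
    unfolding istopology_def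
  proof (intro conjI allI impI, goal_cases)
    case (1 A B) then show ?case by blast
  next
    case (2 A B p q)
    have "A \<inter> B \<inter> Rel_at L p q = (A \<inter> Rel_at L p q) \<inter> (B \<inter> Rel_at L p q)" by blast
    moreover have "openin (Rel_at_top L p q) (A \<inter> Rel_at L p q)"
      "openin (Rel_at_top L p q) (B \<inter> Rel_at L p q)" using 2 by blast+
    ultimately show ?case by (metis openin_Int)
  next
    case (3 K) then show ?case by blast
  next
    case (4 K p q)
    have "\<Union>K \<inter> Rel_at L p q = (\<Union>A\<in>K. A \<inter> Rel_at L p q)" by blast
    moreover have "openin (Rel_at_top L p q) (\<Union>A\<in>K. A \<inter> Rel_at L p q)"
      using 4 by (intro openin_Union) blast
    ultimately show ?case by simp
  qed
  then show ?thesis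
    unfolding Rel_top_def by (simp add: topology_inverse')
qed

text \<open>Topological groupoids; source and range are arrows, namely units.\<close>

record 'g top_groupoid =
  arrows :: "'g set"
  gsrc :: "'g \<Rightarrow> 'g"
  grng :: "'g \<Rightarrow> 'g"
  gmult :: "'g \<Rightarrow> 'g \<Rightarrow> 'g"
  ginv :: "'g \<Rightarrow> 'g"
  gtop :: "'g topology"

text \<open>Isomorphisms of topological (in particular of etale) groupoids: homeomorphisms that are
  functors.  Compatibility with inverses and units is automatic.\<close>

definition groupoid_iso :: "'g top_groupoid \<Rightarrow> 'h top_groupoid \<Rightarrow> ('g \<Rightarrow> 'h) \<Rightarrow> bool" where
  "groupoid_iso G H \<phi> \<longleftrightarrow>
     bij_betw \<phi> (arrows G) (arrows H) \<and>
     homeomorphic_map (gtop G) (gtop H) \<phi> \<and>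
     (\<forall>g\<in>arrows G. \<forall>h\<in>arrows G. gsrc G g = grng G h \<longrightarrow>
        gsrc H (\<phi> g) = grng H (\<phi> h) \<and> \<phi> (gmult G g h) = gmult H (\<phi> g) (\<phi> h))"

type_synonym ('v, 'e) arrow = "('v, 'e) config \<times> int \<times> ('v, 'e) config"

definition Gpd_arrows :: "('v, 'e, 's) bisystem \<Rightarrow> ('v, 'e) arrow set" where
  "Gpd_arrows L = {(x, n, z). x \<in> configs L \<and> z \<in> configs L \<and> (config_shift n x, z) \<in> Rel L}"

definition Gpd :: "('v, 'e, 's) bisystem \<Rightarrow> ('v, 'e) arrow top_groupoid" where
  "Gpd L =
    \<lparr> arrows = Gpd_arrows L,
      gsrc = (\<lambda>(x, n, z). (z, 0, z)),
      grng = (\<lambda>(x, n, z). (x, 0, x)),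
      gmult = (\<lambda>(x, n, z) (y, m, w). (x, n + m, w)),
      ginv = (\<lambda>(x, n, z). (z, - n, x)),
      gtop = pullback_topology (Gpd_arrows L) (\<lambda>(x, n, z). ((config_shift n x, z), n))
               (prod_topology (Rel_top L) (discrete_topology UNIV)) \<rparr>"

definition unit_of :: "('v, 'e) config \<Rightarrow> ('v, 'e) arrow" where
  "unit_of x = (x, 0, x)"

definition Rel_in_Gpd :: "('v, 'e, 's) bisystem \<Rightarrow> ('v, 'e) arrow set" where
  "Rel_in_Gpd L = {(x, n, z) \<in> arrows (Gpd L). n = 0}"

definition gpd_degree :: "('v, 'e) arrow \<Rightarrow> int" where
  "gpd_degree = (\<lambda>(x, n, z). n)"


section \<open>Subshifts\<close>

definition seq_shift :: "int \<Rightarrow> (int \<Rightarrow> 's) \<Rightarrow> (int \<Rightarrow> 's)" where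
  "seq_shift n a = (\<lambda>i. a (i + n))"

definition full_shift_top :: "'s set \<Rightarrow> (int \<Rightarrow> 's) topology" where
  "full_shift_top S = product_topology (\<lambda>_. discrete_topology S) UNIV"

definition subshift :: "'s set \<Rightarrow> (int \<Rightarrow> 's) set \<Rightarrow> bool" where
  "subshift S \<Lambda> \<longleftrightarrow> finite S \<and> closedin (full_shift_top S) \<Lambda> \<and> seq_shift 1 ` \<Lambda> = \<Lambda>"

definition shift_top :: "'s set \<Rightarrow> (int \<Rightarrow> 's) set \<Rightarrow> (int \<Rightarrow> 's) topology" where
  "shift_top S \<Lambda> = subtopology (full_shift_top S) \<Lambda>"

definition topologically_conjugate ::
    "'a set \<Rightarrow> (int \<Rightarrow> 'a) set \<Rightarrow> 'b set \<Rightarrow> (int \<Rightarrow> 'b) set \<Rightarrow> bool" where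
  "topologically_conjugate S1 \<Lambda>1 S2 \<Lambda>2 \<longleftrightarrow>
     (\<exists>g. homeomorphic_map (shift_top S1 \<Lambda>1) (shift_top S2 \<Lambda>2) g \<and>
          (\<forall>a\<in>\<Lambda>1. g (seq_shift 1 a) = seq_shift 1 (g a)))"


section \<open>The canonical lambda-graph bisystem of a subshift\<close>

text \<open>The sequence \<open>x\<close> with the word \<open>w\<close> written at the positions \<open>k+1, k+2, \<dots>\<close>.\<close>

definition insert_word :: "int \<Rightarrow> 's list \<Rightarrow> (int \<Rightarrow> 's) \<Rightarrow> (int \<Rightarrow> 's)" where
  "insert_word k w x = (\<lambda>i. if k < i \<and> i \<le> k + int (length w) then w ! nat (i - k - 1) else x i)"

definition gap_words :: "(int \<Rightarrow> 's) set \<Rightarrow> int \<Rightarrow> int \<Rightarrow> (int \<Rightarrow> 's) \<Rightarrow> 's list set" where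
  "gap_words \<Lambda> k l x = {w. length w = gap k l \<and> insert_word k w x \<in> \<Lambda>}"

definition central_class :: "(int \<Rightarrow> 's) set \<Rightarrow> int \<Rightarrow> int \<Rightarrow> (int \<Rightarrow> 's) \<Rightarrow> (int \<Rightarrow> 's) set" where
  "central_class \<Lambda> k l x = {z \<in> \<Lambda>. gap_words \<Lambda> k l x = gap_words \<Lambda> k l z}"

text \<open>The identification of \<open>\<Omega>\<^bsub>k,l\<^esub>\<close> with \<open>\<Omega>\<^bsub>k-n,l-n\<^esub>\<close> via the \<open>n\<close>-th power of the shift is made
  by moving every class to \<open>\<Omega>\<^bsub>0,l-k\<^esub>\<close>.  Vertices carry their level, since one and the same
  set of sequences can be a class at several levels.\<close>

type_synonym 's class_vertex = "nat \<times> (int \<Rightarrow> 's) set"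

definition cvertex :: "(int \<Rightarrow> 's) set \<Rightarrow> int \<Rightarrow> int \<Rightarrow> (int \<Rightarrow> 's) \<Rightarrow> 's class_vertex" where
  "cvertex \<Lambda> k l x = (gap k l, seq_shift k ` central_class \<Lambda> k l x)"

text \<open>An edge is a triple of source, label and terminal.\<close>

definition canonical ::
    "(int \<Rightarrow> 's) set \<Rightarrow> ('s class_vertex, 's class_vertex \<times> 's \<times> 's class_vertex, 's) bisystem" where
  "canonical \<Lambda> =
    \<lparr> Vert = (\<lambda>n. {cvertex \<Lambda> k l x | k l x. k < l \<and> gap k l = n \<and> x \<in> \<Lambda>}),
      Eminus = (\<lambda>n. {(cvertex \<Lambda> k l x, \<beta>, cvertex \<Lambda> (k + 1) l (insert_word k (\<beta> # a) x)) | k l x \<beta> a.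
                  k < l \<and> gap k l = Suc n \<and> x \<in> \<Lambda> \<and> \<beta> # a \<in> gap_words \<Lambda> k l x}),
      Eplus = (\<lambda>n. {(cvertex \<Lambda> k (l - 1) (insert_word k (a @ [\<alpha>]) x), \<alpha>, cvertex \<Lambda> k l x) | k l x a \<alpha>.
                  k < l \<and> gap k l = Suc n \<and> x \<in> \<Lambda> \<and> a @ [\<alpha>] \<in> gap_words \<Lambda> k l x}),
      src = (\<lambda>(u, a, v). u),
      trm = (\<lambda>(u, a, v). v),
      lab = (\<lambda>(u, a, v). a) \<rparr>"


text \<open>This is a lambda-graph bisystem: in terms of the sequences \<open>y\<close> with all letters already
  filled in, the edges are those of \<open>canonical_Eminus\<close> and \<open>canonical_Eplus\<close> below.\<close>

definition level_vertex :: "(int \<Rightarrow> 's) set \<Rightarrow> nat \<Rightarrow> (int \<Rightarrow> 's) \<Rightarrow> 's class_vertex" where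
  "level_vertex \<Lambda> n x = cvertex \<Lambda> 0 (int n + 1) x"

lemma seq_shift_add: "seq_shift m (seq_shift n x) = seq_shift (m + n) x"
  by (simp add: seq_shift_def algebra_simps)

lemma seq_shift_0: "seq_shift 0 x = x"
  by (simp add: seq_shift_def)

lemma seq_shift_insert_word: "seq_shift n (insert_word k w x) = insert_word (k - n) w (seq_shift n x)"
  by (auto simp: seq_shift_def insert_word_def algebra_simps intro!: ext)

lemma seq_shift_mem:
  assumes "seq_shift 1 ` \<Lambda> = \<Lambda>"
  shows "seq_shift n x \<in> \<Lambda> \<longleftrightarrow> x \<in> \<Lambda>"
proof -
  have 1: "seq_shift 1 x \<in> \<Lambda> \<longleftrightarrow> x \<in> \<Lambda>" for x
  proof
    assume "seq_shift 1 x \<in> \<Lambda>"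
    then obtain y where "y \<in> \<Lambda>" "seq_shift 1 x = seq_shift 1 y" using assms by (metis imageE)
    then have "seq_shift (-1) (seq_shift 1 x) = seq_shift (-1) (seq_shift 1 y)" by simp
    then show "x \<in> \<Lambda>" using \<open>y \<in> \<Lambda>\<close> by (simp add: seq_shift_add seq_shift_0)
  qed (use assms in blast)
  show ?thesis
  proof (induction n rule: int_induct[where k = 0])
    case base then show ?case by (simp add: seq_shift_0)
  next
    case (step1 i)
    then show ?case using 1[of "seq_shift i x"] by (simp add: seq_shift_add add.commute)
  next
    case (step2 i)
    then show ?case using 1[of "seq_shift (i - 1) x"] by (simp add: seq_shift_add)
  qed
qed

lemma gap_words_shift:
  assumes "seq_shift 1 ` \<Lambda> = \<Lambda>"
  shows "gap_words \<Lambda> (k - n) (l - n) (seq_shift n x) = gap_words \<Lambda> k l x"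
  using seq_shift_mem[OF assms]
  by (simp add: gap_words_def gap_def flip: seq_shift_insert_word)

lemma cvertex_shift:
  assumes "seq_shift 1 ` \<Lambda> = \<Lambda>"
  shows "cvertex \<Lambda> (k - n) (l - n) (seq_shift n x) = cvertex \<Lambda> k l x"
proof -
  have "central_class \<Lambda> (k - n) (l - n) (seq_shift n x) = seq_shift n ` central_class \<Lambda> k l x"
  proof (intro subset_antisym subsetI)
    fix z assume z: "z \<in> central_class \<Lambda> (k - n) (l - n) (seq_shift n x)"
    have zz: "z = seq_shift n (seq_shift (- n) z)" by (simp add: seq_shift_add seq_shift_0)
    have "seq_shift (- n) z \<in> central_class \<Lambda> k l x"
      using z gap_words_shift[OF assms, of k n l x] gap_words_shift[OF assms, of k n l "seq_shift (- n) z"]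
      by (simp add: central_class_def seq_shift_mem[OF assms] seq_shift_add seq_shift_0)
    with zz show "z \<in> seq_shift n ` central_class \<Lambda> k l x" by blast
  next
    fix z assume "z \<in> seq_shift n ` central_class \<Lambda> k l x"
    then show "z \<in> central_class \<Lambda> (k - n) (l - n) (seq_shift n x)"
      using gap_words_shift[OF assms] by (auto simp: central_class_def seq_shift_mem[OF assms])
  qed
  then show ?thesis
    by (simp add: cvertex_def gap_def image_image seq_shift_add)
qed

lemma cvertex_level:
  assumes "seq_shift 1 ` \<Lambda> = \<Lambda>" "k < l"
  shows "cvertex \<Lambda> k l x = level_vertex \<Lambda> (gap k l) (seq_shift k x)"
  using cvertex_shift[OF assms(1), of k k l x] assms(2)
  by (simp add: level_vertex_def gap_def)

lemma level_vertex_eq: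
  assumes "x \<in> \<Lambda>" "y \<in> \<Lambda>"
  shows "level_vertex \<Lambda> n x = level_vertex \<Lambda> m y \<longleftrightarrow>
    n = m \<and> gap_words \<Lambda> 0 (int n + 1) x = gap_words \<Lambda> 0 (int n + 1) y"
  using assms
  by (auto simp: level_vertex_def cvertex_def gap_def central_class_def seq_shift_0)

lemma insert_word_insert_word:
  "length v = length w \<Longrightarrow> insert_word k v (insert_word k w x) = insert_word k v x"
  by (auto simp: insert_word_def intro!: ext)

lemma gap_words_insert:
  "length w = gap k l \<Longrightarrow> gap_words \<Lambda> k l (insert_word k w x) = gap_words \<Lambda> k l x"
  by (auto simp: gap_words_def insert_word_insert_word)

lemma insert_word_id: "insert_word k (map y [k+1..k + int n]) y = y"
  by (auto simp: insert_word_def intro!: ext)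

lemma gap_words_self: "y \<in> \<Lambda> \<Longrightarrow> map y [k+1..l-1] \<in> gap_words \<Lambda> k l y"
  using insert_word_id[of k y "gap k l"] 
  by (cases "k < l") (auto simp: gap_words_def gap_def insert_word_def)

lemma gap_words_Cons:
  "w \<in> gap_words \<Lambda> 1 (int n + 2) y \<longleftrightarrow> y 1 # w \<in> gap_words \<Lambda> 0 (int n + 2) y"
proof -
  have "insert_word 0 (y 1 # w) y = insert_word 1 w y"
  proof
    fix i :: int
    consider "i < 1" | "i = 1" | "i > 1" by linarith
    then show "insert_word 0 (y 1 # w) y i = insert_word 1 w y i"
      by cases (auto simp: insert_word_def nth_Cons' nat_diff_distrib' diff_diff_eq numeral_2_eq_2)
  qed
  then show ?thesis by (auto simp: gap_words_def gap_def)
qed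

lemma gap_words_snoc:
  "w \<in> gap_words \<Lambda> 0 (int n + 1) y \<longleftrightarrow> w @ [y (int n + 1)] \<in> gap_words \<Lambda> 0 (int n + 2) y"
proof -
  have "insert_word 0 (w @ [y (int n + 1)]) y = insert_word 0 w y" if "length w = n"
  proof
    fix i :: int
    consider "i < 1" | "1 \<le> i \<and> i \<le> int n" | "i = int n + 1" | "i > int n + 1" by linarith
    then show "insert_word 0 (w @ [y (int n + 1)]) y i = insert_word 0 w y i"
      by cases (use that in \<open>auto simp: insert_word_def nth_append\<close>)
  qed
  then show ?thesis by (auto simp: gap_words_def gap_def)
qed

lemma canonical_Vert:
  assumes "seq_shift 1 ` \<Lambda> = \<Lambda>"
  shows "Vert (canonical \<Lambda>) n = level_vertex \<Lambda> n ` \<Lambda>"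
proof (intro subset_antisym subsetI)
  fix v assume "v \<in> Vert (canonical \<Lambda>) n"
  then obtain k l x where "v = cvertex \<Lambda> k l x" "k < l" "gap k l = n" "x \<in> \<Lambda>"
    by (auto simp: canonical_def)
  then show "v \<in> level_vertex \<Lambda> n ` \<Lambda>"
    using cvertex_level[OF assms] seq_shift_mem[OF assms] by (metis imageI)
next
  fix v assume "v \<in> level_vertex \<Lambda> n ` \<Lambda>"
  then obtain x where "x \<in> \<Lambda>" "v = cvertex \<Lambda> 0 (int n + 1) x" by (auto simp: level_vertex_def)
  moreover have "0 < int n + 1" "gap 0 (int n + 1) = n" by (auto simp: gap_def)
  ultimately show "v \<in> Vert (canonical \<Lambda>) n" by (simp only: canonical_def bisystem.select_convs mem_Collect_eq) blast
qed

lemma canonical_Eminus: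
  assumes "seq_shift 1 ` \<Lambda> = \<Lambda>"
  shows "Eminus (canonical \<Lambda>) n =
    (\<lambda>y. (level_vertex \<Lambda> (Suc n) y, y 1, level_vertex \<Lambda> n (seq_shift 1 y))) ` \<Lambda>"
proof (intro subset_antisym subsetI)
  fix e assume "e \<in> Eminus (canonical \<Lambda>) n"
  then obtain k l x \<beta> a where e: "e = (cvertex \<Lambda> k l x, \<beta>, cvertex \<Lambda> (k + 1) l (insert_word k (\<beta> # a) x))"
    and kl: "k < l" "gap k l = Suc n" and x: "x \<in> \<Lambda>" "\<beta> # a \<in> gap_words \<Lambda> k l x"
    by (auto simp: canonical_def)
  define z where "z = insert_word k (\<beta> # a) x"
  define y where "y = seq_shift k z"
  have z: "z \<in> \<Lambda>" "gap_words \<Lambda> k l z = gap_words \<Lambda> k l x"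
    using x gap_words_insert[of _ k l \<Lambda> x] unfolding z_def by (auto simp: gap_words_def[of \<Lambda> k l x])
  have "cvertex \<Lambda> k l x = cvertex \<Lambda> k l z"
    using z by (simp add: cvertex_def central_class_def)
  also have "\<dots> = level_vertex \<Lambda> (Suc n) y"
    using cvertex_level[OF assms kl(1)] kl by (simp add: y_def)
  finally have 1: "cvertex \<Lambda> k l x = level_vertex \<Lambda> (Suc n) y" .
  have "k + 1 < l" "gap (k + 1) l = n" using kl by (auto simp: gap_def)
  then have 2: "cvertex \<Lambda> (k + 1) l z = level_vertex \<Lambda> n (seq_shift 1 y)"
    using cvertex_level[OF assms, of "k + 1" l z] by (simp add: y_def seq_shift_add add.commute)
  have "y 1 = \<beta>" by (simp add: y_def z_def seq_shift_def insert_word_def)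
  then show "e \<in> (\<lambda>y. (level_vertex \<Lambda> (Suc n) y, y 1, level_vertex \<Lambda> n (seq_shift 1 y))) ` \<Lambda>"
    using e 1 2 z(1) seq_shift_mem[OF assms] by (auto simp: z_def[symmetric] y_def intro!: image_eqI[of _ _ y])
next
  fix e assume "e \<in> (\<lambda>y. (level_vertex \<Lambda> (Suc n) y, y 1, level_vertex \<Lambda> n (seq_shift 1 y))) ` \<Lambda>"
  then obtain y where y: "y \<in> \<Lambda>" and e: "e = (level_vertex \<Lambda> (Suc n) y, y 1, level_vertex \<Lambda> n (seq_shift 1 y))"
    by blast
  define a where "a = map y [2..int n + 1]"
  have a: "y 1 # a = map y [0 + 1..0 + int (Suc n)]"
    using upto_rec1[of 1 "int n + 1"] by (simp add: a_def add.commute)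
  have ins: "insert_word 0 (y 1 # a) y = y" unfolding a by (rule insert_word_id)
  have len: "length (y 1 # a) = gap 0 (int n + 2)" by (simp add: a_def gap_def)
  have "e = (cvertex \<Lambda> 0 (int n + 2) y, y 1, cvertex \<Lambda> (0 + 1) (int n + 2) (insert_word 0 (y 1 # a) y))"
    using e cvertex_level[OF assms, of 1 "int n + 2" y] unfolding ins
    by (simp add: level_vertex_def gap_def add.commute)
  moreover have "y 1 # a \<in> gap_words \<Lambda> 0 (int n + 2) y"
    using ins len y by (simp add: gap_words_def)
  moreover have "0 < int n + 2" "gap 0 (int n + 2) = Suc n" by (auto simp: gap_def)
  ultimately show "e \<in> Eminus (canonical \<Lambda>) n" using y by (simp only: canonical_def bisystem.select_convs mem_Collect_eq) blast
qed

lemma canonical_Eplus: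
  assumes "seq_shift 1 ` \<Lambda> = \<Lambda>"
  shows "Eplus (canonical \<Lambda>) n =
    (\<lambda>y. (level_vertex \<Lambda> n y, y (int n + 1), level_vertex \<Lambda> (Suc n) y)) ` \<Lambda>"
proof (intro subset_antisym subsetI)
  fix e assume "e \<in> Eplus (canonical \<Lambda>) n"
  then obtain k l x \<alpha> a where e: "e = (cvertex \<Lambda> k (l - 1) (insert_word k (a @ [\<alpha>]) x), \<alpha>, cvertex \<Lambda> k l x)"
    and kl: "k < l" "gap k l = Suc n" and x: "x \<in> \<Lambda>" "a @ [\<alpha>] \<in> gap_words \<Lambda> k l x"
    by (auto simp: canonical_def)
  define z where "z = insert_word k (a @ [\<alpha>]) x"
  define y where "y = seq_shift k z"
  have z: "z \<in> \<Lambda>" "gap_words \<Lambda> k l z = gap_words \<Lambda> k l x"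
    using x gap_words_insert[of _ k l \<Lambda> x] unfolding z_def by (auto simp: gap_words_def[of \<Lambda> k l x])
  have "cvertex \<Lambda> k l x = cvertex \<Lambda> k l z"
    using z by (simp add: cvertex_def central_class_def)
  also have "\<dots> = level_vertex \<Lambda> (Suc n) y"
    using cvertex_level[OF assms kl(1)] kl by (simp add: y_def)
  finally have 1: "cvertex \<Lambda> k l x = level_vertex \<Lambda> (Suc n) y" .
  have "k < l - 1" "gap k (l - 1) = n" using kl by (auto simp: gap_def)
  then have 2: "cvertex \<Lambda> k (l - 1) z = level_vertex \<Lambda> n y"
    using cvertex_level[OF assms, of k "l - 1" z] by (simp add: y_def)
  have "length a = n" using x kl by (simp add: gap_words_def)
  then have "y (int n + 1) = \<alpha>"
    by (auto simp: y_def z_def seq_shift_def insert_word_def nth_append)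
  then show "e \<in> (\<lambda>y. (level_vertex \<Lambda> n y, y (int n + 1), level_vertex \<Lambda> (Suc n) y)) ` \<Lambda>"
    using e 1 2 z(1) seq_shift_mem[OF assms] by (auto simp: z_def[symmetric] y_def intro!: image_eqI[of _ _ y])
next
  fix e assume "e \<in> (\<lambda>y. (level_vertex \<Lambda> n y, y (int n + 1), level_vertex \<Lambda> (Suc n) y)) ` \<Lambda>"
  then obtain y where y: "y \<in> \<Lambda>" and e: "e = (level_vertex \<Lambda> n y, y (int n + 1), level_vertex \<Lambda> (Suc n) y)"
    by blast
  define a where "a = map y [1..int n]"
  have a: "a @ [y (int n + 1)] = map y [0 + 1..0 + int (Suc n)]"
    using upto_rec2[of 1 "int n + 1"] by (simp add: a_def add.commute)
  have ins: "insert_word 0 (a @ [y (int n + 1)]) y = y" unfolding a by (rule insert_word_id)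
  have len: "length (a @ [y (int n + 1)]) = gap 0 (int n + 2)" by (simp add: a_def gap_def)
  have "e = (cvertex \<Lambda> 0 (int n + 2 - 1) (insert_word 0 (a @ [y (int n + 1)]) y), y (int n + 1),
             cvertex \<Lambda> 0 (int n + 2) y)"
    using e unfolding ins by (simp add: level_vertex_def add.commute)
  moreover have "a @ [y (int n + 1)] \<in> gap_words \<Lambda> 0 (int n + 2) y"
    using ins len y by (simp add: gap_words_def)
  moreover have "0 < int n + 2" "gap 0 (int n + 2) = Suc n" by (auto simp: gap_def)
  ultimately show "e \<in> Eplus (canonical \<Lambda>) n" using y by (simp only: canonical_def bisystem.select_convs mem_Collect_eq) blast
qed


lemma lambda_graph_bisystem_canonical:
  assumes sub: "subshift S \<Lambda>" and ne: "\<Lambda> \<noteq> {}"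
  shows "lambda_graph_bisystem S (canonical \<Lambda>)"
proof -
  have sh: "seq_shift 1 ` \<Lambda> = \<Lambda>" and fin: "finite S" using sub by (auto simp: subshift_def)
  have S: "x i \<in> S" if "x \<in> \<Lambda>" for x i
    using sub that by (fastforce simp: subshift_def full_shift_top_def dest: closedin_subset)
  have sel: "src (canonical \<Lambda>) = (\<lambda>(u, a, v). u)" "trm (canonical \<Lambda>) = (\<lambda>(u, a, v). v)"
    "lab (canonical \<Lambda>) = (\<lambda>(u, a, v). a)" by (auto simp: canonical_def)
  note V = canonical_Vert[OF sh] and Em = canonical_Eminus[OF sh] and Ep = canonical_Eplus[OF sh]
  have sm: "seq_shift n x \<in> \<Lambda> \<longleftrightarrow> x \<in> \<Lambda>" for n x by (rule seq_shift_mem[OF sh])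
  have fst_lv: "fst (level_vertex \<Lambda> n x) = n" for n x
    by (simp add: level_vertex_def cvertex_def gap_def)
  have lv_n: "level_vertex \<Lambda> n x = level_vertex \<Lambda> m y \<Longrightarrow> n = m" for n m x y
    by (metis fst_lv)
  have finV: "finite (level_vertex \<Lambda> n ` \<Lambda>)" for n
  proof -
    have "gap_words \<Lambda> 0 (int n + 1) x \<subseteq> {w. set w \<subseteq> S \<and> length w = n}" for x
    proof
      fix w assume w: "w \<in> gap_words \<Lambda> 0 (int n + 1) x"
      then have len: "length w = n" by (simp add: gap_words_def gap_def)
      have "w ! i \<in> S" if "i < n" for i
      proof -
        have "insert_word 0 w x (int i + 1) = w ! i" using that len by (simp add: insert_word_def)
        then show ?thesis using S[of "insert_word 0 w x" "int i + 1"] w by (simp add: gap_words_def)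
      qed
      then show "w \<in> {w. set w \<subseteq> S \<and> length w = n}" using len by (auto simp: in_set_conv_nth)
    qed
    then have "gap_words \<Lambda> 0 (int n + 1) ` \<Lambda> \<subseteq> Pow {w. set w \<subseteq> S \<and> length w = n}" by blast
    then have "finite (gap_words \<Lambda> 0 (int n + 1) ` \<Lambda>)"
      using finite_lists_length_eq[OF fin] by (meson finite_Pow_iff finite_subset)
    moreover have "level_vertex \<Lambda> n ` \<Lambda> =
      (\<lambda>w. (n, seq_shift 0 ` {z \<in> \<Lambda>. w = gap_words \<Lambda> 0 (int n + 1) z})) ` gap_words \<Lambda> 0 (int n + 1) ` \<Lambda>"
      by (simp add: level_vertex_def cvertex_def gap_def central_class_def image_image)
    ultimately show ?thesis by simp
  qed
  have finEm: "finite (Eminus (canonical \<Lambda>) n)" for n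
    by (rule finite_subset[of _ "level_vertex \<Lambda> (Suc n) ` \<Lambda> \<times> S \<times> level_vertex \<Lambda> n ` \<Lambda>"])
      (use finV fin S sm in \<open>auto simp: Em\<close>)
  have finEp: "finite (Eplus (canonical \<Lambda>) n)" for n
    by (rule finite_subset[of _ "level_vertex \<Lambda> n ` \<Lambda> \<times> S \<times> level_vertex \<Lambda> (Suc n) ` \<Lambda>"])
      (use finV fin S sm in \<open>auto simp: Ep\<close>)
  have V0: "\<exists>v. level_vertex \<Lambda> 0 ` \<Lambda> = {v}"
  proof -
    obtain x0 where x0: "x0 \<in> \<Lambda>" using ne by blast
    have "level_vertex \<Lambda> 0 x = level_vertex \<Lambda> 0 x0" if x: "x \<in> \<Lambda>" for x
    proof -
      have "gap_words \<Lambda> 0 1 y = {[]}" if "y \<in> \<Lambda>" for y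
        using that insert_word_id[of 0 y 0] by (auto simp: gap_words_def gap_def)
      then show ?thesis using x x0 by (simp add: level_vertex_eq)
    qed
    then show ?thesis using x0 by blast
  qed

  have step_minus: "gap_words \<Lambda> 0 (int n + 1) (seq_shift 1 y) = gap_words \<Lambda> 0 (int n + 1) (seq_shift 1 z)"
    if "gap_words \<Lambda> 0 (int n + 2) y = gap_words \<Lambda> 0 (int n + 2) z" "y 1 = z 1" for y z n
  proof -
    have "gap_words \<Lambda> 1 (int n + 2) y = gap_words \<Lambda> 1 (int n + 2) z"
      using that by (auto simp: gap_words_Cons)
    then show ?thesis
      using gap_words_shift[OF sh, of 1 1 "int n + 2" y] gap_words_shift[OF sh, of 1 1 "int n + 2" z]
      by (simp add: add.commute)
  qed
  have step_plus: "gap_words \<Lambda> 0 (int n + 1) y = gap_words \<Lambda> 0 (int n + 1) z"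
    if "gap_words \<Lambda> 0 (int n + 2) y = gap_words \<Lambda> 0 (int n + 2) z" "y (int n + 1) = z (int n + 1)" for y z n
    using that by (auto simp: gap_words_snoc)

  have lv_minus: "level_vertex \<Lambda> n (seq_shift 1 y) = level_vertex \<Lambda> n (seq_shift 1 z)"
    if "level_vertex \<Lambda> (Suc n) y = level_vertex \<Lambda> (Suc n) z" "y 1 = z 1" "y \<in> \<Lambda>" "z \<in> \<Lambda>" for y z n
  proof -
    have "gap_words \<Lambda> 0 (int (Suc n) + 1) y = gap_words \<Lambda> 0 (int (Suc n) + 1) z"
      using that by (simp only: level_vertex_eq)
    moreover have "int (Suc n) + 1 = int n + 2" by simp
    ultimately have "gap_words \<Lambda> 0 (int n + 2) y = gap_words \<Lambda> 0 (int n + 2) z" by metis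
    from step_minus[OF this that(2)] show ?thesis using that(3,4) by (simp add: level_vertex_eq sm)
  qed
  have lv_plus: "level_vertex \<Lambda> n y = level_vertex \<Lambda> n z"
    if "level_vertex \<Lambda> (Suc n) y = level_vertex \<Lambda> (Suc n) z" "y (int n + 1) = z (int n + 1)"
      "y \<in> \<Lambda>" "z \<in> \<Lambda>" for y z n
  proof -
    have "gap_words \<Lambda> 0 (int (Suc n) + 1) y = gap_words \<Lambda> 0 (int (Suc n) + 1) z"
      using that by (simp only: level_vertex_eq)
    moreover have "int (Suc n) + 1 = int n + 2" by simp
    ultimately have "gap_words \<Lambda> 0 (int n + 2) y = gap_words \<Lambda> 0 (int n + 2) z" by metis
    from step_plus[OF this that(2)] show ?thesis using that(3,4) by (simp add: level_vertex_eq)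
  qed
  have right: "e = f" if ef: "e \<in> Eminus (canonical \<Lambda>) l" "f \<in> Eminus (canonical \<Lambda>) l"
    "src (canonical \<Lambda>) e = src (canonical \<Lambda>) f" "lab (canonical \<Lambda>) e = lab (canonical \<Lambda>) f" for e f l
  proof -
    obtain y z where "y \<in> \<Lambda>" "z \<in> \<Lambda>"
      and e: "e = (level_vertex \<Lambda> (Suc l) y, y 1, level_vertex \<Lambda> l (seq_shift 1 y))"
      and f: "f = (level_vertex \<Lambda> (Suc l) z, z 1, level_vertex \<Lambda> l (seq_shift 1 z))"
      using ef(1,2) unfolding Em by blast
    then show ?thesis using lv_minus[of l y z] ef(3,4) by (simp add: sel)
  qed
  have left: "e = f" if ef: "e \<in> Eplus (canonical \<Lambda>) l" "f \<in> Eplus (canonical \<Lambda>) l"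
    "trm (canonical \<Lambda>) e = trm (canonical \<Lambda>) f" "lab (canonical \<Lambda>) e = lab (canonical \<Lambda>) f" for e f l
  proof -
    obtain y z where "y \<in> \<Lambda>" "z \<in> \<Lambda>"
      and e: "e = (level_vertex \<Lambda> l y, y (int l + 1), level_vertex \<Lambda> (Suc l) y)"
      and f: "f = (level_vertex \<Lambda> l z, z (int l + 1), level_vertex \<Lambda> (Suc l) z)"
      using ef(1,2) unfolding Ep by blast
    then show ?thesis using lv_plus[of l y z] ef(3,4) by (simp add: sel)
  qed

  have loc: "\<exists>\<phi>.
        bij_betw \<phi>
          {(fp, fm) \<in> Eplus (canonical \<Lambda>) l \<times> Eminus (canonical \<Lambda>) (Suc l). src (canonical \<Lambda>) fp = u \<and>
             trm (canonical \<Lambda>) fp = trm (canonical \<Lambda>) fm \<and> src (canonical \<Lambda>) fm = v}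
          {(em, ep) \<in> Eminus (canonical \<Lambda>) l \<times> Eplus (canonical \<Lambda>) (Suc l). trm (canonical \<Lambda>) em = u \<and>
             src (canonical \<Lambda>) em = src (canonical \<Lambda>) ep \<and> trm (canonical \<Lambda>) ep = v} \<and>
        (\<forall>fp\<in>Eplus (canonical \<Lambda>) l. \<forall>fm\<in>Eminus (canonical \<Lambda>) (Suc l).
           src (canonical \<Lambda>) fp = u \<and> trm (canonical \<Lambda>) fp = trm (canonical \<Lambda>) fm \<and> src (canonical \<Lambda>) fm = v \<longrightarrow>
           (\<forall>em ep. \<phi> (fp, fm) = (em, ep) \<longrightarrow> lab (canonical \<Lambda>) fp = lab (canonical \<Lambda>) ep \<and>
              lab (canonical \<Lambda>) fm = lab (canonical \<Lambda>) em))"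
    (is "\<exists>\<phi>. bij_betw \<phi> ?A ?B \<and> _") for l u v
  proof -
    let ?L = "canonical \<Lambda>"
    define D where "D = {(z (int l + 2), z 1) | z. z \<in> \<Lambda> \<and> level_vertex \<Lambda> (l + 2) z = v \<and>
      level_vertex \<Lambda> l (seq_shift 1 z) = u}"
    define la where "la = (\<lambda>(fp, fm). (lab ?L fp, lab ?L fm))"
    define lb where "lb = (\<lambda>(em, ep). (lab ?L ep, lab ?L em))"
    have memA: "p \<in> ?A \<longleftrightarrow> fst p \<in> Eplus ?L l \<and> snd p \<in> Eminus ?L (Suc l) \<and> src ?L (fst p) = u \<and>
      trm ?L (fst p) = trm ?L (snd p) \<and> src ?L (snd p) = v" for p
      by (cases p) simp
    have memB: "p \<in> ?B \<longleftrightarrow> fst p \<in> Eminus ?L l \<and> snd p \<in> Eplus ?L (Suc l) \<and> trm ?L (fst p) = u \<and>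
      src ?L (fst p) = src ?L (snd p) \<and> trm ?L (snd p) = v" for p
      by (cases p) simp
    have injA: "inj_on la ?A"
    proof (rule inj_onI)
      fix p p' assume "p \<in> ?A" "p' \<in> ?A" and lab: "la p = la p'"
      note p = this(1,2)[unfolded memA]
      have l: "lab ?L (fst p) = lab ?L (fst p')" "lab ?L (snd p) = lab ?L (snd p')"
        using lab by (simp_all add: la_def split_beta)
      have "snd p = snd p'" using p l(2) right[of "snd p" "Suc l" "snd p'"] by metis
      moreover from this have "fst p = fst p'" using p l(1) left[of "fst p" l "fst p'"] by metis
      ultimately show "p = p'" by (simp only: prod_eq_iff)
    qed
    have injB: "inj_on lb ?B"
    proof (rule inj_onI)
      fix p p' assume "p \<in> ?B" "p' \<in> ?B" and lab: "lb p = lb p'"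
      note p = this(1,2)[unfolded memB]
      have l: "lab ?L (fst p) = lab ?L (fst p')" "lab ?L (snd p) = lab ?L (snd p')"
        using lab by (simp_all add: lb_def split_beta)
      have "snd p = snd p'" using p l(2) left[of "snd p" "Suc l" "snd p'"] by metis
      moreover from this have "fst p = fst p'" using p l(1) right[of "fst p" l "fst p'"] by metis
      ultimately show "p = p'" by (simp only: prod_eq_iff)
    qed
    have fill: "\<exists>z'. z' \<in> \<Lambda> \<and> (\<forall>i. i \<le> 0 \<or> i > int n \<longrightarrow> z' i = z i) \<and> (\<forall>i. 1 \<le> i \<and> i \<le> int n \<longrightarrow> z' i = y i) \<and>
      gap_words \<Lambda> 0 (int n + 1) z' = gap_words \<Lambda> 0 (int n + 1) z"
      if "y \<in> \<Lambda>" "gap_words \<Lambda> 0 (int n + 1) y = gap_words \<Lambda> 0 (int n + 1) z" for y z n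
    proof -
      define w where "w = map y [1..int n]"
      have w: "w \<in> gap_words \<Lambda> 0 (int n + 1) z"
        using gap_words_self[OF that(1), of 0 "int n + 1"] that(2) by (simp add: w_def)
      have "insert_word 0 w z i = z i" if "i \<le> 0 \<or> i > int n" for i
        using that by (auto simp: insert_word_def w_def)
      moreover have "insert_word 0 w z i = y i" if "1 \<le> i \<and> i \<le> int n" for i
        using that by (auto simp: insert_word_def w_def)
      moreover have "gap_words \<Lambda> 0 (int n + 1) (insert_word 0 w z) = gap_words \<Lambda> 0 (int n + 1) z"
        by (rule gap_words_insert) (simp add: w_def gap_def)
      ultimately show ?thesis using w by (intro exI[of _ "insert_word 0 w z"]) (simp add: gap_words_def)
    qed
    have agree: "gap_words \<Lambda> k m x = gap_words \<Lambda> k m y"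
      if "\<And>i. i \<le> k \<or> i \<ge> m \<Longrightarrow> x i = y i" "k < m" for x y k m
    proof -
      have "insert_word k w x = insert_word k w y" if "length w = gap k m" for w
      proof
        fix i
        have "i \<le> k \<or> i \<ge> m" if "\<not> (k < i \<and> i \<le> k + int (length w))"
          using that \<open>length w = gap k m\<close> \<open>k < m\<close> by (auto simp: gap_def)
        then show "insert_word k w x i = insert_word k w y i"
          using \<open>\<And>i. i \<le> k \<or> i \<ge> m \<Longrightarrow> x i = y i\<close> by (auto simp: insert_word_def)
      qed
      then show ?thesis by (auto simp: gap_words_def)
    qed
    have imA: "la ` ?A = D"
    proof (intro subset_antisym subsetI)
      fix d assume "d \<in> la ` ?A"
      then obtain y z where y: "y \<in> \<Lambda>" and z: "z \<in> \<Lambda>" and u: "level_vertex \<Lambda> l y = u"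
        and v: "level_vertex \<Lambda> (l + 2) z = v"
        and yz: "level_vertex \<Lambda> (Suc l) y = level_vertex \<Lambda> (Suc l) (seq_shift 1 z)"
        and d: "d = (y (int l + 1), z 1)"
        by (auto simp: la_def Em Ep sel)
      have "gap_words \<Lambda> 0 (int (Suc l) + 1) y = gap_words \<Lambda> 0 (int (Suc l) + 1) (seq_shift 1 z)"
        using yz y z by (simp only: level_vertex_eq sm)
      from fill[OF y this] obtain t where t: "t \<in> \<Lambda>"
        "\<And>i. i \<le> 0 \<or> i > int (Suc l) \<Longrightarrow> t i = seq_shift 1 z i"
        "\<And>i. 1 \<le> i \<and> i \<le> int (Suc l) \<Longrightarrow> t i = y i"
        "gap_words \<Lambda> 0 (int (Suc l) + 1) t = gap_words \<Lambda> 0 (int (Suc l) + 1) (seq_shift 1 z)" by blast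
      define z' where "z' = seq_shift (-1) t"
      have z': "z' \<in> \<Lambda>" "seq_shift 1 z' = t" using t(1) by (auto simp: z'_def sm seq_shift_add seq_shift_0)
      have "gap_words \<Lambda> 0 (int (l + 2) + 1) z' = gap_words \<Lambda> 0 (int (l + 2) + 1) z"
        using t(2) by (intro agree) (auto simp: z'_def seq_shift_def)
      then have "level_vertex \<Lambda> (l + 2) z' = v" using v z' z by (simp add: level_vertex_eq flip: v)
      moreover have "level_vertex \<Lambda> (Suc l) t = level_vertex \<Lambda> (Suc l) y"
        unfolding yz using t(1,4) z by (simp only: level_vertex_eq sm)
      then have "level_vertex \<Lambda> l (seq_shift 1 z') = u"
        using z' y u lv_plus[of l t y] t(1) t(3)[of "int l + 1"] by simp
      moreover have "z' 1 = z 1" "z' (int l + 2) = y (int l + 1)"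
        using t(2)[of 0] t(3)[of "int l + 1"] by (auto simp: z'_def seq_shift_def add.commute)
      ultimately show "d \<in> D" using d z'(1) unfolding D_def mem_Collect_eq
        by (intro exI[of _ z']) simp
    next
      fix d assume "d \<in> D"
      then obtain z where z: "z \<in> \<Lambda>" "level_vertex \<Lambda> (l + 2) z = v" "level_vertex \<Lambda> l (seq_shift 1 z) = u"
        and d: "d = (z (int l + 2), z 1)" by (auto simp: D_def)
      let ?y = "seq_shift 1 z"
      let ?fp = "(level_vertex \<Lambda> l ?y, ?y (int l + 1), level_vertex \<Lambda> (Suc l) ?y)"
      let ?fm = "(level_vertex \<Lambda> (Suc (Suc l)) z, z 1, level_vertex \<Lambda> (Suc l) ?y)"
      have "?fp \<in> Eplus ?L l" "?fm \<in> Eminus ?L (Suc l)" using z(1) by (auto simp: Ep Em sm)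
      then have "(?fp, ?fm) \<in> ?A" using z by (simp add: sel)
      moreover have "la (?fp, ?fm) = d" by (simp add: la_def sel d seq_shift_def add.commute)
      ultimately show "d \<in> la ` ?A" by (rule rev_image_eqI[OF _ sym])
    qed
    have imB: "lb ` ?B = D"
    proof (intro subset_antisym subsetI)
      fix d assume "d \<in> lb ` ?B"
      then obtain p where p: "p \<in> ?B" "d = lb p" by blast
      note pp = p(1)[unfolded memB]
      then have "fst p \<in> Eminus ?L l" "snd p \<in> Eplus ?L (Suc l)" by simp_all
      then obtain y z where y: "y \<in> \<Lambda>" and z: "z \<in> \<Lambda>"
        and fp: "fst p = (level_vertex \<Lambda> (Suc l) y, y 1, level_vertex \<Lambda> l (seq_shift 1 y))"
        and sp: "snd p = (level_vertex \<Lambda> (Suc l) z, z (int (Suc l) + 1), level_vertex \<Lambda> (Suc (Suc l)) z)"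
        unfolding Em Ep by (elim imageE)
      have u: "level_vertex \<Lambda> l (seq_shift 1 y) = u" and v: "level_vertex \<Lambda> (l + 2) z = v"
        and yz: "level_vertex \<Lambda> (Suc l) y = level_vertex \<Lambda> (Suc l) z"
        using pp unfolding fp sp by (simp_all add: sel)
      have d: "d = (z (int l + 2), y 1)"
        using p(2) fp sp by (simp add: lb_def split_beta sel add.commute)
      have "gap_words \<Lambda> 0 (int (Suc l) + 1) y = gap_words \<Lambda> 0 (int (Suc l) + 1) z"
        using yz y z by (simp only: level_vertex_eq sm)
      from fill[OF y this] obtain t where t: "t \<in> \<Lambda>"
        "\<And>i. i \<le> 0 \<or> i > int (Suc l) \<Longrightarrow> t i = z i"
        "\<And>i. 1 \<le> i \<and> i \<le> int (Suc l) \<Longrightarrow> t i = y i"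
        "gap_words \<Lambda> 0 (int (Suc l) + 1) t = gap_words \<Lambda> 0 (int (Suc l) + 1) z" by blast
      have "gap_words \<Lambda> 0 (int (l + 2) + 1) t = gap_words \<Lambda> 0 (int (l + 2) + 1) z"
        using t(2) by (intro agree) auto
      then have "level_vertex \<Lambda> (l + 2) t = v" using t(1) z by (simp add: level_vertex_eq flip: v)
      moreover have "level_vertex \<Lambda> (Suc l) t = level_vertex \<Lambda> (Suc l) y"
        unfolding yz using t(1,4) z by (simp only: level_vertex_eq)
      then have "level_vertex \<Lambda> l (seq_shift 1 t) = u"
        using y u lv_minus[of l t y] t(1) t(3)[of 1] by simp
      moreover have "t 1 = y 1" "t (int l + 2) = z (int l + 2)"
        using t(2)[of "int l + 2"] t(3)[of 1] by auto
      ultimately show "d \<in> D" using d t(1) unfolding D_def mem_Collect_eq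
        by (intro exI[of _ t]) simp
    next
      fix d assume "d \<in> D"
      then obtain z where z: "z \<in> \<Lambda>" "level_vertex \<Lambda> (l + 2) z = v" "level_vertex \<Lambda> l (seq_shift 1 z) = u"
        and d: "d = (z (int l + 2), z 1)" by (auto simp: D_def)
      let ?em = "(level_vertex \<Lambda> (Suc l) z, z 1, level_vertex \<Lambda> l (seq_shift 1 z))"
      let ?ep = "(level_vertex \<Lambda> (Suc l) z, z (int (Suc l) + 1), level_vertex \<Lambda> (Suc (Suc l)) z)"
      have "?em \<in> Eminus ?L l" "?ep \<in> Eplus ?L (Suc l)" using z(1) unfolding Ep Em by blast+
      then have "(?em, ?ep) \<in> ?B" using z by (simp add: sel)
      moreover have "lb (?em, ?ep) = d" by (simp add: lb_def sel d add.commute)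
      ultimately show "d \<in> lb ` ?B" by (rule rev_image_eqI[OF _ sym])
    qed
    define \<phi> where "\<phi> = inv_into ?B lb \<circ> la"
    have "bij_betw la ?A D" "bij_betw lb ?B D" using injA injB imA imB by (auto simp: bij_betw_def)
    then have "bij_betw \<phi> ?A ?B" unfolding \<phi>_def by (meson bij_betw_inv_into bij_betw_trans)
    moreover have "lb (\<phi> a) = la a" if "a \<in> ?A" for a
      using that imA imB unfolding \<phi>_def comp_def by (metis (no_types, lifting) f_inv_into_f imageI)
    then have "lab ?L fp = lab ?L ep \<and> lab ?L fm = lab ?L em"
      if "fp \<in> Eplus ?L l" "fm \<in> Eminus ?L (Suc l)"
        "src ?L fp = u \<and> trm ?L fp = trm ?L fm \<and> src ?L fm = v" "\<phi> (fp, fm) = (em, ep)" for fp fm em ep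
    proof -
      have "(fp, fm) \<in> ?A" using that by (simp only: memA fst_conv snd_conv simp_thms)
      from \<open>\<And>a. a \<in> ?A \<Longrightarrow> lb (\<phi> a) = la a\<close>[OF this] have "lb (em, ep) = la (fp, fm)"
        by (simp only: that(4))
      then show ?thesis by (simp only: la_def lb_def prod.case prod.inject simp_thms)
    qed
    ultimately show ?thesis by (intro exI[of _ \<phi>] conjI ballI impI allI; blast)
  qed
  show ?thesis
    unfolding lambda_graph_bisystem_def
  proof (intro conjI fin allI finEm finEp)
    show "finite (Vert (canonical \<Lambda>) l)" for l using finV V by simp
    show "\<exists>v. Vert (canonical \<Lambda>) 0 = {v}" using V0 V by simp
    show "disjoint_family (Vert (canonical \<Lambda>))" "disjoint_family (Eminus (canonical \<Lambda>))"
      "disjoint_family (Eplus (canonical \<Lambda>))"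
      by (auto simp: disjoint_family_on_def V Em Ep dest!: lv_n)
    show "Eminus (canonical \<Lambda>) l \<inter> Eplus (canonical \<Lambda>) m = {}" for l m
      by (auto simp: Em Ep dest!: lv_n)
    show "\<forall>e\<in>Eminus (canonical \<Lambda>) l. \<forall>f\<in>Eminus (canonical \<Lambda>) l. e \<noteq> f \<and>
      src (canonical \<Lambda>) e = src (canonical \<Lambda>) f \<longrightarrow> lab (canonical \<Lambda>) e \<noteq> lab (canonical \<Lambda>) f" for l
      using right by blast
    show "\<forall>e\<in>Eplus (canonical \<Lambda>) l. \<forall>f\<in>Eplus (canonical \<Lambda>) l. e \<noteq> f \<and>
      trm (canonical \<Lambda>) e = trm (canonical \<Lambda>) f \<longrightarrow> lab (canonical \<Lambda>) e \<noteq> lab (canonical \<Lambda>) f" for l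
      using left by blast
  qed (use ne S sm loc in \<open>auto simp: V Em Ep sel\<close>)
qed

end

theory Submission
  imports Defs
begin

text \<open>
  A configuration of the canonical system of a subshift consists of its label sequence and, at
  each \<open>(k,l)\<close>, a class of sequences with the same fillings of the gap between \<open>k\<close> and \<open>l\<close>.  On
  any bounded range it looks like the configuration given by a single sequence of the subshift
  (\<open>realizes_exists\<close>), and the sequences that realize it on a range describe a basic open set.

  A conjugacy \<open>g\<close> and its inverse are block codes of some radius (\<open>Curtis_Hedlund_Lyndon\<close>).  The
  class of \<open>g y\<close> at \<open>(k,l)\<close> is therefore determined by the class of \<open>y\<close> on a slightly wider gap and
  by letters of \<open>y\<close> on two collars at the ends of the gap (\<open>central_eq_transport\<close>).  Applying \<open>g\<close> to
  realizing sequences thus extends \<open>g\<close> to a shift-equivariant homeomorphism \<open>push\<close> of configuration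
  spaces.  As the collars avoid the middle of the gap, \<open>push\<close> maps each step of the tail relation
  into a step (\<open>push_Rel_at\<close>), which is all that continuity for the inductive limit topology
  requires.  Acting by \<open>push\<close> on both ends of an arrow is the required isomorphism.

  Conversely, an isomorphism with the stated properties sends \<open>(x, n, z)\<close> to \<open>(h x, n, h z)\<close>.
  Applied to \<open>(x, 1, \<sigma> x)\<close> it shows that \<open>h (\<sigma> x)\<close> and \<open>\<sigma> (h x)\<close> are tail equivalent.  The steps of the
  tail relation are open in it (\<open>openin_Rel_top_Rel_at\<close>) and the configuration space is compact,
  so one step serves for all \<open>x\<close>: there is one position from which on \<open>h\<^sub>\<Lambda> (\<sigma> a)\<close> and
  \<open>\<sigma> (h\<^sub>\<Lambda> a)\<close> agree for every \<open>a\<close> (\<open>tail_equivariant_if_arrow_map\<close>).  The map \<open>h\<^sub>\<Lambda>\<close> need not be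
  a conjugacy, but far to the right it acts by one local rule, and this rule, used at all
  positions, is one (\<open>tail_code\<close>); its inverse arises in the same way from the inverse of
  \<open>h\<^sub>\<Lambda>\<close> (\<open>tail_code_inverse\<close>).
\<close>

section \<open>Sequence spaces and block codes\<close>

text \<open>This form of compactness serves twice: a locally constant function on a subshift
  depends on a bounded window, and a continuous map from the configuration space to the tail
  relation takes its values in one step.\<close>

lemma compact_space_uniform_bound:
  fixes P :: "'x \<Rightarrow> nat \<Rightarrow> bool"
  assumes "compact_space X"
    and mono: "\<And>x n k. P x n \<Longrightarrow> n \<le> k \<Longrightarrow> P x k"
    and local: "\<And>x. x \<in> topspace X \<Longrightarrow> \<exists>U n. openin X U \<and> x \<in> U \<and> (\<forall>y\<in>U. P y n)"
  shows "\<exists>n. \<forall>x\<in>topspace X. P x n"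
proof -
  define \<U> where "\<U> = {U. openin X U \<and> (\<exists>n. \<forall>y\<in>U. P y n)}"
  have "topspace X \<subseteq> \<Union>\<U>"
    using local unfolding \<U>_def by blast
  moreover have "\<forall>U\<in>\<U>. openin X U"
    by (simp add: \<U>_def)
  ultimately obtain \<F> where \<F>: "finite \<F>" "\<F> \<subseteq> \<U>" "topspace X \<subseteq> \<Union>\<F>"
    using assms(1)[unfolded compact_space_alt, THEN spec[of _ \<U>]] by auto
  have "\<forall>U\<in>\<F>. \<exists>n. \<forall>y\<in>U. P y n"
    using \<F>(2) by (auto simp: \<U>_def)
  then obtain N where N: "\<forall>U\<in>\<F>. \<forall>y\<in>U. P y (N U)"
    by metis
  have "finite (N ` \<F>)"
    using \<F>(1) by blast
  then obtain n where n: "\<forall>U\<in>\<F>. N U \<le> n"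
    unfolding finite_nat_set_iff_bounded_le by blast
  have "P x n" if x: "x \<in> topspace X" for x
  proof -
    obtain U where "U \<in> \<F>" "x \<in> U"
      using x \<F>(3) by blast
    then show ?thesis
      using mono[of x "N U" n] N n by blast
  qed
  then show ?thesis by blast
qed

lemma subshift_invariant: "subshift S \<Lambda> \<Longrightarrow> seq_shift 1 ` \<Lambda> = \<Lambda>"
  by (simp add: subshift_def)

lemma topspace_full_shift_top: "topspace (full_shift_top S) = {a. range a \<subseteq> S}"
  by (auto simp: full_shift_top_def PiE_UNIV_domain)

lemma subshift_range:
  assumes "subshift S \<Lambda>" and "a \<in> \<Lambda>"
  shows "range a \<subseteq> S"
  using assms closedin_subset[of "full_shift_top S" \<Lambda>]
  by (auto simp: subshift_def topspace_full_shift_top)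

lemma topspace_shift_top:
  assumes "subshift S \<Lambda>"
  shows "topspace (shift_top S \<Lambda>) = \<Lambda>"
  using assms closedin_subset by (fastforce simp: subshift_def shift_top_def)

lemma compact_space_shift_top:
  assumes "subshift S \<Lambda>"
  shows "compact_space (shift_top S \<Lambda>)"
proof -
  have "compact_space (full_shift_top S)"
    using assms unfolding full_shift_top_def compact_space_product_topology
    by (simp add: subshift_def compact_space_discrete_topology)
  then show ?thesis
    using assms unfolding shift_top_def subshift_def
    by (simp add: closedin_compact_space compact_space_subtopology)
qed

lemma openin_full_shift_window:
  assumes "openin (full_shift_top S) U" and "a \<in> U"
  obtains n :: nat where
    "\<And>b. range b \<subseteq> S \<Longrightarrow> (\<And>i. \<bar>i\<bar> \<le> int n \<Longrightarrow> b i = a i) \<Longrightarrow> b \<in> U"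
proof -
  obtain B where B: "finite {i. B i \<noteq> S}" "\<And>i. B i \<subseteq> S" "a \<in> Pi UNIV B" "Pi UNIV B \<subseteq> U"
    using assms unfolding full_shift_top_def openin_product_topology_alt
    by (auto simp: PiE_UNIV_domain)
  have "finite ((\<lambda>i. nat \<bar>i\<bar>) ` {i. B i \<noteq> S})"
    using B(1) by blast
  then obtain n where n: "\<And>i. B i \<noteq> S \<Longrightarrow> nat \<bar>i\<bar> \<le> n"
    unfolding finite_nat_set_iff_bounded_le by blast
  have "b \<in> U" if b: "range b \<subseteq> S" "\<And>i. \<bar>i\<bar> \<le> int n \<Longrightarrow> b i = a i" for b
  proof -
    have "b i \<in> B i" for i
    proof (cases "B i = S")
      case False
      then have "b i = a i"
        using n[of i] b(2)[of i] by linarith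
      then show ?thesis
        using B(3) by auto
    qed (use b in auto)
    then show ?thesis
      using B(4) by blast
  qed
  then show thesis
    using that by blast
qed

lemma shift_closedD:
  assumes "subshift S \<Lambda>"
    and "\<And>n::nat. \<exists>b\<in>\<Lambda>. \<forall>i. \<bar>i\<bar> \<le> int n \<longrightarrow> b i = a i"
  shows "a \<in> \<Lambda>"
proof (rule ccontr)
  assume "a \<notin> \<Lambda>"
  have \<Lambda>: "range b \<subseteq> S" if "b \<in> \<Lambda>" for b
    using subshift_range[OF assms(1) that] .
  have "a i \<in> S" for i
  proof -
    obtain b where "b \<in> \<Lambda>" "b i = a i"
      using assms(2)[of "nat \<bar>i\<bar>"] by force
    then show ?thesis
      using \<Lambda>[of b] by (metis rangeI subsetD)
  qed
  then have "a \<in> topspace (full_shift_top S) - \<Lambda>"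
    using \<open>a \<notin> \<Lambda>\<close> by (auto simp: topspace_full_shift_top)
  moreover have "openin (full_shift_top S) (topspace (full_shift_top S) - \<Lambda>)"
    using assms(1) by (simp add: subshift_def closedin_def)
  ultimately obtain n :: nat where n:
    "\<And>b. range b \<subseteq> S \<Longrightarrow> (\<And>i. \<bar>i\<bar> \<le> int n \<Longrightarrow> b i = a i) \<Longrightarrow> b \<in> topspace (full_shift_top S) - \<Lambda>"
    using openin_full_shift_window by metis
  show False
    using assms(2)[of n] n \<Lambda> by blast
qed

lemma continuous_map_seq_shift:
  assumes "subshift S \<Lambda>"
  shows "continuous_map (shift_top S \<Lambda>) (shift_top S \<Lambda>) (seq_shift n)"
proof -
  have "continuous_map (full_shift_top S) (full_shift_top S) (seq_shift n)"
    unfolding full_shift_top_def continuous_map_componentwise_UNIV seq_shift_def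
    using continuous_map_product_projection[of "_ + n" UNIV "\<lambda>_. discrete_topology S"] by simp
  then show ?thesis
    using seq_shift_mem[OF subshift_invariant[OF assms]] unfolding shift_top_def
    by (simp add: continuous_map_from_subtopology continuous_map_in_subtopology image_subset_iff)
qed

lemma continuous_map_shift_component:
  "continuous_map X (shift_top S \<Lambda>) f \<Longrightarrow> continuous_map X (discrete_topology S) (\<lambda>x. f x i)"
  unfolding shift_top_def full_shift_top_def continuous_map_in_subtopology
    continuous_map_componentwise_UNIV
  by blast

text \<open>Around every sequence some cylinder lies in a level set of \<open>f\<close>; compactness bounds the
  lengths of the cylinders needed.  The predicate \<open>P\<close> is monotone in the length, as the bound
  requires.\<close>

lemma locally_constant_window:
  assumes "subshift S \<Lambda>" and "continuous_map (shift_top S \<Lambda>) (discrete_topology T) f"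
  shows "\<exists>m::nat. \<forall>a\<in>\<Lambda>. \<forall>b\<in>\<Lambda>. (\<forall>i. \<bar>i\<bar> \<le> int m \<longrightarrow> a i = b i) \<longrightarrow> f a = f b"
proof -
  define P where "P = (\<lambda>a n. \<forall>b\<in>\<Lambda>. (\<forall>i. \<bar>i\<bar> \<le> int n \<longrightarrow> b i = a i) \<longrightarrow> f b = f a)"
  define C where "C = (\<lambda>a n. {b \<in> \<Lambda>. \<forall>i. \<bar>i\<bar> \<le> int n \<longrightarrow> b i = a i})"
  have top: "topspace (shift_top S \<Lambda>) = \<Lambda>"
    by (rule topspace_shift_top[OF assms(1)])
  have \<Lambda>: "range b \<subseteq> S" if "b \<in> \<Lambda>" for b
    using subshift_range[OF assms(1) that] .
  have ex: "\<exists>n. P a n" if "a \<in> \<Lambda>" for a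
  proof -
    have "f a \<in> T"
      using assms(2) that top by (auto simp: continuous_map_def)
    then have "openin (shift_top S \<Lambda>) {b \<in> topspace (shift_top S \<Lambda>). f b \<in> {f a}}"
      using assms(2) by (intro openin_continuous_map_preimage) auto
    then obtain U where U: "openin (full_shift_top S) U" "{b \<in> \<Lambda>. f b = f a} = U \<inter> \<Lambda>"
      unfolding top by (auto simp: shift_top_def openin_subtopology)
    then have "a \<in> U"
      using that by blast
    with U(1) obtain n where "\<And>b. range b \<subseteq> S \<Longrightarrow> (\<And>i. \<bar>i\<bar> \<le> int n \<Longrightarrow> b i = a i) \<Longrightarrow> b \<in> U"
      using openin_full_shift_window by metis
    then show ?thesis
      using U(2) \<Lambda> unfolding P_def by blast
  qed
  have open_C: "openin (shift_top S \<Lambda>) (C a n)" if "a \<in> \<Lambda>" for a n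
  proof -
    have "openin (shift_top S \<Lambda>) (\<Inter>i\<in>{- int n..int n}. {b \<in> topspace (shift_top S \<Lambda>). b i \<in> {a i}})"
    proof (intro openin_INT2 openin_continuous_map_preimage)
      show "continuous_map (shift_top S \<Lambda>) (discrete_topology S) (\<lambda>b. b i)" for i
        using continuous_map_shift_component[OF continuous_map_id] by simp
    qed (use \<Lambda> that in auto)
    moreover have "(\<Inter>i\<in>{- int n..int n}. {b \<in> topspace (shift_top S \<Lambda>). b i \<in> {a i}}) = C a n"
      unfolding top C_def by (auto simp: abs_le_iff minus_le_iff)
    ultimately show ?thesis by simp
  qed
  have "\<exists>n. \<forall>b\<in>topspace (shift_top S \<Lambda>). P b n"
  proof (rule compact_space_uniform_bound[OF compact_space_shift_top[OF assms(1)]])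
    show "P b k" if "P b n" "n \<le> k" for b n k
      using that unfolding P_def by (meson of_nat_mono order_trans)
    fix a assume "a \<in> topspace (shift_top S \<Lambda>)"
    then have a: "a \<in> \<Lambda>"
      by (simp add: top)
    obtain n where n: "P a n"
      using ex[OF a] by blast
    have "P b n" if "b \<in> C a n" for b
      using that n unfolding C_def P_def by simp
    then show "\<exists>U n. openin (shift_top S \<Lambda>) U \<and> a \<in> U \<and> (\<forall>b\<in>U. P b n)"
      using open_C[OF a, of n] a by (intro exI[of _ "C a n"] exI[of _ n]) (simp add: C_def)
  qed
  then obtain m where m: "\<And>b. b \<in> \<Lambda> \<Longrightarrow> P b m"
    unfolding top by blast
  have "f a = f b" if "a \<in> \<Lambda>" "b \<in> \<Lambda>" "\<forall>i. \<bar>i\<bar> \<le> int m \<longrightarrow> a i = b i" for a b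
    using m[OF that(2)] that(1,3) unfolding P_def by simp
  then show ?thesis by blast
qed

lemma equivariant_seq_shift:
  assumes "seq_shift 1 ` \<Lambda> = \<Lambda>" and "\<And>a. a \<in> \<Lambda> \<Longrightarrow> g (seq_shift 1 a) = seq_shift 1 (g a)"
    and "a \<in> \<Lambda>"
  shows "g (seq_shift n a) = seq_shift n (g a)"
  using assms(3)
proof (induction n arbitrary: a rule: int_induct[where k = 0])
  case base
  then show ?case by (simp add: seq_shift_0)
next
  case (step1 i)
  then show ?case
    using assms(2)[of "seq_shift i a"] seq_shift_mem[OF assms(1)]
    by (simp add: seq_shift_add add.commute)
next
  case (step2 i)
  then have "g (seq_shift i a) = seq_shift 1 (g (seq_shift (i - 1) a))"
    using assms(2)[of "seq_shift (i - 1) a"] seq_shift_mem[OF assms(1)]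
    by (simp add: seq_shift_add)
  then have "seq_shift (-1) (seq_shift i (g a)) = g (seq_shift (i - 1) a)"
    using step2 by (simp add: seq_shift_add seq_shift_0)
  then show ?case
    by (simp add: seq_shift_add)
qed

lemma equivariant_inverse:
  assumes "seq_shift 1 ` \<Lambda>1 = \<Lambda>1" and "\<And>a. a \<in> \<Lambda>1 \<Longrightarrow> g (seq_shift 1 a) = seq_shift 1 (g a)"
    and "\<And>a. a \<in> \<Lambda>1 \<Longrightarrow> g' (g a) = a" and "g' b \<in> \<Lambda>1" "g (g' b) = b"
  shows "g' (seq_shift 1 b) = seq_shift 1 (g' b)"
proof -
  have "g (seq_shift 1 (g' b)) = seq_shift 1 b" "seq_shift 1 (g' b) \<in> \<Lambda>1"
    using assms(2)[OF assms(4)] assms(4,5) seq_shift_mem[OF assms(1)] by auto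
  then show ?thesis
    using assms(3)[of "seq_shift 1 (g' b)"] by simp
qed

definition block_code :: "(int \<Rightarrow> 'a) set \<Rightarrow> nat \<Rightarrow> ((int \<Rightarrow> 'a) \<Rightarrow> int \<Rightarrow> 'b) \<Rightarrow> bool" where
  "block_code \<Lambda> m g \<longleftrightarrow>
     (\<forall>a\<in>\<Lambda>. \<forall>b\<in>\<Lambda>. \<forall>j. (\<forall>i. \<bar>i - j\<bar> \<le> int m \<longrightarrow> a i = b i) \<longrightarrow> g a j = g b j)"

lemma block_codeD:
  assumes "block_code \<Lambda> m g" "a \<in> \<Lambda>" "b \<in> \<Lambda>"
    and "\<And>i. j - int m \<le> i \<Longrightarrow> i \<le> j + int m \<Longrightarrow> a i = b i"
  shows "g a j = g b j"
proof -
  have "\<forall>i. \<bar>i - j\<bar> \<le> int m \<longrightarrow> a i = b i"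
    using assms(4) by (auto simp: abs_le_iff)
  then show ?thesis
    using assms(1-3) unfolding block_code_def by blast
qed

lemma block_code_mono:
  assumes "block_code \<Lambda> m g" and "m \<le> n"
  shows "block_code \<Lambda> n g"
proof -
  have "\<forall>i. \<bar>i - j\<bar> \<le> int m \<longrightarrow> a i = b i" if "\<forall>i. \<bar>i - j\<bar> \<le> int n \<longrightarrow> a i = b i"
    for a b :: "int \<Rightarrow> 'a" and j
    using that assms(2) by auto
  then show ?thesis
    using assms(1) unfolding block_code_def by blast
qed

text \<open>The letter at \<open>0\<close> of the image is a locally constant function of the sequence, so a
  window of some length \<open>m\<close> around \<open>0\<close> determines it; equivariance moves the window to any other
  position.\<close>

lemma Curtis_Hedlund_Lyndon:
  assumes "subshift S \<Lambda>" and "continuous_map (shift_top S \<Lambda>) (shift_top T \<Lambda>') g"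
    and "\<And>a. a \<in> \<Lambda> \<Longrightarrow> g (seq_shift 1 a) = seq_shift 1 (g a)"
  shows "\<exists>m. block_code \<Lambda> m g"
proof -
  note inv = subshift_invariant[OF assms(1)]
  obtain m :: nat where
    "\<forall>a\<in>\<Lambda>. \<forall>b\<in>\<Lambda>. (\<forall>i. \<bar>i\<bar> \<le> int m \<longrightarrow> a i = b i) \<longrightarrow> g a 0 = g b 0"
    using locally_constant_window[OF assms(1) continuous_map_shift_component[OF assms(2), of 0]]
    by (elim exE)
  then have m: "g a 0 = g b 0"
    if "a \<in> \<Lambda>" "b \<in> \<Lambda>" "\<And>i. \<bar>i\<bar> \<le> int m \<Longrightarrow> a i = b i" for a b
    using that by blast
  have "g a j = g b j" if "a \<in> \<Lambda>" "b \<in> \<Lambda>" "\<And>i. \<bar>i - j\<bar> \<le> int m \<Longrightarrow> a i = b i" for a b j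
  proof -
    have "g (seq_shift j a) 0 = g (seq_shift j b) 0"
    proof (rule m)
      show "seq_shift j a i = seq_shift j b i" if "\<bar>i\<bar> \<le> int m" for i
        using that \<open>\<And>i. \<bar>i - j\<bar> \<le> int m \<Longrightarrow> a i = b i\<close>[of "i + j"] by (simp add: seq_shift_def)
    qed (use that in \<open>simp_all add: seq_shift_mem[OF inv]\<close>)
    moreover have "g (seq_shift j a) = seq_shift j (g a)" "g (seq_shift j b) = seq_shift j (g b)"
      using equivariant_seq_shift[of \<Lambda> g _ j, OF inv assms(3)] that(1,2) by blast+
    ultimately have "seq_shift j (g a) 0 = seq_shift j (g b) 0"
      by simp
    then show ?thesis
      by (simp add: seq_shift_def)
  qed
  then show ?thesis
    unfolding block_code_def by blast
qed

section \<open>Central equivalence\<close>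

text \<open>Filling a gap with the letters of another sequence, instead of with a word, makes
  all index computations with word lengths disappear.\<close>

definition splice :: "int \<Rightarrow> int \<Rightarrow> (int \<Rightarrow> 'a) \<Rightarrow> (int \<Rightarrow> 'a) \<Rightarrow> int \<Rightarrow> 'a" where
  "splice k l b y = (\<lambda>i. if k < i \<and> i < l then b i else y i)"

text \<open>Equality of the sets \<open>W\<^bsub>k,l\<^esub>\<close>; see \<open>gap_words_eq_iff\<close> below.\<close>

definition central_eq :: "(int \<Rightarrow> 'a) set \<Rightarrow> int \<Rightarrow> int \<Rightarrow> (int \<Rightarrow> 'a) \<Rightarrow> (int \<Rightarrow> 'a) \<Rightarrow> bool" where
  "central_eq \<Lambda> k l y z \<longleftrightarrow> (\<forall>b. splice k l b y \<in> \<Lambda> \<longleftrightarrow> splice k l b z \<in> \<Lambda>)"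

lemma central_eqD: "central_eq \<Lambda> k l y z \<Longrightarrow> splice k l b y \<in> \<Lambda> \<Longrightarrow> splice k l b z \<in> \<Lambda>"
  by (simp add: central_eq_def)

lemma central_eq_sym: "central_eq \<Lambda> k l y z \<Longrightarrow> central_eq \<Lambda> k l z y"
  by (simp add: central_eq_def)

lemma insert_word_eq_splice:
  assumes "length w = gap k l"
  shows "insert_word k w y = splice k l (\<lambda>i. w ! nat (i - k - 1)) y"
  using assms by (auto simp: insert_word_def splice_def gap_def intro!: ext)

lemma splice_eq_insert_word:
  shows "splice k l b y = insert_word k (map b [k+1..l-1]) y"
  by (auto simp: insert_word_def splice_def gap_def intro!: ext)

lemma gap_words_eq_iff: "gap_words \<Lambda> k l y = gap_words \<Lambda> k l z \<longleftrightarrow> central_eq \<Lambda> k l y z"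
proof
  assume eq: "gap_words \<Lambda> k l y = gap_words \<Lambda> k l z"
  have "splice k l b y \<in> \<Lambda> \<longleftrightarrow> map b [k+1..l-1] \<in> gap_words \<Lambda> k l y" for b y
    by (simp add: splice_eq_insert_word gap_words_def gap_def)
  then show "central_eq \<Lambda> k l y z"
    using eq by (simp add: central_eq_def)
next
  assume "central_eq \<Lambda> k l y z"
  then show "gap_words \<Lambda> k l y = gap_words \<Lambda> k l z"
    by (auto simp: gap_words_def insert_word_eq_splice central_eq_def)
qed

lemma cvertex_eq_iff:
  assumes "y \<in> \<Lambda>" "z \<in> \<Lambda>"
  shows "cvertex \<Lambda> k l y = cvertex \<Lambda> k l z \<longleftrightarrow> central_eq \<Lambda> k l y z"
proof -
  have "inj (seq_shift k :: (int \<Rightarrow> 'a) \<Rightarrow> int \<Rightarrow> 'a)"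
    by (rule inj_on_inverseI[of _ "seq_shift (- k)"]) (simp add: seq_shift_add seq_shift_0)
  then have "cvertex \<Lambda> k l y = cvertex \<Lambda> k l z \<longleftrightarrow> central_class \<Lambda> k l y = central_class \<Lambda> k l z"
    by (simp add: cvertex_def inj_image_eq_iff)
  also have "\<dots> \<longleftrightarrow> gap_words \<Lambda> k l y = gap_words \<Lambda> k l z"
    using assms by (auto simp: central_class_def)
  finally show ?thesis
    by (simp add: gap_words_eq_iff)
qed

lemma central_eq_outside:
  assumes "\<And>i. i \<le> k \<or> l \<le> i \<Longrightarrow> y i = z i"
  shows "central_eq \<Lambda> k l y z"
proof -
  have "splice k l b y = splice k l b z" for b
    using assms by (auto simp: splice_def intro!: ext)
  then show ?thesis by (simp add: central_eq_def)
qed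

text \<open>A filling of the smaller gap is a filling of the larger one that repeats the common letters
  of \<open>y\<close> and \<open>z\<close> on the difference.\<close>

lemma central_eq_subinterval:
  assumes "central_eq \<Lambda> k l y z" and "k \<le> k'" "l' \<le> l"
    and "\<And>i. k < i \<Longrightarrow> i \<le> k' \<Longrightarrow> y i = z i" and "\<And>i. l' \<le> i \<Longrightarrow> i < l \<Longrightarrow> y i = z i"
  shows "central_eq \<Lambda> k' l' y z"
proof -
  have "splice k' l' b y = splice k l (splice k' l' b y) y"
    "splice k' l' b z = splice k l (splice k' l' b y) z" for b
    using assms(2-5) by (auto simp: splice_def intro!: ext)
  then show ?thesis
    using assms(1) unfolding central_eq_def by metis
qed

text \<open>A filling of the gap of \<open>g y\<close> is pulled back by \<open>g'\<close> to a filling of a gap of \<open>y\<close> wider by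
  the code radius, which then also fills that gap of \<open>z\<close>.  Its image under \<open>g\<close> fills the original
  gap of \<open>g z\<close>: the positions near the gap, where the image could differ from both \<open>g z\<close> and the
  filling, see only letters at which \<open>y\<close> and \<open>z\<close> agree.  Agreement is demanded on two collars
  only, not throughout the gap, because tail equivalent configurations carry different
  letters there.\<close>

lemma central_eq_block_code_aux:
  assumes g: "block_code \<Lambda>1 m g" "g ` \<Lambda>1 \<subseteq> \<Lambda>2" and g': "block_code \<Lambda>2 m g'" "g' ` \<Lambda>2 \<subseteq> \<Lambda>1"
    and g'g: "\<And>a. a \<in> \<Lambda>1 \<Longrightarrow> g' (g a) = a" and gg': "\<And>b. b \<in> \<Lambda>2 \<Longrightarrow> g (g' b) = b"
    and yz: "y \<in> \<Lambda>1" "z \<in> \<Lambda>1" "central_eq \<Lambda>1 (k - int m) (l + int m) y z"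
    and left: "\<And>i. k - 3 * int m \<le> i \<Longrightarrow> i \<le> k + int m \<Longrightarrow> y i = z i"
    and right: "\<And>i. l - int m \<le> i \<Longrightarrow> i \<le> l + 3 * int m \<Longrightarrow> y i = z i"
    and b: "splice k l b (g y) \<in> \<Lambda>2"
  shows "splice k l b (g z) \<in> \<Lambda>2"
proof -
  define c where "c = g' (splice k l b (g y))"
  have c: "c \<in> \<Lambda>1" "g c = splice k l b (g y)"
    using b g'(2) gg' by (auto simp: c_def)
  have "c i = y i" if "i \<le> k - int m \<or> l + int m \<le> i" for i
  proof -
    have "c i = g' (g y) i"
      unfolding c_def
      by (rule block_codeD[OF g'(1) b]) (use yz(1) g(2) that in \<open>auto simp: splice_def\<close>)
    then show ?thesis
      using g'g yz(1) by simp
  qed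
  then have "splice (k - int m) (l + int m) c y = c"
    by (auto simp: splice_def intro!: ext)
  define d where "d = splice (k - int m) (l + int m) c z"
  have d: "d \<in> \<Lambda>1"
    using central_eqD[OF yz(3), of c] c(1) \<open>splice _ _ c y = c\<close> by (simp add: d_def)
  \<comment> \<open>Within \<open>2 m\<close> of the gap, \<open>g\<close> sees letters of \<open>d\<close> that are letters of \<open>c\<close>; farther away it
    sees only letters of \<open>z\<close>.\<close>
  have "g d i = splice k l b (g z) i" for i
  proof (cases "k - 2 * int m < i \<and> i < l + 2 * int m")
    case True
    have "g d i = g c i"
    proof (rule block_codeD[OF g(1) d c(1)])
      fix j assume "i - int m \<le> j" "j \<le> i + int m"
      then show "d j = c j"
        using left[of j] right[of j] True \<open>\<And>i. i \<le> k - int m \<or> l + int m \<le> i \<Longrightarrow> c i = y i\<close>[of j]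
        by (auto simp: d_def splice_def)
    qed
    also have "g c i = splice k l b (g z) i"
    proof (cases "k < i \<and> i < l")
      case False
      have "g y i = g z i"
        by (rule block_codeD[OF g(1) yz(1,2)]) (use left right True False in force)
      then show ?thesis
        using False c(2) by (auto simp: splice_def)
    qed (simp add: c(2) splice_def)
    finally show ?thesis .
  next
    case False
    have "g d i = g z i"
      by (rule block_codeD[OF g(1) d yz(2)]) (use False in \<open>auto simp: d_def splice_def\<close>)
    moreover have "\<not> (k < i \<and> i < l)"
      using False by auto
    ultimately show ?thesis
      by (auto simp: splice_def)
  qed
  then have "g d = splice k l b (g z)"
    by blast
  then show ?thesis
    using d g(2) by auto
qed

text \<open>A conjugacy presented by the block codes of both directions; one radius \<open>m\<close> for both keeps
  the situation symmetric, so that every result also holds for the inverse.\<close>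

locale block_conjugacy =
  fixes S1 :: "'a set" and \<Lambda>1 :: "(int \<Rightarrow> 'a) set" and S2 :: "'b set" and \<Lambda>2 :: "(int \<Rightarrow> 'b) set"
    and g g' and m :: nat
  assumes sub1: "subshift S1 \<Lambda>1" and sub2: "subshift S2 \<Lambda>2"
    and g: "block_code \<Lambda>1 m g" "g ` \<Lambda>1 \<subseteq> \<Lambda>2"
    and g': "block_code \<Lambda>2 m g'" "g' ` \<Lambda>2 \<subseteq> \<Lambda>1"
    and g'g: "\<And>a. a \<in> \<Lambda>1 \<Longrightarrow> g' (g a) = a" and gg': "\<And>b. b \<in> \<Lambda>2 \<Longrightarrow> g (g' b) = b"
    and g_shift: "\<And>a. a \<in> \<Lambda>1 \<Longrightarrow> g (seq_shift 1 a) = seq_shift 1 (g a)"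
begin

lemmas inv1 = subshift_invariant[OF sub1] and inv2 = subshift_invariant[OF sub2]

text \<open>The collars of radius \<open>3 m\<close> have to lie strictly inside the gap widened by the margin,
  since a sequence realizing a configuration has the right letters only there.\<close>

definition margin :: int where "margin = 3 * int m + 1"

lemma margin_pos: "0 < margin"
  by (simp add: margin_def)

lemma central_eq_transport:
  assumes yz: "y \<in> \<Lambda>1" "z \<in> \<Lambda>1" "central_eq \<Lambda>1 (k - margin) (l + margin) y z"
    and left: "\<And>i. k - margin < i \<Longrightarrow> i \<le> k + int m \<Longrightarrow> y i = z i"
    and right: "\<And>i. l - int m \<le> i \<Longrightarrow> i < l + margin \<Longrightarrow> y i = z i"
  shows "central_eq \<Lambda>2 k l (g y) (g z)"
proof -
  have ce: "central_eq \<Lambda>1 (k - int m) (l + int m) y z"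
    by (rule central_eq_subinterval[OF yz(3)]) (use left right in \<open>auto simp: margin_def\<close>)
  have ce': "central_eq \<Lambda>1 (k - int m) (l + int m) z y"
    by (rule central_eq_sym[OF ce])
  have left': "y i = z i" if "k - 3 * int m \<le> i" "i \<le> k + int m" for i
    using left that by (simp add: margin_def)
  have right': "y i = z i" if "l - int m \<le> i" "i \<le> l + 3 * int m" for i
    using right that by (simp add: margin_def)
  show ?thesis
    unfolding central_eq_def
  proof (intro allI iffI)
    show "splice k l b (g z) \<in> \<Lambda>2" if "splice k l b (g y) \<in> \<Lambda>2" for b
      by (rule central_eq_block_code_aux[OF g g' _ _ yz(1,2) ce left' right' that]) (simp_all add: g'g gg')
    show "splice k l b (g y) \<in> \<Lambda>2" if "splice k l b (g z) \<in> \<Lambda>2" for b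
      by (rule central_eq_block_code_aux[OF g g' _ _ yz(2,1) ce' left'[symmetric] right'[symmetric] that])
        (simp_all add: g'g gg')
  qed
qed

lemma g_local:
  assumes "y \<in> \<Lambda>1" "z \<in> \<Lambda>1" "\<And>j. \<bar>j - i\<bar> < margin \<Longrightarrow> y j = z j"
  shows "g y i = g z i"
  by (rule block_codeD[OF g(1) assms(1,2)]) (use assms(3) in \<open>auto simp: margin_def\<close>)

lemma g_seq_shift: "a \<in> \<Lambda>1 \<Longrightarrow> g (seq_shift n a) = seq_shift n (g a)"
  using equivariant_seq_shift[of \<Lambda>1 g a n] inv1 g_shift by blast

lemma inverse: "block_conjugacy S2 \<Lambda>2 S1 \<Lambda>1 g' g m"
proof (unfold_locales; (fact sub1 sub2 g g' g'g gg')?)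
  fix b assume "b \<in> \<Lambda>2"
  then show "g' (seq_shift 1 b) = seq_shift 1 (g' b)"
    using equivariant_inverse[of \<Lambda>1 g g' b] inv1 g_shift g'g gg' g'(2) by blast
qed

end

section \<open>Configurations of the canonical system\<close>

lemma canonical_sel:
  "src (canonical \<Lambda>) e = fst e" "lab (canonical \<Lambda>) e = fst (snd e)" "trm (canonical \<Lambda>) e = snd (snd e)"
  by (simp_all add: canonical_def split_beta)

lemma seq_shift_image:
  assumes "seq_shift 1 ` \<Lambda> = \<Lambda>"
  shows "seq_shift k ` \<Lambda> = \<Lambda>"
proof (intro subset_antisym subsetI)
  fix y assume "y \<in> \<Lambda>"
  then show "y \<in> seq_shift k ` \<Lambda>"
    using seq_shift_mem[OF assms]
    by (intro image_eqI[of _ _ "seq_shift (- k) y"]) (simp_all add: seq_shift_add seq_shift_0)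
qed (use seq_shift_mem[OF assms] in auto)

text \<open>Membership in the vertex and edge sets, read at a position \<open>(k,l)\<close> of the configuration
  space: every edge comes from one sequence that has its label and both its end vertices.\<close>

lemma canonical_Vert_at:
  assumes "seq_shift 1 ` \<Lambda> = \<Lambda>" "k < l"
  shows "v \<in> Vert (canonical \<Lambda>) (gap k l) \<longleftrightarrow> (\<exists>y\<in>\<Lambda>. v = cvertex \<Lambda> k l y)"
proof -
  have "(\<exists>y\<in>\<Lambda>. v = cvertex \<Lambda> k l y) \<longleftrightarrow> v \<in> level_vertex \<Lambda> (gap k l) ` seq_shift k ` \<Lambda>"
    using cvertex_level[OF assms] by auto
  then show ?thesis
    by (simp only: canonical_Vert[OF assms(1)] seq_shift_image[OF assms(1)])
qed

lemma canonical_Eminus_at: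
  assumes "seq_shift 1 ` \<Lambda> = \<Lambda>" "k < l"
  shows "e \<in> Eminus (canonical \<Lambda>) (gap k l) \<longleftrightarrow>
    (\<exists>y\<in>\<Lambda>. e = (cvertex \<Lambda> (k - 1) l y, y k, cvertex \<Lambda> k l y))"
proof -
  have "cvertex \<Lambda> (k - 1) l y = level_vertex \<Lambda> (Suc (gap k l)) (seq_shift (k - 1) y)" for y
    using cvertex_level[OF assms(1), of "k - 1" l] assms(2) by (simp add: gap_def Suc_nat_eq_nat_zadd1)
  moreover have "cvertex \<Lambda> k l y = level_vertex \<Lambda> (gap k l) (seq_shift 1 (seq_shift (k - 1) y))" for y
    using cvertex_level[OF assms] by (simp add: seq_shift_add)
  moreover have "y k = seq_shift (k - 1) y 1" for y :: "int \<Rightarrow> 'a"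
    by (simp add: seq_shift_def)
  ultimately have "(\<exists>y\<in>\<Lambda>. e = (cvertex \<Lambda> (k - 1) l y, y k, cvertex \<Lambda> k l y)) \<longleftrightarrow>
    e \<in> (\<lambda>y. (level_vertex \<Lambda> (Suc (gap k l)) y, y 1, level_vertex \<Lambda> (gap k l) (seq_shift 1 y)))
      ` seq_shift (k - 1) ` \<Lambda>"
    by auto
  then show ?thesis
    by (simp only: canonical_Eminus[OF assms(1)] seq_shift_image[OF assms(1)])
qed

lemma canonical_Eplus_at:
  assumes "seq_shift 1 ` \<Lambda> = \<Lambda>" "k < l"
  shows "e \<in> Eplus (canonical \<Lambda>) (gap k l) \<longleftrightarrow>
    (\<exists>y\<in>\<Lambda>. e = (cvertex \<Lambda> k l y, y l, cvertex \<Lambda> k (l + 1) y))"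
proof -
  have "cvertex \<Lambda> k (l + 1) y = level_vertex \<Lambda> (Suc (gap k l)) (seq_shift k y)" for y
    using cvertex_level[OF assms(1), of k "l + 1"] assms(2) by (simp add: gap_def Suc_nat_eq_nat_zadd1)
  moreover have "cvertex \<Lambda> k l y = level_vertex \<Lambda> (gap k l) (seq_shift k y)" for y
    using cvertex_level[OF assms] by simp
  moreover have "y l = seq_shift k y (int (gap k l) + 1)" for y :: "int \<Rightarrow> 'a"
    using assms(2) by (simp add: seq_shift_def gap_def)
  ultimately have "(\<exists>y\<in>\<Lambda>. e = (cvertex \<Lambda> k l y, y l, cvertex \<Lambda> k (l + 1) y)) \<longleftrightarrow>
    e \<in> (\<lambda>y. (level_vertex \<Lambda> (gap k l) y, y (int (gap k l) + 1), level_vertex \<Lambda> (Suc (gap k l)) y))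
      ` seq_shift k ` \<Lambda>"
    by auto
  then show ?thesis
    by (simp only: canonical_Eplus[OF assms(1)] seq_shift_image[OF assms(1)])
qed

text \<open>An edge of the canonical system is a triple of source, label and terminal, so a
  configuration consists of its vertices and its label sequence.\<close>

definition config_of ::
    "(int \<Rightarrow> int \<Rightarrow> 'a class_vertex) \<Rightarrow> (int \<Rightarrow> 'a) \<Rightarrow>
      ('a class_vertex, 'a class_vertex \<times> 'a \<times> 'a class_vertex) config" where
  "config_of V a = restrict
     (\<lambda>(k, l). (V k l, (V (k - 1) l, a k, V k l), (V k l, a l, V k (l + 1)))) Z2"

text \<open>The sequence \<open>y\<close> has the vertex of \<open>x\<close> at \<open>(k,l)\<close> and the labels of \<open>x\<close> strictly between.
  Outside this gap the letters of \<open>y\<close> may differ from the labels of \<open>x\<close>.  The configurations realized by \<open>y\<close>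
  form a basic open set, so realizing sequences play the part of approximations by points of
  \<open>\<Lambda>\<close>.\<close>

definition realizes ::
    "(int \<Rightarrow> 'a) set \<Rightarrow> int \<Rightarrow> int \<Rightarrow> (int \<Rightarrow> 'a) \<Rightarrow>
      ('a class_vertex, 'a class_vertex \<times> 'a \<times> 'a class_vertex) config \<Rightarrow> bool" where
  "realizes \<Lambda> k l y x \<longleftrightarrow> y \<in> \<Lambda> \<and> vertex_at x k l = cvertex \<Lambda> k l y \<and>
     (\<forall>i. k < i \<and> i < l \<longrightarrow> y i = labels (canonical \<Lambda>) x i)"

lemma vertex_at_config_of: "k < l \<Longrightarrow> vertex_at (config_of V a) k l = V k l"
  by (simp add: config_of_def vertex_at_def Z2_def)

lemma labels_config_of: "labels (canonical \<Lambda>) (config_of V a) = a"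
  by (rule ext) (simp add: config_of_def labels_def edge_minus_def Z2_def canonical_sel)

lemma realizesD:
  assumes "realizes \<Lambda> k l y x"
  shows "y \<in> \<Lambda>" "vertex_at x k l = cvertex \<Lambda> k l y"
    "\<And>i. k < i \<Longrightarrow> i < l \<Longrightarrow> y i = labels (canonical \<Lambda>) x i"
  using assms unfolding realizes_def by simp_all

locale canonical_system =
  fixes \<Lambda> :: "(int \<Rightarrow> 'a) set"
  assumes inv: "seq_shift 1 ` \<Lambda> = \<Lambda>"
begin

abbreviation "L \<equiv> canonical \<Lambda>"

lemma config_eq_config_of:
  assumes "x \<in> configs L"
  shows "x = config_of (vertex_at x) (labels L x)"
proof
  fix p
  show "x p = config_of (vertex_at x) (labels L x) p"
  proof (cases "p \<in> Z2")
    case True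
    then obtain k l where p: "p = (k, l)" "k < l"
      by (auto simp: Z2_def)
    have "edge_minus x k l = (vertex_at x (k - 1) l, labels L x k, vertex_at x k l)"
      "edge_plus x k l = (vertex_at x k l, labels L x l, vertex_at x k (l + 1))"
      using assms labels_eq[OF assms p(2)] p(2)
      by (auto simp: configs_def canonical_sel prod_eq_iff)
    moreover have "x p = (vertex_at x k l, edge_minus x k l, edge_plus x k l)"
      by (simp add: p vertex_at_def edge_minus_def edge_plus_def)
    ultimately show ?thesis
      using True p by (simp add: config_of_def)
  next
    case False
    have "x \<in> extensional Z2"
      using assms unfolding configs_def by blast
    then have "x p = undefined"
      using False by (rule extensional_arb)
    then show ?thesis
      using False by (simp add: config_of_def)
  qed
qed

lemma config_eqI:
  assumes "x \<in> configs L" "z \<in> configs L" "labels L x = labels L z"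
    and "\<And>k l. k < l \<Longrightarrow> vertex_at x k l = vertex_at z k l"
  shows "x = z"
proof -
  have "config_of (vertex_at x) (labels L x) = config_of (vertex_at z) (labels L z)"
    using assms(3,4) by (auto simp: config_of_def Z2_def intro!: ext)
  then show ?thesis
    using config_eq_config_of[OF assms(1)] config_eq_config_of[OF assms(2)] by (rule box_equals[OF _ sym sym])
qed

text \<open>For each position a single sequence has to witness the three vertices and the two letters
  that occur in the edges there; different positions may use different witnesses.\<close>

lemma config_of_mem:
  assumes "\<And>k l. k < l \<Longrightarrow> \<exists>y\<in>\<Lambda>. V k l = cvertex \<Lambda> k l y \<and> V (k - 1) l = cvertex \<Lambda> (k - 1) l y \<and>
    V k (l + 1) = cvertex \<Lambda> k (l + 1) y \<and> y k = a k \<and> y l = a l"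
  shows "config_of V a \<in> configs L"
proof -
  let ?x = "config_of V a"
  have at: "vertex_at ?x k l = V k l" "edge_minus ?x k l = (V (k - 1) l, a k, V k l)"
    "edge_plus ?x k l = (V k l, a l, V k (l + 1))" if "k < l" for k l
    using that by (simp_all add: config_of_def vertex_at_def edge_minus_def edge_plus_def Z2_def)
  have mem: "V k l \<in> Vert L (gap k l)" "(V (k - 1) l, a k, V k l) \<in> Eminus L (gap k l)"
    "(V k l, a l, V k (l + 1)) \<in> Eplus L (gap k l)" if kl: "k < l" for k l
  proof -
    obtain y where y: "y \<in> \<Lambda>" "V k l = cvertex \<Lambda> k l y" "V (k - 1) l = cvertex \<Lambda> (k - 1) l y"
      "V k (l + 1) = cvertex \<Lambda> k (l + 1) y" "y k = a k" "y l = a l"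
      using assms[OF kl] by blast
    show "V k l \<in> Vert L (gap k l)"
      using y(1,2) unfolding canonical_Vert_at[OF inv kl] by blast
    show "(V (k - 1) l, a k, V k l) \<in> Eminus L (gap k l)"
      unfolding canonical_Eminus_at[OF inv kl] using y by (intro bexI[of _ y]) simp_all
    show "(V k l, a l, V k (l + 1)) \<in> Eplus L (gap k l)"
      unfolding canonical_Eplus_at[OF inv kl] using y by (intro bexI[of _ y]) simp_all
  qed
  have "?x \<in> extensional Z2"
    by (simp add: config_of_def)
  moreover have "\<exists>b :: int \<Rightarrow> 'a. \<forall>k l. k < l \<longrightarrow> lab L (edge_minus ?x k l) = b k \<and> lab L (edge_plus ?x k l) = b l"
    by (intro exI[of _ a]) (simp add: at canonical_sel)
  ultimately show ?thesis
    unfolding configs_def using mem by (simp add: at canonical_sel)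
qed

lemma config_minus_step:
  assumes "x \<in> configs L" "k < l"
  shows "\<exists>y\<in>\<Lambda>. vertex_at x (k - 1) l = cvertex \<Lambda> (k - 1) l y \<and> vertex_at x k l = cvertex \<Lambda> k l y \<and>
    y k = labels L x k"
proof -
  have "edge_minus x k l \<in> Eminus L (gap k l)"
    using assms by (auto simp: configs_def)
  then obtain y where y: "y \<in> \<Lambda>" "edge_minus x k l = (cvertex \<Lambda> (k - 1) l y, y k, cvertex \<Lambda> k l y)"
    unfolding canonical_Eminus_at[OF inv assms(2)] by blast
  moreover have "src L (edge_minus x k l) = vertex_at x (k - 1) l" "trm L (edge_minus x k l) = vertex_at x k l"
    using assms by (auto simp: configs_def)
  moreover have "lab L (edge_minus x k l) = labels L x k"
    by (rule labels_eq(1)[OF assms])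
  ultimately show ?thesis
    by (intro bexI[of _ y]) (simp_all add: canonical_sel)
qed

lemma config_plus_step:
  assumes "x \<in> configs L" "k < l"
  shows "\<exists>y\<in>\<Lambda>. vertex_at x k (l + 1) = cvertex \<Lambda> k (l + 1) y \<and> vertex_at x k l = cvertex \<Lambda> k l y \<and>
    y l = labels L x l"
proof -
  have "edge_plus x k l \<in> Eplus L (gap k l)"
    using assms by (auto simp: configs_def)
  then obtain y where y: "y \<in> \<Lambda>" "edge_plus x k l = (cvertex \<Lambda> k l y, y l, cvertex \<Lambda> k (l + 1) y)"
    unfolding canonical_Eplus_at[OF inv assms(2)] by blast
  moreover have "src L (edge_plus x k l) = vertex_at x k l" "trm L (edge_plus x k l) = vertex_at x k (l + 1)"
    using assms by (auto simp: configs_def)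
  moreover have "lab L (edge_plus x k l) = labels L x l"
    by (rule labels_eq(2)[OF assms])
  ultimately show ?thesis
    by (intro bexI[of _ y]) (simp_all add: canonical_sel)
qed

lemma vertex_at_class:
  assumes "x \<in> configs L" "k < l"
  shows "\<exists>y\<in>\<Lambda>. vertex_at x k l = cvertex \<Lambda> k l y"
proof -
  obtain y where "y \<in> \<Lambda>" "vertex_at x k l = cvertex \<Lambda> k l y"
    using config_minus_step[OF assms] by (elim bexE conjE)
  then show ?thesis
    by (intro bexI[of _ y])
qed

text \<open>One step to the right or to the left removes a letter from the gap.  The edge
  used comes from some sequence, which is centrally equivalent to \<open>y\<close> and has the same letter
  at the removed position, so the new classes agree as well.\<close>

lemma vertex_at_shrink:
  assumes x: "x \<in> configs L" and kl: "k < l" and y: "y \<in> \<Lambda>" "vertex_at x k l = cvertex \<Lambda> k l y"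
    and sub: "k \<le> k'" "k' < l'" "l' \<le> l"
    and lab: "\<And>i. k < i \<Longrightarrow> i \<le> k' \<Longrightarrow> y i = labels L x i" "\<And>i. l' \<le> i \<Longrightarrow> i < l \<Longrightarrow> y i = labels L x i"
  shows "vertex_at x k' l' = cvertex \<Lambda> k' l' y"
proof -
  have left: "k' < l \<Longrightarrow> \<forall>i. k < i \<and> i \<le> k' \<longrightarrow> y i = labels L x i \<Longrightarrow>
    vertex_at x k' l = cvertex \<Lambda> k' l y"
    using sub(1)
  proof (induction k' rule: int_ge_induct)
    case base
    show ?case by (rule y(2))
  next
    case (step i)
    obtain z where z: "z \<in> \<Lambda>" "vertex_at x i l = cvertex \<Lambda> i l z"
      "vertex_at x (i + 1) l = cvertex \<Lambda> (i + 1) l z" "z (i + 1) = labels L x (i + 1)"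
      using config_minus_step[OF x step.prems(1)] by auto
    have "vertex_at x i l = cvertex \<Lambda> i l y"
      by (rule step.IH) (use step.prems in simp_all)
    then have ce: "central_eq \<Lambda> i l z y"
      using z(1,2) y(1) cvertex_eq_iff by metis
    have zy: "z j = y j" if "i < j" "j \<le> i + 1" for j
    proof -
      have "j = i + 1" using that by simp
      then show ?thesis
        using z(4) step.prems(2)[rule_format, of "i + 1"] step.hyps by simp
    qed
    have "central_eq \<Lambda> (i + 1) l z y"
      by (rule central_eq_subinterval[OF ce _ _ zy]) simp_all
    then show ?case
      using z(1,3) y(1) cvertex_eq_iff by metis
  qed
  have right: "\<forall>i. l' \<le> i \<and> i < l \<longrightarrow> y i = labels L x i \<Longrightarrow> k' < l' \<Longrightarrow>
    vertex_at x k' l' = cvertex \<Lambda> k' l' y"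
    using sub(3)
  proof (induction l' rule: int_le_induct)
    case base
    show ?case
      using left sub(2,3) lab(1) by simp
  next
    case (step i)
    have "k' < i - 1"
      using step.prems by simp
    from config_plus_step[OF x this] obtain z where z: "z \<in> \<Lambda>" "vertex_at x k' i = cvertex \<Lambda> k' i z"
      "vertex_at x k' (i - 1) = cvertex \<Lambda> k' (i - 1) z" "z (i - 1) = labels L x (i - 1)"
      by auto
    have "vertex_at x k' i = cvertex \<Lambda> k' i y"
      by (rule step.IH) (use step.prems in simp_all)
    then have ce: "central_eq \<Lambda> k' i z y"
      using z(1,2) y(1) cvertex_eq_iff by metis
    have zy: "z j = y j" if "i - 1 \<le> j" "j < i" for j
    proof -
      have "j = i - 1" using that by simp
      then show ?thesis
        using z(4) step.prems(1)[rule_format, of "i - 1"] step.hyps by simp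
    qed
    have "central_eq \<Lambda> k' (i - 1) z y"
      by (rule central_eq_subinterval[OF ce _ _ _ zy]) simp_all
    then show ?case
      using z(1,3) y(1) cvertex_eq_iff by metis
  qed
  show ?thesis
    using right lab(2) sub(2) by simp
qed

lemma realizes_mono:
  assumes "x \<in> configs L" "realizes \<Lambda> k l y x" "k \<le> k'" "k' < l'" "l' \<le> l"
  shows "realizes \<Lambda> k' l' y x"
proof -
  have "vertex_at x k' l' = cvertex \<Lambda> k' l' y"
    by (rule vertex_at_shrink[OF assms(1) _ realizesD(1,2)[OF assms(2)] assms(3-5)])
      (use realizesD(3)[OF assms(2)] assms(3-5) in auto)
  then show ?thesis
    using assms by (auto simp: realizes_def)
qed

text \<open>Induction on the length of the gap.  The edge from \<open>(k,l)\<close> to \<open>(k,l+1)\<close> comes from a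
  sequence \<open>z\<close> with the right letter at \<open>l\<close>; as \<open>z\<close> has the class of the sequence \<open>y\<close> already
  found, the letters of \<open>y\<close> may be written into the gap of \<open>z\<close>.\<close>

lemma realizes_exists:
  assumes x: "x \<in> configs L" and "k < l"
  shows "\<exists>y. realizes \<Lambda> k l y x"
  using assms(2)
proof (induction l rule: int_gr_induct)
  case base
  obtain y where "y \<in> \<Lambda>" "vertex_at x k (k + 1) = cvertex \<Lambda> k (k + 1) y"
    using vertex_at_class[OF x, of k "k + 1"] by auto
  then show ?case
    by (intro exI[of _ y]) (auto simp: realizes_def)
next
  case (step l)
  then obtain y where y: "realizes \<Lambda> k l y x"
    by blast
  obtain z where z: "z \<in> \<Lambda>" "vertex_at x k (l + 1) = cvertex \<Lambda> k (l + 1) z"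
    "vertex_at x k l = cvertex \<Lambda> k l z" "z l = labels L x l"
    using config_plus_step[OF x step.hyps] by blast
  have "central_eq \<Lambda> k l y z"
    using z(1,3) realizesD(1,2)[OF y] cvertex_eq_iff by metis
  moreover have "splice k l y y = y"
    by (auto simp: splice_def intro!: ext)
  ultimately have t: "splice k l y z \<in> \<Lambda>"
    using central_eqD[of \<Lambda> k l y z y] realizesD(1)[OF y] by simp
  moreover have "central_eq \<Lambda> k (l + 1) z (splice k l y z)"
    by (rule central_eq_outside) (auto simp: splice_def)
  then have "vertex_at x k (l + 1) = cvertex \<Lambda> k (l + 1) (splice k l y z)"
    using z(1,2) t cvertex_eq_iff by metis
  moreover have "splice k l y z i = labels L x i" if "k < i" "i < l + 1" for i
  proof (cases "i = l")
    case False
    then show ?thesis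
      using that realizesD(3)[OF y, of i] by (simp add: splice_def)
  qed (simp add: splice_def z(4))
  ultimately show ?case
    by (intro exI[of _ "splice k l y z"]) (simp add: realizes_def)
qed

end

section \<open>Windows and continuity\<close>

text \<open>Membership in a common basic open set, stated for two configurations.\<close>

definition window_eq ::
    "('v, 'e, 's) bisystem \<Rightarrow> int \<Rightarrow> int \<Rightarrow> ('v, 'e) config \<Rightarrow> ('v, 'e) config \<Rightarrow> bool" where
  "window_eq L p q x z \<longleftrightarrow> vertex_at x p q = vertex_at z p q \<and>
     (\<forall>i. p < i \<and> i < q \<longrightarrow> labels L x i = labels L z i)"

lemma labels_word_pred_words:
  assumes x: "x \<in> configs L" and "p < q"
  shows "map (labels L x) [p+1..q-1] \<in> pred_words L (gap p q) (vertex_at x p q)"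
proof -
  define es where "es = map (\<lambda>i. edge_plus x p (p + 1 + int i)) [0..<gap p q]"
  have nth: "es ! i = edge_plus x p (p + 1 + int i)" if "i < gap p q" for i
    using that by (simp add: es_def)
  have E: "edge_plus x p l \<in> Eplus L (gap p l)" "src L (edge_plus x p l) = vertex_at x p l"
    "trm L (edge_plus x p l) = vertex_at x p (l + 1)" if "p < l" for l
    using x that by (auto simp: configs_def)
  have "map (labels L x) [p+1..q-1] = map (lab L) es"
    by (rule nth_equalityI)
      (use labels_eq(2)[OF x] in \<open>auto simp: es_def gap_def\<close>)
  moreover have "length es = gap p q"
    by (simp add: es_def)
  moreover have "es ! i \<in> Eplus L i" if "i < gap p q" for i
    using E(1)[of "p + 1 + int i"] nth[OF that] by (simp add: gap_def)
  moreover have "trm L (es ! i) = src L (es ! Suc i)" if "Suc i < gap p q" for i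
  proof -
    have "p + 1 + int (Suc i) = p + 1 + int i + 1"
      by simp
    then show ?thesis
      using E(3)[of "p + 1 + int i"] E(2)[of "p + 1 + int (Suc i)"] nth[of i] nth[OF that] that by simp
  qed
  moreover have "trm L (es ! (gap p q - 1)) = vertex_at x p q" if "0 < gap p q"
  proof -
    have "es ! (gap p q - 1) = edge_plus x p (q - 1)"
      using nth[of "gap p q - 1"] that by (simp add: gap_def)
    moreover have "trm L (edge_plus x p (q - 1)) = vertex_at x p q"
      using E(3)[of "q - 1"] that by (simp add: gap_def)
    ultimately show ?thesis
      by (simp only:)
  qed
  ultimately show ?thesis
    unfolding pred_words_def by (intro CollectI exI[of _ es]) simp
qed

lemma openin_window:
  assumes x: "x \<in> configs L" and "p < q"
  shows "openin (config_top L) {z \<in> configs L. window_eq L p q x z}"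
proof -
  have "{z \<in> configs L. window_eq L p q x z} =
    cylinder L p q (map (labels L x) [p+1..q-1]) (vertex_at x p q)"
    by (auto simp: window_eq_def cylinder_def)
  moreover have "vertex_at x p q \<in> Vert L (gap p q)"
    using assms by (auto simp: configs_def)
  ultimately show ?thesis
    unfolding config_top_def using labels_word_pred_words[OF assms] assms(2)
    by (intro topology_generated_by_Basis) blast
qed

lemma continuous_map_config_topI:
  assumes f: "\<And>x. x \<in> topspace X \<Longrightarrow> f x \<in> configs L"
    and local: "\<And>x p q. x \<in> topspace X \<Longrightarrow> p < q \<Longrightarrow>
      \<exists>U. openin X U \<and> x \<in> U \<and> (\<forall>y\<in>U. window_eq L p q (f x) (f y))"
  shows "continuous_map X (config_top L) f"
proof -
  have "openin X (f -` cylinder L p q \<mu> v \<inter> topspace X)" if "p < q" for p q \<mu> v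
  proof (subst openin_subopen, intro ballI)
    fix x assume x: "x \<in> f -` cylinder L p q \<mu> v \<inter> topspace X"
    then obtain U where U: "openin X U" "x \<in> U" "\<And>y. y \<in> U \<Longrightarrow> window_eq L p q (f x) (f y)"
      using local[of x p q] \<open>p < q\<close> by blast
    have "y \<in> f -` cylinder L p q \<mu> v \<inter> topspace X" if "y \<in> U" for y
    proof -
      have y: "y \<in> topspace X"
        using U(1) that openin_subset by blast
      have "map (labels L (f y)) [p+1..q-1] = map (labels L (f x)) [p+1..q-1]"
        using U(3)[OF that] by (auto simp: window_eq_def)
      also have "\<dots> = \<mu>"
        using x by (simp add: cylinder_def)
      finally have "map (labels L (f y)) [p+1..q-1] = \<mu>" .
      moreover have "vertex_at (f y) p q = v"
        using x U(3)[OF that] by (auto simp: cylinder_def window_eq_def)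
      ultimately show ?thesis
        using y f[OF y] unfolding cylinder_def by blast
    qed
    then show "\<exists>T. openin X T \<and> x \<in> T \<and> T \<subseteq> f -` cylinder L p q \<mu> v \<inter> topspace X"
      using U(1,2) by blast
  qed
  moreover have "f ` topspace X \<subseteq> configs L"
    using f by blast
  moreover have "\<Union> {cylinder L p q \<mu> v | p q \<mu> v.
      p < q \<and> v \<in> Vert L (gap p q) \<and> \<mu> \<in> pred_words L (gap p q) v} = configs L"
    using topspace_config_top[of L] unfolding config_top_def topology_generated_by_topspace .
  ultimately show ?thesis
    unfolding config_top_def continuous_on_generated_topo_iff by auto
qed

section \<open>The shift\<close>

lemma config_shift_at:
  "vertex_at (config_shift n x) k l = vertex_at x (k + n) (l + n)"
  "edge_minus (config_shift n x) k l = edge_minus x (k + n) (l + n)"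
  "edge_plus (config_shift n x) k l = edge_plus x (k + n) (l + n)"
  by (simp_all add: config_shift_def vertex_at_def edge_minus_def edge_plus_def)

lemma labels_config_shift: "labels L (config_shift n x) i = labels L x (i + n)"
  by (simp add: labels_def config_shift_at algebra_simps)

lemma config_shift_configs:
  assumes "x \<in> configs L"
  shows "config_shift n x \<in> configs L"
proof -
  have "config_shift n x \<in> extensional Z2"
  proof -
    have "x \<in> extensional Z2"
      using assms unfolding configs_def by blast
    then show ?thesis
      by (auto simp: config_shift_def extensional_def Z2_def)
  qed
  moreover have "\<forall>k l. k < l \<longrightarrow> vertex_at x (k + n) (l + n) \<in> Vert L (gap k l) \<and>
      edge_minus x (k + n) (l + n) \<in> Eminus L (gap k l) \<and> edge_plus x (k + n) (l + n) \<in> Eplus L (gap k l) \<and>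
      src L (edge_minus x (k + n) (l + n)) = vertex_at x (k - 1 + n) (l + n) \<and>
      trm L (edge_minus x (k + n) (l + n)) = vertex_at x (k + n) (l + n) \<and>
      src L (edge_plus x (k + n) (l + n)) = vertex_at x (k + n) (l + n) \<and>
      trm L (edge_plus x (k + n) (l + n)) = vertex_at x (k + n) (l + 1 + n)"
  proof (intro allI impI)
    fix k l :: int assume "k < l"
    then have kl: "k + n < l + n"
      by simp
    have eq: "gap (k + n) (l + n) = gap k l" "k + n - 1 = k - 1 + n" "l + n + 1 = l + 1 + n"
      by (simp_all add: gap_def)
    have "\<forall>k l. k < l \<longrightarrow> vertex_at x k l \<in> Vert L (gap k l) \<and>
      edge_minus x k l \<in> Eminus L (gap k l) \<and> edge_plus x k l \<in> Eplus L (gap k l) \<and>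
      src L (edge_minus x k l) = vertex_at x (k - 1) l \<and> trm L (edge_minus x k l) = vertex_at x k l \<and>
      src L (edge_plus x k l) = vertex_at x k l \<and> trm L (edge_plus x k l) = vertex_at x k (l + 1)"
      using assms unfolding configs_def by blast
    from this[rule_format, OF kl]
    show "vertex_at x (k + n) (l + n) \<in> Vert L (gap k l) \<and>
      edge_minus x (k + n) (l + n) \<in> Eminus L (gap k l) \<and> edge_plus x (k + n) (l + n) \<in> Eplus L (gap k l) \<and>
      src L (edge_minus x (k + n) (l + n)) = vertex_at x (k - 1 + n) (l + n) \<and>
      trm L (edge_minus x (k + n) (l + n)) = vertex_at x (k + n) (l + n) \<and>
      src L (edge_plus x (k + n) (l + n)) = vertex_at x (k + n) (l + n) \<and>
      trm L (edge_plus x (k + n) (l + n)) = vertex_at x (k + n) (l + 1 + n)"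
      unfolding eq .
  qed
  moreover have "\<forall>k l. k < l \<longrightarrow> lab L (edge_minus x (k + n) (l + n)) = labels L x (k + n) \<and>
      lab L (edge_plus x (k + n) (l + n)) = labels L x (l + n)"
    using labels_eq[OF assms] by simp
  then have "\<exists>a. \<forall>k l. k < l \<longrightarrow> lab L (edge_minus x (k + n) (l + n)) = a k \<and>
      lab L (edge_plus x (k + n) (l + n)) = a l"
    by (rule exI[of _ "\<lambda>k. labels L x (k + n)"])
  ultimately show ?thesis
    unfolding configs_def mem_Collect_eq config_shift_at by (intro conjI)
qed

lemma config_shift_0: "config_shift 0 x = x"
  by (simp add: config_shift_def)

lemma continuous_map_config_shift: "continuous_map (config_top L) (config_top L) (config_shift n)"
proof (rule continuous_map_config_topI)
  show "config_shift n x \<in> configs L" if "x \<in> topspace (config_top L)" for x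
    using that config_shift_configs by (simp add: topspace_config_top)
  fix x and p q :: int assume "x \<in> topspace (config_top L)" "p < q"
  then have "openin (config_top L) {z \<in> configs L. window_eq L (p + n) (q + n) x z}"
    by (intro openin_window) (auto simp: topspace_config_top)
  moreover have "window_eq L p q (config_shift n x) (config_shift n z)"
    if "window_eq L (p + n) (q + n) x z" for z
    using that by (simp add: window_eq_def config_shift_at labels_config_shift)
  ultimately show "\<exists>U. openin (config_top L) U \<and> x \<in> U \<and>
      (\<forall>y\<in>U. window_eq L p q (config_shift n x) (config_shift n y))"
    using \<open>x \<in> topspace (config_top L)\<close>
    by (intro exI[of _ "{z \<in> configs L. window_eq L (p + n) (q + n) x z}"])
      (simp add: topspace_config_top window_eq_def)
qed

section \<open>The equivalence relation\<close>

lemma square_eq_iff: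
  "square p q x = square p q z \<longleftrightarrow> (\<forall>k l. k \<le> p \<and> q \<le> l \<longrightarrow> x (k, l) = z (k, l))"
proof
  assume eq: "square p q x = square p q z"
  show "\<forall>k l. k \<le> p \<and> q \<le> l \<longrightarrow> x (k, l) = z (k, l)"
  proof (intro allI impI)
    fix k l assume "k \<le> p \<and> q \<le> l"
    then show "x (k, l) = z (k, l)"
      using fun_cong[OF eq, of "(k, l)"] by (simp add: square_def)
  qed
qed (auto simp: square_def restrict_def intro!: ext)

lemma Rel_at_mono:
  assumes "p' \<le> p" "q \<le> q'"
  shows "Rel_at L p q \<subseteq> Rel_at L p' q'"
  using assms unfolding Rel_at_def square_eq_iff by (auto intro: order_trans)

lemma Rel_at_subset_Rel: "p < q \<Longrightarrow> Rel_at L p q \<subseteq> Rel L"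
  by (auto simp: Rel_def Z2_def)

lemma RelE:
  assumes "w \<in> Rel L"
  obtains n :: nat where "w \<in> Rel_at L (- int n) (int n + 1)"
proof -
  obtain p q where w: "w \<in> Rel_at L p q"
    using assms by (auto simp: Rel_def)
  have "- int (nat (\<bar>p\<bar> + \<bar>q\<bar>)) \<le> p" "q \<le> int (nat (\<bar>p\<bar> + \<bar>q\<bar>)) + 1"
    by auto
  then show thesis
    using w Rel_at_mono that by blast
qed

lemma Rel_at_labels:
  assumes "(x, z) \<in> Rel_at L p q"
  shows "i \<le> p \<Longrightarrow> labels L x i = labels L z i" "q \<le> i \<Longrightarrow> labels L x i = labels L z i"
proof -
  have xz: "x \<in> configs L" "z \<in> configs L" "\<And>k l. k \<le> p \<Longrightarrow> q \<le> l \<Longrightarrow> x (k, l) = z (k, l)"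
    using assms by (auto simp: Rel_at_def square_eq_iff)
  show "labels L x i = labels L z i" if "i \<le> p"
  proof -
    define l where "l = max q (i + 1)"
    have "i < l" "edge_minus x i l = edge_minus z i l"
      using xz(3)[OF that, of l] by (auto simp: l_def edge_minus_def)
    then show ?thesis
      using labels_eq(1)[OF xz(1), of i l] labels_eq(1)[OF xz(2), of i l] by simp
  qed
  show "labels L x i = labels L z i" if "q \<le> i"
  proof -
    define k where "k = min p (i - 1)"
    have "k < i" "edge_plus x k i = edge_plus z k i"
      using xz(3)[OF _ that, of k] by (auto simp: k_def edge_plus_def)
    then show ?thesis
      using labels_eq(2)[OF xz(1), of k i] labels_eq(2)[OF xz(2), of k i] by simp
  qed
qed

lemma Rel_at_vertex_at:
  "(x, z) \<in> Rel_at L p q \<Longrightarrow> k \<le> p \<Longrightarrow> q \<le> l \<Longrightarrow> vertex_at x k l = vertex_at z k l"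
  by (simp add: Rel_at_def square_eq_iff vertex_at_def)

lemma topspace_Rel_at_top: "topspace (Rel_at_top L p q) = Rel_at L p q"
  by (auto simp: Rel_at_top_def Rel_at_def topspace_config_top)

lemma topspace_Rel_top: "topspace (Rel_top L) = Rel L"
proof -
  have "openin (Rel_top L) (Rel L)"
    unfolding openin_Rel_top
  proof (intro conjI allI impI)
    fix p q :: int assume "p < q"
    then have "Rel L \<inter> Rel_at L p q = topspace (Rel_at_top L p q)"
      using Rel_at_subset_Rel[of p q L] by (auto simp: topspace_Rel_at_top)
    then show "openin (Rel_at_top L p q) (Rel L \<inter> Rel_at L p q)"
      by simp
  qed simp
  then show ?thesis
    using openin_subset openin_topspace[of "Rel_top L"] by (metis openin_Rel_top subset_antisym)
qed

text \<open>A map into the inductive limit is continuous as soon as it takes its values in one step.\<close>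

lemma continuous_map_into_Rel_top:
  assumes "p < q" and f: "continuous_map X (config_top L) f" "continuous_map X (config_top L) g"
    and mem: "\<And>x. x \<in> topspace X \<Longrightarrow> (f x, g x) \<in> Rel_at L p q"
  shows "continuous_map X (Rel_top L) (\<lambda>x. (f x, g x))"
proof -
  have c: "continuous_map X (Rel_at_top L p q) (\<lambda>x. (f x, g x))"
    unfolding Rel_at_top_def continuous_map_in_subtopology
    using f mem by (auto simp: continuous_map_pairwise o_def)
  show ?thesis
    unfolding continuous_map_def
  proof (intro conjI allI impI)
    show "(\<lambda>x. (f x, g x)) \<in> topspace X \<rightarrow> topspace (Rel_top L)"
      using mem Rel_at_subset_Rel[OF assms(1)] by (auto simp: topspace_Rel_top)
    fix U assume "openin (Rel_top L) U"
    then have "openin (Rel_at_top L p q) (U \<inter> Rel_at L p q)"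
      using assms(1) by (simp add: openin_Rel_top)
    then have "openin X {x \<in> topspace X. (f x, g x) \<in> U \<inter> Rel_at L p q}"
      by (rule openin_continuous_map_preimage[OF c])
    moreover have "{x \<in> topspace X. (f x, g x) \<in> U \<inter> Rel_at L p q} = {x \<in> topspace X. (f x, g x) \<in> U}"
      using mem by auto
    ultimately show "openin X {x \<in> topspace X. (f x, g x) \<in> U}"
      by simp
  qed
qed

text \<open>Mapping each step into some step is enough: the map is then continuous on each step.\<close>

lemma continuous_map_Rel_top:
  assumes h: "continuous_map (config_top L1) (config_top L2) h"
    and rel: "\<And>p q. p < q \<Longrightarrow> \<exists>p' q'. p' < q' \<and> (\<forall>(x, z)\<in>Rel_at L1 p q. (h x, h z) \<in> Rel_at L2 p' q')"
  shows "continuous_map (Rel_top L1) (Rel_top L2) (\<lambda>(x, z). (h x, h z))"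
  unfolding continuous_map_def
proof (intro conjI allI impI)
  show "(\<lambda>(x, z). (h x, h z)) \<in> topspace (Rel_top L1) \<rightarrow> topspace (Rel_top L2)"
  proof (clarsimp simp: topspace_Rel_top)
    fix x z assume "(x, z) \<in> Rel L1"
    then obtain p q where "p < q" "(x, z) \<in> Rel_at L1 p q"
      by (auto simp: Rel_def Z2_def)
    then show "(h x, h z) \<in> Rel L2"
      using rel[of p q] Rel_at_subset_Rel by fast
  qed
  fix U assume U: "openin (Rel_top L2) U"
  let ?V = "{w \<in> topspace (Rel_top L1). (case w of (x, z) \<Rightarrow> (h x, h z)) \<in> U}"
  show "openin (Rel_top L1) ?V"
    unfolding openin_Rel_top
  proof (intro conjI allI impI)
    show "?V \<subseteq> Rel L1"
      using topspace_Rel_top[of L1] by blast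
    fix p q :: int assume "p < q"
    then obtain p' q' where pq: "p' < q'" "\<forall>(x, z)\<in>Rel_at L1 p q. (h x, h z) \<in> Rel_at L2 p' q'"
      using rel by blast
    have "continuous_map (Rel_at_top L1 p q) (config_top L1) fst"
      "continuous_map (Rel_at_top L1 p q) (config_top L1) snd"
      unfolding Rel_at_top_def
      by (simp_all add: continuous_map_from_subtopology continuous_map_fst continuous_map_snd)
    then have "continuous_map (Rel_at_top L1 p q) (config_top L2) (\<lambda>w. h (fst w))"
      "continuous_map (Rel_at_top L1 p q) (config_top L2) (\<lambda>w. h (snd w))"
      using continuous_map_compose[OF _ h, unfolded o_def] by blast+
    then have "continuous_map (Rel_at_top L1 p q) (Rel_top L2) (\<lambda>w. (h (fst w), h (snd w)))"
      by (rule continuous_map_into_Rel_top[OF pq(1)]) (use pq(2) in \<open>auto simp: topspace_Rel_at_top\<close>)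
    from openin_continuous_map_preimage[OF this U]
    have "openin (Rel_at_top L1 p q) {w \<in> Rel_at L1 p q. (h (fst w), h (snd w)) \<in> U}"
      by (simp add: topspace_Rel_at_top)
    moreover have "{w \<in> Rel_at L1 p q. (h (fst w), h (snd w)) \<in> U} = ?V \<inter> Rel_at L1 p q"
      using Rel_at_subset_Rel[OF \<open>p < q\<close>, of L1] by (auto simp: topspace_Rel_top)
    ultimately show "openin (Rel_at_top L1 p q) (?V \<inter> Rel_at L1 p q)"
      by simp
  qed
qed

section \<open>Compactness of the configuration space\<close>

text \<open>The ambient product of finite discrete spaces.  The configurations are closed in it, and its
  topology is at least as fine on them as the one generated by the cylinders; compactness passes
  to the coarser topology.\<close>

definition config_box :: "('v, 'e, 's) bisystem \<Rightarrow> ('v, 'e) config topology" where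
  "config_box L = product_topology
     (\<lambda>i. discrete_topology (Vert L (gap (fst i) (snd i)) \<times> Eminus L (gap (fst i) (snd i)) \<times>
        Eplus L (gap (fst i) (snd i)))) Z2"

lemma openin_config_box_agree:
  assumes "finite J" "J \<subseteq> Z2" "x \<in> topspace (config_box L)"
  shows "openin (config_box L) {z \<in> topspace (config_box L). \<forall>i\<in>J. z i = x i}"
  using assms(1,2)
proof (induction J)
  case (insert i J)
  have "continuous_map (config_box L) (discrete_topology (Vert L (gap (fst i) (snd i)) \<times>
      Eminus L (gap (fst i) (snd i)) \<times> Eplus L (gap (fst i) (snd i)))) (\<lambda>z. z i)"
    unfolding config_box_def
    by (rule continuous_map_product_projection) (use insert.prems in simp)
  then have "openin (config_box L) {z \<in> topspace (config_box L). z i \<in> {x i}}"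
    by (rule openin_continuous_map_preimage)
      (use assms(3) insert.prems in \<open>auto simp: config_box_def dest: PiE_mem\<close>)
  then have "openin (config_box L) ({z \<in> topspace (config_box L). z i \<in> {x i}} \<inter>
      {z \<in> topspace (config_box L). \<forall>i\<in>J. z i = x i})"
    using insert by (intro openin_Int) simp_all
  moreover have "{z \<in> topspace (config_box L). z i \<in> {x i}} \<inter>
      {z \<in> topspace (config_box L). \<forall>i\<in>J. z i = x i} =
      {z \<in> topspace (config_box L). \<forall>i\<in>insert i J. z i = x i}"
    by auto
  ultimately show ?case
    by simp
qed simp

lemma configs_subset_config_box: "configs L \<subseteq> topspace (config_box L)"
proof
  fix x assume x: "x \<in> configs L"
  then have "x \<in> extensional Z2"
    unfolding configs_def by blast
  moreover have "x i \<in> Vert L (gap (fst i) (snd i)) \<times> Eminus L (gap (fst i) (snd i)) \<times>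
      Eplus L (gap (fst i) (snd i))" if "i \<in> Z2" for i
  proof -
    have "fst i < snd i"
      using that by (auto simp: Z2_def)
    then have "vertex_at x (fst i) (snd i) \<in> Vert L (gap (fst i) (snd i))"
      "edge_minus x (fst i) (snd i) \<in> Eminus L (gap (fst i) (snd i))"
      "edge_plus x (fst i) (snd i) \<in> Eplus L (gap (fst i) (snd i))"
      using x by (auto simp: configs_def)
    then show ?thesis
      by (simp add: vertex_at_def edge_minus_def edge_plus_def mem_Times_iff)
  qed
  ultimately show "x \<in> topspace (config_box L)"
    by (auto simp: config_box_def PiE_iff)
qed

text \<open>Each defining condition involves at most three positions, and so does the consistency of the
  labels with the label sequence.\<close>

lemma closedin_configs: "closedin (config_box L) (configs L)"
proof -
  have sep: "\<exists>J. finite J \<and> J \<subseteq> Z2 \<and> (\<forall>z\<in>configs L. \<not> (\<forall>i\<in>J. z i = x i))"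
    if x: "x \<in> topspace (config_box L)" "x \<notin> configs L" for x
  proof (rule ccontr)
    assume no: "\<not> ?thesis"
    have approx: "\<exists>z\<in>configs L. \<forall>i\<in>J. z i = x i" if "finite J" "J \<subseteq> Z2" for J
      using no that by blast
    have "x \<in> extensional Z2"
      using x(1) by (simp add: config_box_def PiE_def)
    moreover have "vertex_at x k l \<in> Vert L (gap k l) \<and> edge_minus x k l \<in> Eminus L (gap k l) \<and>
        edge_plus x k l \<in> Eplus L (gap k l) \<and>
        src L (edge_minus x k l) = vertex_at x (k - 1) l \<and> trm L (edge_minus x k l) = vertex_at x k l \<and>
        src L (edge_plus x k l) = vertex_at x k l \<and> trm L (edge_plus x k l) = vertex_at x k (l + 1)"
      if kl: "k < l" for k l
    proof -
      obtain z where z: "z \<in> configs L" "\<forall>i\<in>{(k, l), (k - 1, l), (k, l + 1)}. z i = x i"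
        using approx[of "{(k, l), (k - 1, l), (k, l + 1)}"] kl by (auto simp: Z2_def)
      have "vertex_at x k l = vertex_at z k l" "vertex_at x (k - 1) l = vertex_at z (k - 1) l"
        "vertex_at x k (l + 1) = vertex_at z k (l + 1)" "edge_minus x k l = edge_minus z k l"
        "edge_plus x k l = edge_plus z k l"
        using z(2) by (simp_all add: vertex_at_def edge_minus_def edge_plus_def)
      then show ?thesis
        using z(1) kl unfolding configs_def by simp
    qed
    moreover have "lab L (edge_minus x k l) = labels L x k \<and> lab L (edge_plus x k l) = labels L x l"
      if kl: "k < l" for k l
    proof -
      obtain z where z: "z \<in> configs L" "\<forall>i\<in>{(k, l), (k, k + 1), (l, l + 1)}. z i = x i"
        using approx[of "{(k, l), (k, k + 1), (l, l + 1)}"] kl by (auto simp: Z2_def)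
      have "edge_minus x k l = edge_minus z k l" "edge_plus x k l = edge_plus z k l"
        "labels L x k = labels L z k" "labels L x l = labels L z l"
        using z(2) by (simp_all add: labels_def edge_minus_def edge_plus_def)
      then show ?thesis
        using labels_eq[OF z(1) kl] by simp
    qed
    then have "\<exists>a. \<forall>k l. k < l \<longrightarrow> lab L (edge_minus x k l) = a k \<and> lab L (edge_plus x k l) = a l"
      by (intro exI[of _ "labels L x"]) simp
    ultimately have "x \<in> configs L"
      unfolding configs_def by simp
    then show False
      using x(2) by simp
  qed
  have "\<exists>U. openin (config_box L) U \<and> x \<in> U \<and> U \<subseteq> topspace (config_box L) - configs L"
    if x: "x \<in> topspace (config_box L) - configs L" for x
  proof -
    obtain J where J: "finite J" "J \<subseteq> Z2" "\<forall>z\<in>configs L. \<not> (\<forall>i\<in>J. z i = x i)"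
      using x sep[of x] by auto
    show ?thesis
      using openin_config_box_agree[OF J(1,2), of x L] J(3) x
      by (intro exI[of _ "{z \<in> topspace (config_box L). \<forall>i\<in>J. z i = x i}"]) auto
  qed
  then have "openin (config_box L) (topspace (config_box L) - configs L)"
    by (subst openin_subopen) blast
  then show ?thesis
    using configs_subset_config_box by (simp add: closedin_def)
qed

lemma compact_space_config_top:
  assumes "\<And>n. finite (Vert L n)" "\<And>n. finite (Eminus L n)" "\<And>n. finite (Eplus L n)"
  shows "compact_space (config_top L)"
proof -
  have "compact_space (config_box L)"
    unfolding config_box_def compact_space_product_topology
    using assms by (simp add: compact_space_discrete_topology)
  then have "compactin (config_box L) (configs L)"
    using closedin_configs closedin_compact_space by blast
  then have c: "compact_space (subtopology (config_box L) (configs L))"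
    by (simp add: compact_space_subtopology)
  have top: "topspace (subtopology (config_box L) (configs L)) = configs L"
    using configs_subset_config_box by auto
  have "continuous_map (subtopology (config_box L) (configs L)) (config_top L) id"
  proof (rule continuous_map_config_topI)
    fix x and p q :: int
    assume x: "x \<in> topspace (subtopology (config_box L) (configs L))" and pq: "p < q"
    define J where "J = insert (p, q) ((\<lambda>i. (i, i + 1)) ` {p..q})"
    have "finite J" "J \<subseteq> Z2"
      using pq by (auto simp: J_def Z2_def)
    then have op: "openin (config_box L) {z \<in> topspace (config_box L). \<forall>i\<in>J. z i = x i}"
      using x top configs_subset_config_box by (intro openin_config_box_agree) auto
    have "window_eq L p q x z" if "\<forall>i\<in>J. z i = x i" for z
      using that by (simp add: window_eq_def J_def vertex_at_def labels_def edge_minus_def)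
    then show "\<exists>U. openin (subtopology (config_box L) (configs L)) U \<and> x \<in> U \<and>
        (\<forall>y\<in>U. window_eq L p q (id x) (id y))"
      using x op by (intro exI[of _ "{z \<in> topspace (config_box L). \<forall>i\<in>J. z i = x i} \<inter> configs L"])
        (simp add: openin_subtopology_Int)
  qed (simp add: top)
  then have "compactin (config_top L) (id ` topspace (subtopology (config_box L) (configs L)))"
    using c unfolding compact_space_def by (rule image_compactin[rotated])
  then show ?thesis
    unfolding top compact_space_def topspace_config_top by simp
qed

section \<open>Vertices and tail equivalence in canonical systems\<close>

context canonical_system
begin

lemma realizes_window_eq:
  assumes "realizes \<Lambda> k l y x"
  shows "realizes \<Lambda> k l y z \<longleftrightarrow> window_eq L k l x z"
  using assms unfolding realizes_def window_eq_def by metis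

lemma vertex_at_determined:
  assumes x: "x \<in> configs L" and z: "z \<in> configs L" and eq: "vertex_at x k l = vertex_at z k l"
    and sub: "k \<le> k'" "k' < l'" "l' \<le> l"
    and lab: "\<And>i. k < i \<Longrightarrow> i \<le> k' \<Longrightarrow> labels L x i = labels L z i"
      "\<And>i. l' \<le> i \<Longrightarrow> i < l \<Longrightarrow> labels L x i = labels L z i"
  shows "vertex_at x k' l' = vertex_at z k' l'"
proof -
  have kl: "k < l"
    using sub by simp
  obtain y where y: "realizes \<Lambda> k l y x"
    using realizes_exists[OF x kl] by blast
  have "vertex_at x k' l' = cvertex \<Lambda> k' l' y"
    using realizes_mono[OF x y sub] realizesD(2) by blast
  moreover have "vertex_at z k' l' = cvertex \<Lambda> k' l' y"
    by (rule vertex_at_shrink[OF z kl realizesD(1)[OF y] _ sub])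
      (use realizesD(2,3)[OF y] eq lab sub in auto)
  ultimately show ?thesis by simp
qed

lemma Rel_atI:
  assumes x: "x \<in> configs L" and z: "z \<in> configs L"
    and lab: "\<And>i. i \<le> p \<Longrightarrow> labels L x i = labels L z i" "\<And>i. q \<le> i \<Longrightarrow> labels L x i = labels L z i"
    and vert: "\<And>k l. k \<le> p \<Longrightarrow> q \<le> l \<Longrightarrow> k < l \<Longrightarrow> vertex_at x k l = vertex_at z k l"
  shows "(x, z) \<in> Rel_at L p q"
proof -
  have "x (k, l) = z (k, l)" if kl: "k \<le> p" "q \<le> l" for k l
  proof -
    have "config_of (vertex_at x) (labels L x) (k, l) = config_of (vertex_at z) (labels L z) (k, l)"
      using lab(1)[OF kl(1)] lab(2)[OF kl(2)] vert[OF kl] vert[of "k - 1" l] vert[of k "l + 1"] kl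
      by (simp add: config_of_def Z2_def restrict_def)
    then show ?thesis
      using config_eq_config_of[OF x] config_eq_config_of[OF z] by metis
  qed
  then show ?thesis
    using x z by (simp add: Rel_at_def square_eq_iff)
qed

text \<open>Take \<open>(x, z)\<close> in the smaller relation and \<open>(a, b)\<close> in the larger one, with \<open>a\<close> and \<open>b\<close>
  close to \<open>x\<close> and \<open>z\<close> at \<open>(p',q')\<close>.  The labels of \<open>a\<close> and \<open>b\<close> between \<open>p'\<close> and \<open>q'\<close> are those of
  \<open>x\<close> and \<open>z\<close>, so they agree wherever the smaller relation demands it; the additional vertices
  follow from those already known and these labels.\<close>

lemma openin_Rel_at:
  assumes "p < q" "p' \<le> p" "q \<le> q'"
  shows "openin (Rel_at_top L p' q') (Rel_at L p q)"
proof (subst openin_subopen, intro ballI)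
  fix w assume "w \<in> Rel_at L p q"
  then obtain x z where w: "w = (x, z)" and xz: "(x, z) \<in> Rel_at L p q"
    by (cases w) auto
  have mem: "x \<in> configs L" "z \<in> configs L"
    using xz by (auto simp: Rel_at_def)
  have pq': "p' < q'"
    using assms by simp
  let ?U = "{a \<in> configs L. window_eq L p' q' x a}" and ?V = "{b \<in> configs L. window_eq L p' q' z b}"
  have "openin (prod_topology (config_top L) (config_top L)) (?U \<times> ?V)"
    using openin_window[OF mem(1) pq'] openin_window[OF mem(2) pq'] by (simp add: openin_prod_Times_iff)
  then have "openin (Rel_at_top L p' q') (?U \<times> ?V \<inter> Rel_at L p' q')"
    unfolding Rel_at_top_def by (rule openin_subtopology_Int)
  moreover have "w \<in> ?U \<times> ?V \<inter> Rel_at L p' q'"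
    using w mem xz Rel_at_mono[OF assms(2,3), of L] by (auto simp: window_eq_def)
  moreover have "?U \<times> ?V \<inter> Rel_at L p' q' \<subseteq> Rel_at L p q"
  proof
    fix c assume c: "c \<in> ?U \<times> ?V \<inter> Rel_at L p' q'"
    then obtain a b where ab: "c = (a, b)" "a \<in> configs L" "b \<in> configs L" "window_eq L p' q' x a"
      "window_eq L p' q' z b" "(a, b) \<in> Rel_at L p' q'"
      by (cases c) auto
    have lab: "labels L a i = labels L b i" if "i \<le> p \<or> q \<le> i" for i
    proof (cases "i \<le> p' \<or> q' \<le> i")
      case True
      then show ?thesis
        using Rel_at_labels[OF ab(6)] by blast
    next
      case False
      then have "labels L x i = labels L a i" "labels L z i = labels L b i"
        using ab(4,5) by (auto simp: window_eq_def)
      moreover have "labels L x i = labels L z i"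
        using Rel_at_labels[OF xz] that by blast
      ultimately show ?thesis by simp
    qed
    have "vertex_at a k l = vertex_at b k l" if "k \<le> p" "q \<le> l" "k < l" for k l
      \<comment> \<open>The larger relation covers the position moved out to \<open>(p',q')\<close>.\<close>
    proof (rule vertex_at_determined[OF ab(2,3)])
      show "vertex_at a (min k p') (max l q') = vertex_at b (min k p') (max l q')"
        by (rule Rel_at_vertex_at[OF ab(6)]) simp_all
    qed (use that lab in auto)
    then show "c \<in> Rel_at L p q"
      unfolding ab(1) by (intro Rel_atI ab lab) auto
  qed
  ultimately show "\<exists>T. openin (Rel_at_top L p' q') T \<and> w \<in> T \<and> T \<subseteq> Rel_at L p q"
    by blast
qed

lemma openin_Rel_top_Rel_at:
  assumes "p < q"
  shows "openin (Rel_top L) (Rel_at L p q)"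
  unfolding openin_Rel_top
proof (intro conjI allI impI)
  show "Rel_at L p q \<subseteq> Rel L"
    by (rule Rel_at_subset_Rel[OF assms])
  fix p' q' :: int assume "p' < q'"
  have "openin (Rel_at_top L (min p p') (max q q')) (Rel_at L p q)"
    using assms by (intro openin_Rel_at) auto
  then obtain U where U: "openin (prod_topology (config_top L) (config_top L)) U"
    "Rel_at L p q = U \<inter> Rel_at L (min p p') (max q q')"
    unfolding Rel_at_top_def openin_subtopology by blast
  have "Rel_at L p' q' \<subseteq> Rel_at L (min p p') (max q q')"
    by (rule Rel_at_mono) auto
  then have "Rel_at L p q \<inter> Rel_at L p' q' = U \<inter> Rel_at L p' q'"
    using U(2) by blast
  then show "openin (Rel_at_top L p' q') (Rel_at L p q \<inter> Rel_at L p' q')"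
    unfolding Rel_at_top_def using openin_subtopology_Int[OF U(1)] by simp
qed

text \<open>The sequence \<open>a\<close> itself witnesses every edge of the configuration of its own classes.\<close>

lemma labels_surj:
  assumes "a \<in> \<Lambda>"
  shows "\<exists>x\<in>configs L. labels L x = a"
proof (intro bexI)
  show "config_of (\<lambda>k l. cvertex \<Lambda> k l a) a \<in> configs L"
    by (rule config_of_mem) (use assms in blast)
qed (rule labels_config_of)

end

text \<open>Every finite part of the label sequence occurs in a realizing sequence, and \<open>\<Lambda>\<close> is
  closed.\<close>

lemma (in canonical_system) labels_mem:
  assumes "subshift S \<Lambda>" "x \<in> configs L"
  shows "labels L x \<in> \<Lambda>"
proof (rule shift_closedD[OF assms(1)])
  fix n :: nat
  obtain y where y: "realizes \<Lambda> (- int n - 1) (int n + 1) y x"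
    using realizes_exists[OF assms(2), of "- int n - 1" "int n + 1"] by auto
  have "y i = labels L x i" if "\<bar>i\<bar> \<le> int n" for i
    using realizesD(3)[OF y, of i] that by auto
  then show "\<exists>b\<in>\<Lambda>. \<forall>i. \<bar>i\<bar> \<le> int n \<longrightarrow> b i = labels L x i"
    using realizesD(1)[OF y] by blast
qed

section \<open>The groupoid\<close>

lemma Gpd_sel [simp]:
  "arrows (Gpd L) = Gpd_arrows L" "gsrc (Gpd L) (x, n, z) = (z, 0, z)" "grng (Gpd L) (x, n, z) = (x, 0, x)"
  "gmult (Gpd L) (x, n, z) (y, m, w) = (x, n + m, w)"
  by (simp_all add: Gpd_def)

lemma mem_Gpd_arrows:
  "(x, n, z) \<in> Gpd_arrows L \<longleftrightarrow> x \<in> configs L \<and> z \<in> configs L \<and> (config_shift n x, z) \<in> Rel L"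
  by (simp add: Gpd_arrows_def)

lemma Rel_refl: "x \<in> configs L \<Longrightarrow> (x, x) \<in> Rel L"
  using Rel_at_subset_Rel[of 0 1 L] by (auto simp: Rel_at_def)

lemma Rel_in_Gpd_eq: "Rel_in_Gpd L = {w \<in> Gpd_arrows L. gpd_degree w = 0}"
  by (auto simp: Rel_in_Gpd_def gpd_degree_def)

lemma gtop_Gpd:
  "gtop (Gpd L) = pullback_topology (Gpd_arrows L) (\<lambda>(x, n, z). ((config_shift n x, z), n))
     (prod_topology (Rel_top L) (discrete_topology UNIV))"
  by (simp add: Gpd_def)

lemma topspace_gtop_Gpd: "topspace (gtop (Gpd L)) = Gpd_arrows L"
  by (auto simp: gtop_Gpd topspace_pullback_topology topspace_Rel_top Gpd_arrows_def)

lemma continuous_map_Gpd_Rel_top: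
  "continuous_map (gtop (Gpd L)) (prod_topology (Rel_top L) (discrete_topology UNIV))
     (\<lambda>(x, n, z). ((config_shift n x, z), n))"
  unfolding gtop_Gpd
  using continuous_map_pullback[OF continuous_map_id] by simp

lemma continuous_map_into_Gpd:
  assumes "continuous_map X (prod_topology (Rel_top L) (discrete_topology UNIV))
      (\<lambda>a. ((config_shift (n a) (x a), z a), n a))"
    and "\<And>a. a \<in> topspace X \<Longrightarrow> (x a, n a, z a) \<in> Gpd_arrows L"
  shows "continuous_map X (gtop (Gpd L)) (\<lambda>a. (x a, n a, z a))"
  unfolding gtop_Gpd
proof (rule continuous_map_pullback')
  show "continuous_map X (prod_topology (Rel_top L) (discrete_topology UNIV))
      ((\<lambda>(x, n, z). ((config_shift n x, z), n)) \<circ> (\<lambda>a. (x a, n a, z a)))"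
    using assms(1) by (simp add: o_def)
qed (use assms(2) in auto)

lemma continuous_map_Gpd:
  assumes h: "continuous_map (config_top L1) (config_top L2) h"
    and shift: "\<And>n x. x \<in> configs L1 \<Longrightarrow> h (config_shift n x) = config_shift n (h x)"
    and rel: "\<And>p q. p < q \<Longrightarrow> \<exists>p' q'. p' < q' \<and> (\<forall>(x, z)\<in>Rel_at L1 p q. (h x, h z) \<in> Rel_at L2 p' q')"
  shows "continuous_map (gtop (Gpd L1)) (gtop (Gpd L2)) (\<lambda>(x, n, z). (h x, n, h z))"
proof -
  have hR: "continuous_map (Rel_top L1) (Rel_top L2) (\<lambda>(x, z). (h x, h z))"
    by (rule continuous_map_Rel_top[OF h rel])
  have "continuous_map (gtop (Gpd L1)) (Rel_top L2)
      ((\<lambda>(x, z). (h x, h z)) \<circ> (fst \<circ> (\<lambda>(x, n, z). ((config_shift n x, z), n))))"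
    by (intro continuous_map_compose[OF _ hR] continuous_map_compose[OF continuous_map_Gpd_Rel_top]
        continuous_map_fst)
  moreover have "continuous_map (gtop (Gpd L1)) (discrete_topology UNIV)
      (snd \<circ> (\<lambda>(x, n, z). ((config_shift n x, z), n)))"
    by (intro continuous_map_compose[OF continuous_map_Gpd_Rel_top] continuous_map_snd)
  ultimately have c: "continuous_map (gtop (Gpd L1)) (prod_topology (Rel_top L2) (discrete_topology UNIV))
      (\<lambda>a. ((h (config_shift (fst (snd a)) (fst a)), h (snd (snd a))), fst (snd a)))"
    unfolding continuous_map_pairwise by (simp add: o_def split_beta)
  have h_mem: "h x \<in> configs L2" if "x \<in> configs L1" for x
    using continuous_map_funspace[OF h] that by (auto simp: topspace_config_top)
  have "continuous_map (gtop (Gpd L1)) (gtop (Gpd L2)) (\<lambda>a. (h (fst a), fst (snd a), h (snd (snd a))))"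
  proof (rule continuous_map_into_Gpd)
    show "continuous_map (gtop (Gpd L1)) (prod_topology (Rel_top L2) (discrete_topology UNIV))
      (\<lambda>a. ((config_shift (fst (snd a)) (h (fst a)), h (snd (snd a))), fst (snd a)))"
      by (rule continuous_map_eq[OF c]) (auto simp: topspace_gtop_Gpd mem_Gpd_arrows shift)
    fix a assume "a \<in> topspace (gtop (Gpd L1))"
    then obtain x n z where a: "a = (x, n, z)" "x \<in> configs L1" "z \<in> configs L1" "(config_shift n x, z) \<in> Rel L1"
      by (cases a) (auto simp: topspace_gtop_Gpd mem_Gpd_arrows)
    have "(h (config_shift n x), h z) \<in> Rel L2"
      using funcset_mem[OF continuous_map_funspace[OF hR, unfolded topspace_Rel_top] a(4)] by simp
    then show "(h (fst a), fst (snd a), h (snd (snd a))) \<in> Gpd_arrows L2"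
      using a(1-3) h_mem shift by (simp add: mem_Gpd_arrows)
  qed
  then show ?thesis
    by (simp add: split_beta')
qed

lemma realizes_config_shift:
  assumes "realizes \<Lambda> (k + n) (l + n) y x" "seq_shift 1 ` \<Lambda> = \<Lambda>"
  shows "realizes \<Lambda> k l (seq_shift n y) (config_shift n x)"
  using assms(1) cvertex_shift[OF assms(2), of "k + n" n "l + n" y]
  by (simp add: realizes_def config_shift_at labels_config_shift seq_shift_mem[OF assms(2)])
    (simp add: seq_shift_def)

section \<open>Conjugacies induce isomorphisms\<close>

context block_conjugacy
begin

interpretation L1: canonical_system \<Lambda>1
  by unfold_locales (rule inv1)

interpretation L2: canonical_system \<Lambda>2
  by unfold_locales (rule inv2)

text \<open>The extension of \<open>g\<close> to configurations.  At \<open>(k,l)\<close> it takes the class of \<open>g y\<close> for any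
  \<open>y\<close> that realizes \<open>x\<close> on a gap wider by the margin; \<open>push_vertex_choice\<close> shows that the choice of
  \<open>y\<close> does not matter.\<close>

definition push ::
    "('a class_vertex, 'a class_vertex \<times> 'a \<times> 'a class_vertex) config \<Rightarrow>
      ('b class_vertex, 'b class_vertex \<times> 'b \<times> 'b class_vertex) config" where
  "push x = config_of
     (\<lambda>k l. cvertex \<Lambda>2 k l (g (SOME y. realizes \<Lambda>1 (k - margin) (l + margin) y x)))
     (g (labels (canonical \<Lambda>1) x))"

lemma g_mem: "y \<in> \<Lambda>1 \<Longrightarrow> g y \<in> \<Lambda>2"
  using g(2) by blast

lemma labels_push: "labels (canonical \<Lambda>2) (push x) = g (labels (canonical \<Lambda>1) x)"
  unfolding push_def by (rule labels_config_of)

lemma push_vertex_choice: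
  assumes "k < l" "realizes \<Lambda>1 (k - margin) (l + margin) y x"
  shows "cvertex \<Lambda>2 k l (g (SOME y. realizes \<Lambda>1 (k - margin) (l + margin) y x)) = cvertex \<Lambda>2 k l (g y)"
proof -
  define z where "z = (SOME y. realizes \<Lambda>1 (k - margin) (l + margin) y x)"
  have z: "realizes \<Lambda>1 (k - margin) (l + margin) z x"
    unfolding z_def by (rule someI[where P = "\<lambda>y. realizes \<Lambda>1 (k - margin) (l + margin) y x"]) (rule assms(2))
  have "central_eq \<Lambda>1 (k - margin) (l + margin) z y"
    using realizesD(1,2)[OF z] realizesD(1,2)[OF assms(2)] cvertex_eq_iff by metis
  moreover have "z i = y i" if "k - margin < i" "i < l + margin" for i
    using realizesD(3)[OF z that] realizesD(3)[OF assms(2) that] by simp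
  ultimately have "central_eq \<Lambda>2 k l (g z) (g y)"
    by (intro central_eq_transport realizesD(1)[OF z] realizesD(1)[OF assms(2)])
      (use assms(1) in \<open>simp_all add: margin_def\<close>)
  then show ?thesis
    unfolding z_def[symmetric] using z assms(2) g_mem by (simp add: cvertex_eq_iff realizes_def)
qed

text \<open>The property that governs everything else about \<open>push\<close>: as the configurations with
  a common realizing sequence form a basic open set, it gives continuity; as a realizing sequence
  determines the vertex, it gives the inverse of \<open>push\<close> and its equivariance.\<close>

lemma realizes_push:
  assumes x: "x \<in> configs (canonical \<Lambda>1)" and "k < l" and y: "realizes \<Lambda>1 (k - margin) (l + margin) y x"
  shows "realizes \<Lambda>2 k l (g y) (push x)"
proof -
  have "g y i = g (labels (canonical \<Lambda>1) x) i" if "k < i" "i < l" for i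
  proof (rule g_local)
    show "y j = labels (canonical \<Lambda>1) x j" if "\<bar>j - i\<bar> < margin" for j
      using realizesD(3)[OF y, of j] that \<open>k < i\<close> \<open>i < l\<close> by auto
  qed (rule realizesD(1)[OF y] L1.labels_mem[OF sub1 x])+
  moreover have "vertex_at (push x) k l = cvertex \<Lambda>2 k l (g y)"
    unfolding push_def using push_vertex_choice[OF assms(2) y] by (simp add: vertex_at_config_of[OF assms(2)])
  ultimately show ?thesis
    using g_mem realizesD(1)[OF y] by (simp add: realizes_def labels_push)
qed

lemma push_mem:
  assumes x: "x \<in> configs (canonical \<Lambda>1)"
  shows "push x \<in> configs (canonical \<Lambda>2)"
  unfolding push_def
proof (rule L2.config_of_mem)
  fix k l :: int assume kl: "k < l"
  obtain y where y: "realizes \<Lambda>1 (k - 1 - margin) (l + 1 + margin) y x"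
    using L1.realizes_exists[OF x, of "k - 1 - margin" "l + 1 + margin"] kl margin_pos by auto
  have r: "realizes \<Lambda>1 (k' - margin) (l' + margin) y x" if "k - 1 \<le> k'" "k' < l'" "l' \<le> l + 1" for k' l'
    by (rule L1.realizes_mono[OF x y]) (use that margin_pos in auto)
  have lab: "g y i = g (labels (canonical \<Lambda>1) x) i" if "k \<le> i" "i \<le> l" for i
  proof (rule g_local)
    show "y j = labels (canonical \<Lambda>1) x j" if "\<bar>j - i\<bar> < margin" for j
      using realizesD(3)[OF y, of j] that \<open>k \<le> i\<close> \<open>i \<le> l\<close> by auto
  qed (rule realizesD(1)[OF y] L1.labels_mem[OF sub1 x])+
  show "\<exists>y\<in>\<Lambda>2.
    cvertex \<Lambda>2 k l (g (SOME y. realizes \<Lambda>1 (k - margin) (l + margin) y x)) = cvertex \<Lambda>2 k l y \<and>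
    cvertex \<Lambda>2 (k - 1) l (g (SOME y. realizes \<Lambda>1 (k - 1 - margin) (l + margin) y x)) = cvertex \<Lambda>2 (k - 1) l y \<and>
    cvertex \<Lambda>2 k (l + 1) (g (SOME y. realizes \<Lambda>1 (k - margin) (l + 1 + margin) y x)) = cvertex \<Lambda>2 k (l + 1) y \<and>
    y k = g (labels (canonical \<Lambda>1) x) k \<and> y l = g (labels (canonical \<Lambda>1) x) l"
  proof (intro bexI[of _ "g y"] conjI push_vertex_choice)
    show "g y \<in> \<Lambda>2"
      using g_mem realizesD(1)[OF y] .
  qed (use kl in \<open>auto intro: r lab\<close>)
qed

lemma push_config_shift:
  assumes x: "x \<in> configs (canonical \<Lambda>1)"
  shows "push (config_shift n x) = config_shift n (push x)"
proof (rule L2.config_eqI)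
  note xs = config_shift_configs[OF x]
  show "push (config_shift n x) \<in> configs (canonical \<Lambda>2)" "config_shift n (push x) \<in> configs (canonical \<Lambda>2)"
    by (intro push_mem config_shift_configs x)+
  have "labels (canonical \<Lambda>1) (config_shift n x) = seq_shift n (labels (canonical \<Lambda>1) x)"
    by (rule ext) (simp add: labels_config_shift seq_shift_def)
  then have "labels (canonical \<Lambda>2) (push (config_shift n x)) = seq_shift n (g (labels (canonical \<Lambda>1) x))"
    using g_seq_shift[OF L1.labels_mem[OF sub1 x], of n] by (simp only: labels_push)
  then show "labels (canonical \<Lambda>2) (push (config_shift n x)) = labels (canonical \<Lambda>2) (config_shift n (push x))"
    by (simp add: fun_eq_iff labels_config_shift labels_push[of x]) (simp add: seq_shift_def)
  fix k l :: int assume kl: "k < l"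
  obtain y where y: "realizes \<Lambda>1 (k + n - margin) (l + n + margin) y x"
    using L1.realizes_exists[OF x, of "k + n - margin" "l + n + margin"] kl margin_pos by auto
  then have "realizes \<Lambda>1 (k - margin) (l + margin) (seq_shift n y) (config_shift n x)"
    by (intro realizes_config_shift inv1) (simp add: algebra_simps)
  then have "realizes \<Lambda>2 k l (g (seq_shift n y)) (push (config_shift n x))"
    by (rule realizes_push[OF xs kl])
  moreover have "realizes \<Lambda>2 k l (seq_shift n (g y)) (config_shift n (push x))"
    by (intro realizes_config_shift inv2 realizes_push x y) (use kl in simp)
  ultimately show "vertex_at (push (config_shift n x)) k l = vertex_at (config_shift n (push x)) k l"
    using g_seq_shift[OF realizesD(1)[OF y], of n] by (simp add: realizes_def)
qed

lemma continuous_map_push: "continuous_map (config_top (canonical \<Lambda>1)) (config_top (canonical \<Lambda>2)) push"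
proof (rule continuous_map_config_topI)
  fix x and p q :: int assume "x \<in> topspace (config_top (canonical \<Lambda>1))" and pq: "p < q"
  then have x: "x \<in> configs (canonical \<Lambda>1)"
    by (simp add: topspace_config_top)
  have pqm: "p - margin < q + margin"
    using pq margin_pos by simp
  have "window_eq (canonical \<Lambda>2) p q (push x) (push z)"
    if z: "z \<in> configs (canonical \<Lambda>1)" "window_eq (canonical \<Lambda>1) (p - margin) (q + margin) x z" for z
  proof -
    obtain y where y: "realizes \<Lambda>1 (p - margin) (q + margin) y x"
      using L1.realizes_exists[OF x pqm] by blast
    then have "realizes \<Lambda>1 (p - margin) (q + margin) y z"
      using L1.realizes_window_eq z(2) by blast
    then show ?thesis
      using realizes_push[OF x pq y] realizes_push[OF z(1) pq] L2.realizes_window_eq by blast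
  qed
  moreover have "x \<in> {z \<in> configs (canonical \<Lambda>1). window_eq (canonical \<Lambda>1) (p - margin) (q + margin) x z}"
    using x by (simp add: window_eq_def)
  ultimately show "\<exists>U. openin (config_top (canonical \<Lambda>1)) U \<and> x \<in> U \<and>
      (\<forall>z\<in>U. window_eq (canonical \<Lambda>2) p q (push x) (push z))"
    using openin_window[OF x pqm] by blast
qed (simp add: push_mem topspace_config_top)

text \<open>Tail equivalent configurations differ in labels inside the gap, so realizing sequences of
  both agree only on collars around the ends of the gap.  This is what
  \<open>central_eq_transport\<close> asks for.\<close>

lemma push_Rel_at:
  assumes xz: "(x, z) \<in> Rel_at (canonical \<Lambda>1) p q" and "p < q"
  shows "(push x, push z) \<in> Rel_at (canonical \<Lambda>2) (p - margin) (q + margin)"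
proof (rule L2.Rel_atI)
  have x: "x \<in> configs (canonical \<Lambda>1)" and z: "z \<in> configs (canonical \<Lambda>1)"
    using xz by (auto simp: Rel_at_def)
  show "push x \<in> configs (canonical \<Lambda>2)" "push z \<in> configs (canonical \<Lambda>2)"
    using x z by (auto intro: push_mem)
  note lab = Rel_at_labels[OF xz]
  have mem: "labels (canonical \<Lambda>1) x \<in> \<Lambda>1" "labels (canonical \<Lambda>1) z \<in> \<Lambda>1"
    using L1.labels_mem[OF sub1] x z by blast+
  show "labels (canonical \<Lambda>2) (push x) i = labels (canonical \<Lambda>2) (push z) i" if "i \<le> p - margin" for i
    unfolding labels_push by (rule g_local[OF mem]) (use lab(1) that in auto)
  show "labels (canonical \<Lambda>2) (push x) i = labels (canonical \<Lambda>2) (push z) i" if "q + margin \<le> i" for i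
    unfolding labels_push by (rule g_local[OF mem]) (use lab(2) that in auto)
  fix k l :: int assume k: "k \<le> p - margin" and l: "q + margin \<le> l" and kl: "k < l"
  have klm: "k - margin < l + margin"
    using kl margin_pos by simp
  obtain y where y: "realizes \<Lambda>1 (k - margin) (l + margin) y x"
    using L1.realizes_exists[OF x klm] by blast
  obtain y' where y': "realizes \<Lambda>1 (k - margin) (l + margin) y' z"
    using L1.realizes_exists[OF z klm] by blast
  have "vertex_at x (k - margin) (l + margin) = vertex_at z (k - margin) (l + margin)"
    by (rule Rel_at_vertex_at[OF xz]) (use k l margin_pos in auto)
  then have "central_eq \<Lambda>1 (k - margin) (l + margin) y y'"
    using realizesD(1,2)[OF y] realizesD(1,2)[OF y'] cvertex_eq_iff by metis
  moreover have "y i = y' i" if "k - margin < i" "i \<le> k + int m" for i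
    using realizesD(3)[OF y, of i] realizesD(3)[OF y', of i] lab(1)[of i] that k kl
    by (simp add: margin_def)
  moreover have "y i = y' i" if "l - int m \<le> i" "i < l + margin" for i
    using realizesD(3)[OF y, of i] realizesD(3)[OF y', of i] lab(2)[of i] that l kl
    by (simp add: margin_def)
  ultimately have "central_eq \<Lambda>2 k l (g y) (g y')"
    by (intro central_eq_transport realizesD(1)[OF y] realizesD(1)[OF y'])
  then have "cvertex \<Lambda>2 k l (g y) = cvertex \<Lambda>2 k l (g y')"
    using g_mem realizesD(1)[OF y] realizesD(1)[OF y'] by (simp add: cvertex_eq_iff)
  then show "vertex_at (push x) k l = vertex_at (push z) k l"
    using realizesD(2)[OF realizes_push[OF x kl y]] realizesD(2)[OF realizes_push[OF z kl y']] by simp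
qed

definition push_arrow where "push_arrow = (\<lambda>(x, n :: int, z). (push x, n, push z))"

lemma gpd_degree_push_arrow: "gpd_degree (push_arrow w) = gpd_degree w"
  by (simp add: push_arrow_def gpd_degree_def split_beta)

lemma continuous_map_push_arrow:
  "continuous_map (gtop (Gpd (canonical \<Lambda>1))) (gtop (Gpd (canonical \<Lambda>2))) push_arrow"
  unfolding push_arrow_def
proof (rule continuous_map_Gpd[OF continuous_map_push push_config_shift])
  fix p q :: int assume "p < q"
  then show "\<exists>p' q'. p' < q' \<and>
      (\<forall>(x, z)\<in>Rel_at (canonical \<Lambda>1) p q. (push x, push z) \<in> Rel_at (canonical \<Lambda>2) p' q')"
    using push_Rel_at[of _ _ p q] margin_pos
    by (intro exI[of _ "p - margin"] exI[of _ "q + margin"]) auto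
qed

end

context block_conjugacy
begin

interpretation L1: canonical_system \<Lambda>1
  by unfold_locales (rule inv1)

interpretation inv: block_conjugacy S2 \<Lambda>2 S1 \<Lambda>1 g' g m
  by (rule inverse)

lemma push_inverse:
  assumes x: "x \<in> configs (canonical \<Lambda>1)"
  shows "inv.push (push x) = x"
proof (rule L1.config_eqI)
  show "inv.push (push x) \<in> configs (canonical \<Lambda>1)"
    by (intro inv.push_mem push_mem x)
  show "labels (canonical \<Lambda>1) (inv.push (push x)) = labels (canonical \<Lambda>1) x"
    using g'g[OF L1.labels_mem[OF sub1 x]] by (simp add: inv.labels_push labels_push)
  fix k l :: int assume kl: "k < l"
  obtain y where y: "realizes \<Lambda>1 (k - margin - margin) (l + margin + margin) y x"
    using L1.realizes_exists[OF x, of "k - margin - margin" "l + margin + margin"] kl margin_pos by auto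
  have "realizes \<Lambda>2 (k - margin) (l + margin) (g y) (push x)"
    by (rule realizes_push[OF x _ y]) (use kl margin_pos in simp)
  then have "realizes \<Lambda>1 k l (g' (g y)) (inv.push (push x))"
    by (rule inv.realizes_push[OF push_mem[OF x] kl])
  moreover have "realizes \<Lambda>1 k l y x"
    by (rule L1.realizes_mono[OF x y]) (use kl margin_pos in auto)
  ultimately show "vertex_at (inv.push (push x)) k l = vertex_at x k l"
    using g'g by (simp add: realizes_def)
qed (rule x)

end

context block_conjugacy
begin

interpretation inv: block_conjugacy S2 \<Lambda>2 S1 \<Lambda>1 g' g m
  by (rule inverse)

lemma groupoid_iso_push_arrow:
  "groupoid_iso (Gpd (canonical \<Lambda>1)) (Gpd (canonical \<Lambda>2)) push_arrow"
  "push_arrow ` Rel_in_Gpd (canonical \<Lambda>1) = Rel_in_Gpd (canonical \<Lambda>2)"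
proof -
  have left_inv: "inv.push_arrow (push_arrow w) = w" if "w \<in> Gpd_arrows (canonical \<Lambda>1)" for w
    using that push_inverse by (cases w) (auto simp: push_arrow_def inv.push_arrow_def mem_Gpd_arrows)
  have right_inv: "push_arrow (inv.push_arrow w) = w" if "w \<in> Gpd_arrows (canonical \<Lambda>2)" for w
    using that inv.push_inverse by (cases w) (auto simp: push_arrow_def inv.push_arrow_def mem_Gpd_arrows)
  have "homeomorphic_maps (gtop (Gpd (canonical \<Lambda>1))) (gtop (Gpd (canonical \<Lambda>2))) push_arrow inv.push_arrow"
    unfolding homeomorphic_maps_def topspace_gtop_Gpd
    using continuous_map_push_arrow inv.continuous_map_push_arrow left_inv right_inv by blast
  then have homeo: "homeomorphic_map (gtop (Gpd (canonical \<Lambda>1))) (gtop (Gpd (canonical \<Lambda>2))) push_arrow"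
    using homeomorphic_map_maps by blast
  then have bij: "bij_betw push_arrow (Gpd_arrows (canonical \<Lambda>1)) (Gpd_arrows (canonical \<Lambda>2))"
    using homeomorphic_imp_injective_map[OF homeo] homeomorphic_imp_surjective_map[OF homeo]
    by (simp add: bij_betw_def topspace_gtop_Gpd)
  show "groupoid_iso (Gpd (canonical \<Lambda>1)) (Gpd (canonical \<Lambda>2)) push_arrow"
    unfolding groupoid_iso_def Gpd_sel using homeo bij by (auto simp: push_arrow_def)
  have "Gpd_arrows (canonical \<Lambda>2) = push_arrow ` Gpd_arrows (canonical \<Lambda>1)"
    using bij by (simp add: bij_betw_def)
  then show "push_arrow ` Rel_in_Gpd (canonical \<Lambda>1) = Rel_in_Gpd (canonical \<Lambda>2)"
    unfolding Rel_in_Gpd_eq using gpd_degree_push_arrow by auto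
qed

end

lemma block_conjugacy_exists:
  assumes "subshift S1 \<Lambda>1" "subshift S2 \<Lambda>2"
    and g: "homeomorphic_map (shift_top S1 \<Lambda>1) (shift_top S2 \<Lambda>2) g"
    and shift: "\<And>a. a \<in> \<Lambda>1 \<Longrightarrow> g (seq_shift 1 a) = seq_shift 1 (g a)"
  shows "\<exists>g' m. block_conjugacy S1 \<Lambda>1 S2 \<Lambda>2 g g' m"
proof -
  note top = topspace_shift_top[OF assms(1)] topspace_shift_top[OF assms(2)]
  obtain g' where "homeomorphic_maps (shift_top S1 \<Lambda>1) (shift_top S2 \<Lambda>2) g g'"
    using g homeomorphic_map_maps by blast
  then have c: "continuous_map (shift_top S1 \<Lambda>1) (shift_top S2 \<Lambda>2) g"
    "continuous_map (shift_top S2 \<Lambda>2) (shift_top S1 \<Lambda>1) g'"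
    and g'g: "\<And>a. a \<in> \<Lambda>1 \<Longrightarrow> g' (g a) = a" and gg': "\<And>b. b \<in> \<Lambda>2 \<Longrightarrow> g (g' b) = b"
    unfolding homeomorphic_maps_def top by blast+
  have im: "g ` \<Lambda>1 \<subseteq> \<Lambda>2" "g' ` \<Lambda>2 \<subseteq> \<Lambda>1"
    using continuous_map_image_subset_topspace[OF c(1)] continuous_map_image_subset_topspace[OF c(2)]
    unfolding top by simp_all
  have shift': "g' (seq_shift 1 b) = seq_shift 1 (g' b)" if b: "b \<in> \<Lambda>2" for b
  proof -
    have "g' b \<in> \<Lambda>1"
      using b im(2) by blast
    from equivariant_inverse[OF subshift_invariant[OF assms(1)] shift g'g this gg'[OF b]]
    show ?thesis
      by simp
  qed
  obtain m1 where m1: "block_code \<Lambda>1 m1 g"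
    using Curtis_Hedlund_Lyndon[OF assms(1) c(1) shift] by blast
  obtain m2 where m2: "block_code \<Lambda>2 m2 g'"
    using Curtis_Hedlund_Lyndon[OF assms(2) c(2) shift'] by blast
  have codes: "block_code \<Lambda>1 (max m1 m2) g" "block_code \<Lambda>2 (max m1 m2) g'"
    by (rule block_code_mono[OF m1] block_code_mono[OF m2]; simp)+
  have "block_conjugacy S1 \<Lambda>1 S2 \<Lambda>2 g g' (max m1 m2)"
    by unfold_locales (fact assms codes im g'g gg' shift)+
  then show ?thesis
    by blast
qed

section \<open>Maps that commute with the shift on right tails\<close>

text \<open>A homeomorphism that comes from a groupoid isomorphism commutes with the shift only up to
  finitely many coordinates, in a range common to all sequences.  The right half of this
  condition says that \<open>h\<close> obeys one local rule far to the right.\<close>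

definition tail_equivariant :: "(int \<Rightarrow> 'a) set \<Rightarrow> int \<Rightarrow> ((int \<Rightarrow> 'a) \<Rightarrow> int \<Rightarrow> 'b) \<Rightarrow> bool" where
  "tail_equivariant \<Lambda> M h \<longleftrightarrow> (\<forall>a\<in>\<Lambda>. \<forall>i\<ge>M. h (seq_shift 1 a) i = h a (i + 1))"

text \<open>The block code that \<open>h\<close> obeys far to the right, applied at every position.  The local rule is
  the letter of \<open>h\<close> at \<open>M\<close>.\<close>

definition tail_code :: "int \<Rightarrow> ((int \<Rightarrow> 'a) \<Rightarrow> int \<Rightarrow> 'b) \<Rightarrow> (int \<Rightarrow> 'a) \<Rightarrow> int \<Rightarrow> 'b" where
  "tail_code M h a = (\<lambda>j. h (seq_shift (j - M) a) M)"

lemma tail_equivariant_mono: "tail_equivariant \<Lambda> M h \<Longrightarrow> M \<le> N \<Longrightarrow> tail_equivariant \<Lambda> N h"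
  by (simp add: tail_equivariant_def)

lemma tail_code_seq_shift: "tail_code M h (seq_shift n a) = seq_shift n (tail_code M h a)"
  by (simp add: tail_code_def seq_shift_add) (simp add: seq_shift_def algebra_simps)

lemma tail_code_eq:
  assumes inv: "seq_shift 1 ` \<Lambda> = \<Lambda>" and h: "tail_equivariant \<Lambda> M h" and "a \<in> \<Lambda>" "M \<le> j"
  shows "tail_code M h a j = h a j"
proof -
  have "h (seq_shift (int n) a) M = h a (M + int n)" if "a \<in> \<Lambda>" for n a
    using that
  proof (induction n arbitrary: a)
    case (Suc n)
    have "seq_shift 1 a \<in> \<Lambda>"
      using Suc.prems seq_shift_mem[OF inv] by blast
    then have "h (seq_shift (int n) (seq_shift 1 a)) M = h (seq_shift 1 a) (M + int n)"
      by (rule Suc.IH)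
    also have "\<dots> = h a (M + int n + 1)"
      using h Suc.prems by (simp add: tail_equivariant_def)
    finally show ?case
      by (simp add: seq_shift_add add_ac)
  qed (simp add: seq_shift_0)
  from this[OF assms(3), of "nat (j - M)"] assms(4) show ?thesis
    by (simp add: tail_code_def)
qed

text \<open>Shifting \<open>a\<close> far to the right, applying \<open>h\<close> and shifting back gives points of \<open>\<Lambda>2\<close> that agree
  with \<open>tail_code M h a\<close> on longer and longer windows.\<close>

lemma tail_code_mem:
  assumes inv: "seq_shift 1 ` \<Lambda>1 = \<Lambda>1" and sub: "subshift S2 \<Lambda>2" and "h ` \<Lambda>1 \<subseteq> \<Lambda>2"
    and h: "tail_equivariant \<Lambda>1 M h" and a: "a \<in> \<Lambda>1"
  shows "tail_code M h a \<in> \<Lambda>2"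
proof (rule shift_closedD[OF sub])
  fix n :: nat
  define N where "N = \<bar>M\<bar> + int n"
  have c: "seq_shift (- N) a \<in> \<Lambda>1"
    using a seq_shift_mem[OF inv] by blast
  have "seq_shift N (h (seq_shift (- N) a)) i = tail_code M h a i" if "\<bar>i\<bar> \<le> int n" for i
  proof -
    have "seq_shift N (h (seq_shift (- N) a)) i = tail_code M h (seq_shift (- N) a) (i + N)"
      using tail_code_eq[OF inv h c, of "i + N"] that by (simp add: seq_shift_def N_def)
    also have "\<dots> = tail_code M h a i"
      by (simp add: tail_code_seq_shift) (simp add: seq_shift_def)
    finally show ?thesis .
  qed
  moreover have "seq_shift N (h (seq_shift (- N) a)) \<in> \<Lambda>2"
    using c assms(3) seq_shift_mem[OF subshift_invariant[OF sub]] by blast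
  ultimately show "\<exists>b\<in>\<Lambda>2. \<forall>i. \<bar>i\<bar> \<le> int n \<longrightarrow> b i = tail_code M h a i"
    by blast
qed

lemma continuous_map_tail_code:
  assumes sub: "subshift S1 \<Lambda>1" "subshift S2 \<Lambda>2"
    and c: "continuous_map (shift_top S1 \<Lambda>1) (shift_top S2 \<Lambda>2) h" and h: "tail_equivariant \<Lambda>1 M h"
  shows "continuous_map (shift_top S1 \<Lambda>1) (shift_top S2 \<Lambda>2) (tail_code M h)"
proof -
  have im: "h ` \<Lambda>1 \<subseteq> \<Lambda>2"
    using continuous_map_image_subset_topspace[OF c] by (simp add: topspace_shift_top sub)
  have "continuous_map (shift_top S1 \<Lambda>1) (discrete_topology S2) (\<lambda>a. tail_code M h a j)" for j
    using continuous_map_shift_component[OF continuous_map_compose[OF continuous_map_seq_shift[OF sub(1)] c]]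
    by (simp add: tail_code_def o_def)
  then have "continuous_map (shift_top S1 \<Lambda>1) (full_shift_top S2) (tail_code M h)"
    unfolding full_shift_top_def continuous_map_componentwise_UNIV by blast
  moreover have "tail_code M h \<in> topspace (shift_top S1 \<Lambda>1) \<rightarrow> \<Lambda>2"
    using tail_code_mem[OF subshift_invariant[OF sub(1)] sub(2) im h] by (auto simp: topspace_shift_top sub)
  ultimately show ?thesis
    by (auto simp: shift_top_def[of S2] continuous_map_in_subtopology)
qed

text \<open>Far to the right \<open>tail_code M h\<close> is \<open>h\<close>, and \<open>tail_code M k\<close>, being a block code, computes its
  letters from there; so the composition is \<open>k \<circ> h\<close> far to the right.  Equivariance carries the
  identity to every position.\<close>

lemma tail_code_inverse:
  assumes sub: "subshift S1 \<Lambda>1" "subshift S2 \<Lambda>2"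
    and h: "continuous_map (shift_top S1 \<Lambda>1) (shift_top S2 \<Lambda>2) h" "tail_equivariant \<Lambda>1 M h"
    and k: "continuous_map (shift_top S2 \<Lambda>2) (shift_top S1 \<Lambda>1) k" "tail_equivariant \<Lambda>2 M k"
    and kh: "\<And>a. a \<in> \<Lambda>1 \<Longrightarrow> k (h a) = a" and a: "a \<in> \<Lambda>1"
  shows "tail_code M k (tail_code M h a) = a"
proof -
  have inv: "seq_shift 1 ` \<Lambda>1 = \<Lambda>1" "seq_shift 1 ` \<Lambda>2 = \<Lambda>2"
    using sub subshift_invariant by blast+
  have im: "h ` \<Lambda>1 \<subseteq> \<Lambda>2"
    using continuous_map_image_subset_topspace[OF h(1)] by (simp add: topspace_shift_top sub)
  obtain m where m: "block_code \<Lambda>2 m (tail_code M k)"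
    using Curtis_Hedlund_Lyndon[OF sub(2) continuous_map_tail_code[OF sub(2,1) k] tail_code_seq_shift]
    by blast
  define n where "n = \<bar>M\<bar> + int m"
  have "tail_code M k (tail_code M h a) j = a j" for j
  proof -
    define c where "c = seq_shift (j - n) a"
    have c: "c \<in> \<Lambda>1"
      using a seq_shift_mem[OF inv(1)] by (simp add: c_def)
    have hc: "h c \<in> \<Lambda>2"
      using c im by blast
    have "tail_code M k (tail_code M h c) n = tail_code M k (h c) n"
    proof (rule block_codeD[OF m])
      show "tail_code M h c \<in> \<Lambda>2"
        by (rule tail_code_mem[OF inv(1) sub(2) im h(2) c])
      show "tail_code M h c i = h c i" if "n - int m \<le> i" for i
        by (rule tail_code_eq[OF inv(1) h(2) c]) (use that in \<open>simp add: n_def\<close>)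
    qed (rule hc)
    also have "\<dots> = c n"
      using tail_code_eq[OF inv(2) k(2) hc, of n] kh[OF c] by (simp add: n_def)
    finally show ?thesis
      by (simp add: c_def tail_code_seq_shift) (simp add: seq_shift_def)
  qed
  then show ?thesis
    by blast
qed

lemma topologically_conjugate_if_tail_equivariant:
  assumes sub: "subshift S1 \<Lambda>1" "subshift S2 \<Lambda>2"
    and hk: "homeomorphic_maps (shift_top S1 \<Lambda>1) (shift_top S2 \<Lambda>2) h k"
    and "tail_equivariant \<Lambda>1 M h" "tail_equivariant \<Lambda>2 N k"
  shows "topologically_conjugate S1 \<Lambda>1 S2 \<Lambda>2"
proof -
  define K where "K = max M N"
  have h: "continuous_map (shift_top S1 \<Lambda>1) (shift_top S2 \<Lambda>2) h" "tail_equivariant \<Lambda>1 K h"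
    and k: "continuous_map (shift_top S2 \<Lambda>2) (shift_top S1 \<Lambda>1) k" "tail_equivariant \<Lambda>2 K k"
    using hk assms(4,5) by (auto simp: homeomorphic_maps_def K_def intro: tail_equivariant_mono)
  have inverse: "\<And>a. a \<in> \<Lambda>1 \<Longrightarrow> k (h a) = a" "\<And>b. b \<in> \<Lambda>2 \<Longrightarrow> h (k b) = b"
    using hk by (auto simp: homeomorphic_maps_def topspace_shift_top sub)
  have "homeomorphic_maps (shift_top S1 \<Lambda>1) (shift_top S2 \<Lambda>2) (tail_code K h) (tail_code K k)"
    unfolding homeomorphic_maps_def topspace_shift_top[OF sub(1)] topspace_shift_top[OF sub(2)]
    using continuous_map_tail_code[OF sub h] continuous_map_tail_code[OF sub(2,1) k]
      tail_code_inverse[OF sub h k inverse(1)] tail_code_inverse[OF sub(2,1) k h inverse(2)]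
    by blast
  then have "homeomorphic_map (shift_top S1 \<Lambda>1) (shift_top S2 \<Lambda>2) (tail_code K h)"
    using homeomorphic_map_maps by blast
  then show ?thesis
    unfolding topologically_conjugate_def using tail_code_seq_shift[of K h 1] by blast
qed

section \<open>Isomorphisms induce conjugacies\<close>

lemma unit_of_mem_Gpd: "x \<in> configs L \<Longrightarrow> unit_of x \<in> Gpd_arrows L"
  by (simp add: unit_of_def mem_Gpd_arrows config_shift_0 Rel_refl)

lemma shift_arrow_mem_Gpd: "x \<in> configs L \<Longrightarrow> (x, n, config_shift n x) \<in> Gpd_arrows L"
  by (simp add: mem_Gpd_arrows config_shift_configs Rel_refl)

text \<open>An arrow is composable with the units at its two ends, and this fixes the ends of its
  image; the degree fixes the integer.\<close>

lemma groupoid_iso_arrow: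
  assumes iso: "groupoid_iso (Gpd L1) (Gpd L2) \<phi>"
    and unit: "\<And>x. x \<in> configs L1 \<Longrightarrow> \<phi> (unit_of x) = unit_of (h x)"
    and deg: "\<And>w. w \<in> Gpd_arrows L1 \<Longrightarrow> gpd_degree (\<phi> w) = gpd_degree w"
    and w: "(x, n, z) \<in> Gpd_arrows L1"
  shows "\<phi> (x, n, z) = (h x, n, h z)"
proof -
  have x: "x \<in> configs L1" and z: "z \<in> configs L1"
    using w by (simp_all add: mem_Gpd_arrows)
  have comp: "gsrc (Gpd L2) (\<phi> a) = grng (Gpd L2) (\<phi> b)"
    if "a \<in> Gpd_arrows L1" "b \<in> Gpd_arrows L1" "gsrc (Gpd L1) a = grng (Gpd L1) b" for a b
    using iso that by (simp add: groupoid_iso_def)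
  obtain p m q where \<phi>: "\<phi> (x, n, z) = (p, m, q)"
    using prod_cases3 by blast
  have "p = h x"
    using comp[OF unit_of_mem_Gpd[OF x] w] by (simp add: unit[OF x] \<phi>) (simp add: unit_of_def)
  moreover have "q = h z"
    using comp[OF w unit_of_mem_Gpd[OF z]] by (simp add: unit[OF z] \<phi>) (simp add: unit_of_def)
  moreover have "m = n"
    using deg[OF w] by (simp add: \<phi> gpd_degree_def)
  ultimately show ?thesis
    using \<phi> by simp
qed

lemma continuous_map_shift_arrow:
  "continuous_map (config_top L) (gtop (Gpd L)) (\<lambda>x. (x, 1, config_shift 1 x))"
proof (rule continuous_map_into_Gpd)
  have "continuous_map (config_top L) (Rel_top L) (\<lambda>x. (config_shift 1 x, config_shift 1 x))"
    by (rule continuous_map_into_Rel_top[of 0 1])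
      (simp_all add: continuous_map_config_shift Rel_at_def topspace_config_top config_shift_configs)
  then show "continuous_map (config_top L) (prod_topology (Rel_top L) (discrete_topology UNIV))
      (\<lambda>x. ((config_shift 1 x, config_shift 1 x), 1))"
    by (simp add: continuous_map_pairwise o_def)
qed (simp add: shift_arrow_mem_Gpd topspace_config_top)

text \<open>The image of the arrow \<open>(x, 1, \<sigma> x)\<close> says that \<open>(\<sigma> (h x), h (\<sigma> x))\<close> lies in the relation
  \<open>R\<close>.  Its dependence on \<open>x\<close> is continuous, \<open>R\<close> is an increasing union of open steps, and the
  configuration space is compact; so one step contains all these pairs.  Membership in a step
  makes the labels agree from a fixed position on.\<close>

lemma tail_equivariant_if_arrow_map:
  assumes sub1: "subshift S1 \<Lambda>1" and sub2: "subshift S2 \<Lambda>2"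
    and c: "continuous_map (gtop (Gpd (canonical \<Lambda>1))) (gtop (Gpd (canonical \<Lambda>2))) \<phi>"
    and \<phi>: "\<And>x n z. (x, n, z) \<in> Gpd_arrows (canonical \<Lambda>1) \<Longrightarrow> \<phi> (x, n, z) = (h x, n, h z)"
    and lab: "\<And>x. x \<in> configs (canonical \<Lambda>1) \<Longrightarrow> k (labels (canonical \<Lambda>1) x) = labels (canonical \<Lambda>2) (h x)"
  shows "\<exists>M. tail_equivariant \<Lambda>1 M k"
  \<comment> \<open>Compactness rests on the finiteness of the vertex and edge sets, proved for nonempty \<open>\<Lambda>1\<close>.\<close>
proof (cases "\<Lambda>1 = {}")
  case False
  interpret L1: canonical_system \<Lambda>1
    by unfold_locales (rule subshift_invariant[OF sub1])
  interpret L2: canonical_system \<Lambda>2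
    by unfold_locales (rule subshift_invariant[OF sub2])
  let ?L1 = "canonical \<Lambda>1" and ?L2 = "canonical \<Lambda>2"
  define \<psi> where "\<psi> = (\<lambda>x. (config_shift 1 (h x), h (config_shift 1 x)))"
  have "continuous_map (config_top ?L1) (Rel_top ?L2)
      (fst \<circ> ((\<lambda>(x, n, z). ((config_shift n x, z), n)) \<circ> (\<phi> \<circ> (\<lambda>x. (x, 1, config_shift 1 x)))))"
    by (rule continuous_map_compose[OF continuous_map_compose[OF continuous_map_compose
            [OF continuous_map_shift_arrow c] continuous_map_Gpd_Rel_top] continuous_map_fst])
  then have \<psi>: "continuous_map (config_top ?L1) (Rel_top ?L2) \<psi>"
    by (rule continuous_map_eq)
      (simp add: \<psi>_def \<phi> shift_arrow_mem_Gpd topspace_config_top)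
  have "lambda_graph_bisystem S1 ?L1"
    by (rule lambda_graph_bisystem_canonical[OF sub1 False])
  then have compact: "compact_space (config_top ?L1)"
    by (intro compact_space_config_top) (simp_all add: lambda_graph_bisystem_def)
  have "\<exists>n. \<forall>x\<in>topspace (config_top ?L1). \<psi> x \<in> Rel_at ?L2 (- int n) (int n + 1)"
  proof (rule compact_space_uniform_bound[OF compact])
    show "\<psi> x \<in> Rel_at ?L2 (- int k) (int k + 1)" if "\<psi> x \<in> Rel_at ?L2 (- int n) (int n + 1)" "n \<le> k" for x n k
      using that(1) Rel_at_mono[of "- int k" "- int n" "int n + 1" "int k + 1" ?L2] that(2) by auto
    fix x assume x: "x \<in> topspace (config_top ?L1)"
    have "\<psi> x \<in> Rel ?L2"
      using funcset_mem[OF continuous_map_funspace[OF \<psi>] x] by (simp add: topspace_Rel_top)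
    then obtain n where n: "\<psi> x \<in> Rel_at ?L2 (- int n) (int n + 1)"
      by (rule RelE)
    have "openin (Rel_top ?L2) (Rel_at ?L2 (- int n) (int n + 1))"
      by (rule L2.openin_Rel_top_Rel_at) simp
    from openin_continuous_map_preimage[OF \<psi> this]
    show "\<exists>U n. openin (config_top ?L1) U \<and> x \<in> U \<and> (\<forall>y\<in>U. \<psi> y \<in> Rel_at ?L2 (- int n) (int n + 1))"
      using x n by blast
  qed
  then obtain n where n: "\<And>x. x \<in> configs ?L1 \<Longrightarrow> \<psi> x \<in> Rel_at ?L2 (- int n) (int n + 1)"
    unfolding topspace_config_top by blast
  have "k (seq_shift 1 a) i = k a (i + 1)" if a: "a \<in> \<Lambda>1" and i: "int n + 1 \<le> i" for a i
  proof -
    obtain x where x: "x \<in> configs ?L1" "labels ?L1 x = a"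
      using L1.labels_surj[OF a] by blast
    have "labels ?L2 (config_shift 1 (h x)) i = labels ?L2 (h (config_shift 1 x)) i"
      using Rel_at_labels(2)[OF n[OF x(1), unfolded \<psi>_def] i] .
    moreover have "labels ?L2 (h (config_shift 1 x)) = k (labels ?L1 (config_shift 1 x))"
      using lab[OF config_shift_configs[OF x(1)]] by simp
    moreover have "labels ?L1 (config_shift 1 x) = seq_shift 1 a"
      by (rule ext) (simp add: labels_config_shift seq_shift_def x(2))
    moreover have "labels ?L2 (config_shift 1 (h x)) i = k a (i + 1)"
      using lab[OF x(1)] x(2) by (simp add: labels_config_shift)
    ultimately show ?thesis
      by simp
  qed
  then show ?thesis
    unfolding tail_equivariant_def by blast
qed (simp add: tail_equivariant_def)

theorem proposition7p4:
  fixes S1 :: "'a set" and \<Lambda>1 :: "(int \<Rightarrow> 'a) set"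
    and S2 :: "'b set" and \<Lambda>2 :: "(int \<Rightarrow> 'b) set"
  assumes "subshift S1 \<Lambda>1" and "subshift S2 \<Lambda>2"
  shows "topologically_conjugate S1 \<Lambda>1 S2 \<Lambda>2 \<longleftrightarrow>
    (\<exists>\<phi> h h\<^sub>\<Lambda>.
       groupoid_iso (Gpd (canonical \<Lambda>1)) (Gpd (canonical \<Lambda>2)) \<phi> \<and>
       homeomorphic_map (shift_top S1 \<Lambda>1) (shift_top S2 \<Lambda>2) h\<^sub>\<Lambda> \<and>
       \<phi> ` Rel_in_Gpd (canonical \<Lambda>1) = Rel_in_Gpd (canonical \<Lambda>2) \<and>
       (\<forall>x\<in>configs (canonical \<Lambda>1). \<phi> (unit_of x) = unit_of (h x)) \<and>
       (\<forall>x\<in>configs (canonical \<Lambda>1). h\<^sub>\<Lambda> (labels (canonical \<Lambda>1) x) = labels (canonical \<Lambda>2) (h x)) \<and>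
       (\<forall>g\<in>arrows (Gpd (canonical \<Lambda>1)). gpd_degree (\<phi> g) = gpd_degree g))"
    (is "?conjugate \<longleftrightarrow> ?isomorphic")
proof
  assume ?conjugate
  then obtain g where conj: "homeomorphic_map (shift_top S1 \<Lambda>1) (shift_top S2 \<Lambda>2) g"
    "\<And>a. a \<in> \<Lambda>1 \<Longrightarrow> g (seq_shift 1 a) = seq_shift 1 (g a)"
    unfolding topologically_conjugate_def by blast
  obtain g' m where "block_conjugacy S1 \<Lambda>1 S2 \<Lambda>2 g g' m"
    using block_conjugacy_exists[OF assms conj] by blast
  then interpret block_conjugacy S1 \<Lambda>1 S2 \<Lambda>2 g g' m .
  show ?isomorphic
  proof (intro exI conjI ballI)
    show "push_arrow (unit_of x) = unit_of (push x)" for x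
      by (simp add: push_arrow_def unit_of_def)
  qed (rule groupoid_iso_push_arrow conj(1) labels_push[symmetric] gpd_degree_push_arrow)+
next
  assume ?isomorphic
  then obtain \<phi> h k where iso: "groupoid_iso (Gpd (canonical \<Lambda>1)) (Gpd (canonical \<Lambda>2)) \<phi>"
    and k: "homeomorphic_map (shift_top S1 \<Lambda>1) (shift_top S2 \<Lambda>2) k"
    and unit: "\<And>x. x \<in> configs (canonical \<Lambda>1) \<Longrightarrow> \<phi> (unit_of x) = unit_of (h x)"
    and lab: "\<And>x. x \<in> configs (canonical \<Lambda>1) \<Longrightarrow> k (labels (canonical \<Lambda>1) x) = labels (canonical \<Lambda>2) (h x)"
    and deg: "\<And>w. w \<in> Gpd_arrows (canonical \<Lambda>1) \<Longrightarrow> gpd_degree (\<phi> w) = gpd_degree w"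
    unfolding Gpd_sel by blast
  let ?L1 = "canonical \<Lambda>1" and ?L2 = "canonical \<Lambda>2"
  have arrow: "\<phi> (x, n, z) = (h x, n, h z)" if "(x, n, z) \<in> Gpd_arrows ?L1" for x n z
    using iso unit deg that by (rule groupoid_iso_arrow)
  obtain \<phi>' where \<phi>': "homeomorphic_maps (gtop (Gpd ?L1)) (gtop (Gpd ?L2)) \<phi> \<phi>'"
    using iso homeomorphic_map_maps unfolding groupoid_iso_def by blast
  have c: "continuous_map (gtop (Gpd ?L1)) (gtop (Gpd ?L2)) \<phi>" "continuous_map (gtop (Gpd ?L2)) (gtop (Gpd ?L1)) \<phi>'"
    and \<phi>\<phi>': "\<And>w. w \<in> Gpd_arrows ?L2 \<Longrightarrow> \<phi> (\<phi>' w) = w"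
    and \<phi>'\<phi>: "\<And>w. w \<in> Gpd_arrows ?L1 \<Longrightarrow> \<phi>' (\<phi> w) = w"
    using \<phi>' unfolding homeomorphic_maps_def topspace_gtop_Gpd by simp_all
  obtain k' where k': "homeomorphic_maps (shift_top S1 \<Lambda>1) (shift_top S2 \<Lambda>2) k k'"
    using k homeomorphic_map_maps by blast
  then have k'k: "k' (k a) = a" if "a \<in> \<Lambda>1" for a
    using that by (simp add: homeomorphic_maps_def topspace_shift_top assms)
  interpret L1: canonical_system \<Lambda>1
    by unfold_locales (rule subshift_invariant[OF assms(1)])
  have inj: "inj_on h (configs ?L1)"
  proof (rule inj_onI)
    fix x y assume xy: "x \<in> configs ?L1" "y \<in> configs ?L1" "h x = h y"
    then have "unit_of x = unit_of y"
      using \<phi>'\<phi>[OF unit_of_mem_Gpd] unit by metis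
    then show "x = y"
      by (simp add: unit_of_def)
  qed
  \<comment> \<open>The inverse of \<open>\<phi>\<close> has the same form, with \<open>h\<close> inverted.\<close>
  define h' where "h' = inv_into (configs ?L1) h"
  have arrow': "\<phi>' (x, n, z) = (h' x, n, h' z) \<and> h' x \<in> configs ?L1 \<and> h (h' x) = x"
    if w: "(x, n, z) \<in> Gpd_arrows ?L2" for x n z
  proof -
    obtain p m q where pq: "\<phi>' (x, n, z) = (p, m, q)"
      using prod_cases3 by blast
    have mem: "(p, m, q) \<in> Gpd_arrows ?L1"
      using funcset_mem[OF continuous_map_funspace[OF c(2), unfolded topspace_gtop_Gpd] w] pq by simp
    then have "(h p, m, h q) = (x, n, z)"
      using arrow[OF mem] \<phi>\<phi>'[OF w] pq by simp
    moreover have "p \<in> configs ?L1" "q \<in> configs ?L1"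
      using mem by (simp_all add: mem_Gpd_arrows)
    ultimately show ?thesis
      using pq inj by (auto simp: h'_def)
  qed
  have lab': "k' (labels ?L2 z) = labels ?L1 (h' z)" if z: "z \<in> configs ?L2" for z
  proof -
    have "h' z \<in> configs ?L1" "h (h' z) = z"
      using arrow'[of z 0 z] unit_of_mem_Gpd[OF z] by (simp_all add: unit_of_def)
    then show ?thesis
      using lab[of "h' z"] k'k[OF L1.labels_mem[OF assms(1), of "h' z"]] by simp
  qed
  have "\<exists>N. tail_equivariant \<Lambda>2 N k'"
  proof (rule tail_equivariant_if_arrow_map[OF assms(2,1) c(2)])
    show "\<phi>' (x, n, z) = (h' x, n, h' z)" if "(x, n, z) \<in> Gpd_arrows ?L2" for x n z
      using arrow'[OF that] by simp
  qed (rule lab')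
  moreover have "\<exists>M. tail_equivariant \<Lambda>1 M k"
    by (rule tail_equivariant_if_arrow_map[OF assms c(1) arrow lab])
  ultimately show ?conjugate
    using topologically_conjugate_if_tail_equivariant[OF assms k'] by blast
qed

end
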